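(* Let $\boldsymbol f=(f_R,f_B)$ be the maximal solution on $[0,\kappa_{\boldsymbol f})$ of the Cauchy problem $$\boldsymbol f'(x)=\frac{\boldsymbol\beta(\boldsymbol f(x))}{\beta_R(\boldsymbol f(x))+\beta_B(\boldsymbol f(x))},\quad x\in(0,\kappa_{\boldsymbol f}),\qquad \boldsymbol f(0)=(0,0),$$ where $\boldsymbol\beta=(\beta_R,\beta_B)$. For every $\kappa<\kappa_{\boldsymbol f}$, $$\sup_{x\in[0,\kappa]}\|\boldsymbol F_n(x)-\boldsymbol f(x)\|\to 0\qquad\text{almost surely, as } n\to\infty,$$ where $\boldsymbol F_n(x)=(\widetilde N_R(xq)/q,\ \widetilde N_B(xq)/q)$ is the rescaled linear interpolation of the numbers of red and black activations.
   Context: Asymptotic setting. All limits are as $n\to\infty$; $a_n\ll b_n$ means $a_n=o(b_n)$. Fix a constant integer $r\ge2$; $p=p_n\in(0,1)$ with $\frac1n\ll p\ll\frac1{n^{1/r}\log n}$; $g=g_n:=(1-\frac1r)\big(\frac{(r-1)!}{np^r}\big)^{1/(r-1)}$. The sequence $q=q_n$ is in one of four regimes: $q=g$; $g\ll q\ll p^{-1}$; $q=p^{-1}$; $p^{-1}\ll q\ll n$. The seed numbers $a_R,a_B$ (integers depending on $n$) satisfy $a_R/q\to\alpha_R$, $a_B/q\to\alpha_B$ with constants $\alpha_R>\alpha_B>0$. For $S\in\{R,B\}$, $\overline S$ is the other color. Functions $\beta_S$ on $[0,\infty)^2$: $\beta_S(x_R,x_B)$ equals - $r^{-1}(1-r^{-1})^{r-1}(x_S+\alpha_S)^r-x_S$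 if $q=g$; - $\frac1{r!}(x_S+\alpha_S)^r$ if $g\ll q\ll p^{-1}$; - $\sum_{r'=r}^\infty\sum_{r''=0}^{r'-r}\frac{(x_S+\alpha_S)^{r'}}{r'!}\frac{(x_{\overline S}+\alpha_{\overline S})^{r''}}{r''!}e^{-(x_R+x_B+\alpha_R+\alpha_B)}$ if $q=p^{-1}$; - $1$ if $\frac{x_S+\alpha_S}{x_R+\alpha_R+x_B+\alpha_B}\ge\frac12$ and $0$ otherwise, if $p^{-1}\ll q\ll n$. Process (for each $n$, independent over $n$, all on one probability space). It represents competing bootstrap percolation on the Erdős–Rényi graph $G(n,p)$ started from $a_R$ red and $a_B$ black uniformly random seeds. Let $\mathcal V_W$ be the set of $n_W=n-a_R-a_B$ non-seed nodes, initially white. Each $v\in\mathcal V_W$ has an independent unit-rate Poisson clock. Independently, let $E_i^{S,(v)}$ ($i\ge1$, $S\in\{R,B\}$, $v\in\mathcal V_W$) be i.i.d. Bernoulli($p$) ($E^{S,(v)}_i$ indicates an edge between $v$ and the $i$-th node of color $S$, seeds counted first), and $L_k$ ($k\ge1$) i.i.d. uniform on $(0,1)$, independent of everything else. Let $\mathcal V_S(t)$ be the set of non-seed nodes of color $S$ at time $t$, $N_S(t)=|\mathcal V_S(t)|$, $\mathcal V_W(t)=\mathcal V_W\setminus(\mathcal V_R(t)\cup\mathcal V_B(t))$ the white nodes, $D_S^{(v)}(t)=\sum_{i=1}^{N_S(t)+a_S}E_i^{S,(v)}$, $\mathcal S_S(t)=\{v\in\mathcal V_W: D_S^{(v)}(t)-D_{\overline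 S}^{(v)}(t)\ge r\}$, $\mathcal S(t)=\mathcal S_R(t)\cup\mathcal S_B(t)$. When the clock of a white node $v$ rings at time $t$ and $v\in\mathcal S_S(t^-)$, it takes color $S$ permanently; otherwise it stays white. Let $T_k$ be the time of the $k$-th activation, $T_0=0$, and $K^*=\min\{k\ge0:\mathcal S(T_k)\cap\mathcal V_W(T_k)=\emptyset\}$ the index at which the process naturally stops. Extension beyond $T_{K^*}$: after time $T_{K^*}$ every white node whose clock rings is activated; if this is the $(k+1)$-th activation ($k\ge K^*$) it gets color $R$ if $L_{k+1}<U^R_{k+1}$ and color $B$ otherwise ($U$ defined below). All quantities $N_S,T_k,\dots$ refer to this extended process. The notation $[k]$ means "evaluated at $T_k$" for $0\le k\le n_W$, and quantities are frozen at their value for $k=n_W$ when $k>n_W$ (with $T_k=\infty$). Define $$Q^S_{k+1}=|\mathcal S_S[k]|-N_S[k]+\big|(\mathcal V_W\setminus\mathcal S_S[k])\cap\mathcal V_S[k]\cap\{v:D_S^{(v)}[k]\ge r\}\big|-\big|\mathcal S_S[k]\cap\mathcal V_{\overline S}[k]\cap\{v:D_{\overline S}^{(v)}[k]\ge r\}\big|,$$ $U^S_{k+1}=\frac{|Q^S_{k+1}|}{|Q^R_{k+1}|+|Q^B_{k+1}|}$ with $0/0:=1/2$ (for $k\le K^*$, $Q^S_{k+1}=|\mathcal V_W[k]\cap\mathcal S_S[k]|$). Interpolation: $\widetilde N_S(xq):=N_S[\lfloor xq\rfloor]+(xq-\lfloor xq\rfloor)\big(N_S[\lceil xq\rceil]-N_S[\lfloor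 xq\rfloor]\big)$, $x\ge0$. $\|\cdot\|$ is the Euclidean norm on $\mathbb R^2$. *)

theory Defs
  imports "HOL-Probability.Probability" "HOL-Library.Landau_Symbols"
begin

datatype color = Red | Black

fun other :: "color \<Rightarrow> color" where
  "other Red = Black"
| "other Black = Red"

fun component :: "color \<Rightarrow> real \<times> real \<Rightarrow> real" where
  "component Red x = fst x"
| "component Black x = snd x"


section \<open>Regimes and the Cauchy problem\<close>

definition g_seq :: "nat \<Rightarrow> (nat \<Rightarrow> real) \<Rightarrow> nat \<Rightarrow> real" where
  "g_seq r p n = (1 - 1 / real r) * (fact (r - 1) / (real n * p n ^ r)) powr (1 / (real r - 1))"

datatype regime = Critical | Intermediate | Inverse_p | Beyond

fun in_regime :: "regime \<Rightarrow> nat \<Rightarrow> (nat \<Rightarrow> real) \<Rightarrow> (nat \<Rightarrow> real) \<Rightarrow> bool" where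
  "in_regime Critical r p q \<longleftrightarrow> (\<forall>n\<ge>1. q n = g_seq r p n)"
| "in_regime Intermediate r p q \<longleftrightarrow> g_seq r p \<in> o(q) \<and> q \<in> o(\<lambda>n. 1 / p n)"
| "in_regime Inverse_p r p q \<longleftrightarrow> (\<forall>n\<ge>1. q n = 1 / p n)"
| "in_regime Beyond r p q \<longleftrightarrow> (\<lambda>n. 1 / p n) \<in> o(q) \<and> q \<in> o(\<lambda>n. real n)"

text \<open>In the regime \<^term>\<open>Inverse_p\<close> the outer sum is shifted, \<open>r' = r + j\<close> and \<open>r'' = i\<close>.\<close>

fun beta :: "regime \<Rightarrow> nat \<Rightarrow> (color \<Rightarrow> real) \<Rightarrow> color \<Rightarrow> real \<times> real \<Rightarrow> real" where
  "beta Critical r \<alpha> S x =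
     1 / real r * (1 - 1 / real r) ^ (r - 1) * (component S x + \<alpha> S) ^ r - component S x"
| "beta Intermediate r \<alpha> S x = 1 / fact r * (component S x + \<alpha> S) ^ r"
| "beta Inverse_p r \<alpha> S x =
     (\<Sum>j. \<Sum>i=0..j. (component S x + \<alpha> S) ^ (r + j) / fact (r + j)
        * ((component (other S) x + \<alpha> (other S)) ^ i / fact i)
        * exp (- (component Red x + component Black x + \<alpha> Red + \<alpha> Black)))"
| "beta Beyond r \<alpha> S x =
     (if (component S x + \<alpha> S) / (component Red x + \<alpha> Red + component Black x + \<alpha> Black) \<ge> 1 / 2
      then 1 else 0)"

text \<open>Solutions of \<open>f' = b(f) / (b\<^sub>R(f) + b\<^sub>B(f))\<close>, \<open>f(0) = (0, 0)\<close> on \<open>[0, K)\<close> for a field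
  \<open>b\<close> on \<open>[0, \<infinity>)\<^sup>2\<close>, where \<open>0 < K \<le> \<infinity>\<close>.  Since division is total in HOL, the denominator is
  explicitly required not to vanish along the solution.\<close>

definition cauchy_solution ::
  "(color \<Rightarrow> real \<times> real \<Rightarrow> real) \<Rightarrow> ereal \<Rightarrow> (real \<Rightarrow> real \<times> real) \<Rightarrow> bool" where
  "cauchy_solution b K f \<longleftrightarrow>
     0 < K \<and> f 0 = (0, 0) \<and>
     continuous_on {x. 0 \<le> x \<and> ereal x < K} f \<and>
     (\<forall>x. 0 \<le> x \<and> ereal x < K \<longrightarrow> fst (f x) \<ge> 0 \<and> snd (f x) \<ge> 0) \<and>
     (\<forall>x. 0 < x \<and> ereal x < K \<longrightarrow>
        b Red (f x) + b Black (f x) \<noteq> 0 \<and>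
        (f has_vector_derivative
           (b Red (f x) / (b Red (f x) + b Black (f x)),
            b Black (f x) / (b Red (f x) + b Black (f x)))) (at x))"

definition maximal_cauchy_solution ::
  "(color \<Rightarrow> real \<times> real \<Rightarrow> real) \<Rightarrow> ereal \<Rightarrow> (real \<Rightarrow> real \<times> real) \<Rightarrow> bool" where
  "maximal_cauchy_solution b K f \<longleftrightarrow>
     cauchy_solution b K f \<and>
     (\<forall>K' h. cauchy_solution b K' h \<and> K \<le> K' \<and> (\<forall>x. 0 \<le> x \<and> ereal x < K \<longrightarrow> h x = f x)
        \<longrightarrow> K' = K)"


section \<open>The process for one realization of clocks, edges and tie-breakers\<close>

text \<open>The sets \<open>\<V>\<^sub>S(t)\<close>, and with them \<open>D\<close> and \<open>\<S>\<close>, only change at activations.  The process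
  is therefore given by its states at the activation times \<open>T\<^sub>k\<close>, and on the interval
  \<open>(T\<^sub>k, T\<^sub>k\<^sub>+\<^sub>1]\<close> the left limit \<open>\<S>\<^sub>S(t\<^sup>-)\<close> is the value at \<open>T\<^sub>k\<close>.\<close>

record state =
  time :: ereal
  colored :: "color \<Rightarrow> nat set"

text \<open>The non-seed nodes are \<open>0, \<dots>, nW - 1\<close>; \<open>ring v\<close> is the set of ringing times of the clock
  of \<open>v\<close>; \<open>E S v i\<close> and \<open>L k\<close> are used for \<open>i \<ge> 1\<close> and \<open>k \<ge> 1\<close> only.\<close>

locale percolation =
  fixes r nW :: nat
    and a :: "color \<Rightarrow> nat"
    and ring :: "nat \<Rightarrow> real set"
    and E :: "color \<Rightarrow> nat \<Rightarrow> nat \<Rightarrow> real"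
    and L :: "nat \<Rightarrow> real"
begin

definition VW :: "nat set" where
  "VW = {..<nW}"

definition N :: "state \<Rightarrow> color \<Rightarrow> nat" where
  "N s S = card (colored s S)"

definition white :: "state \<Rightarrow> nat set" where
  "white s = VW - (colored s Red \<union> colored s Black)"

definition D :: "state \<Rightarrow> color \<Rightarrow> nat \<Rightarrow> real" where
  "D s S v = (\<Sum>i = 1..N s S + a S. E S v i)"

definition susceptible_to :: "state \<Rightarrow> color \<Rightarrow> nat set" where
  "susceptible_to s S = {v \<in> VW. D s S v - D s (other S) v \<ge> real r}"

definition susceptible :: "state \<Rightarrow> nat set" where
  "susceptible s = susceptible_to s Red \<union> susceptible_to s Black"

text \<open>If \<open>s\<close> is the state at \<open>T\<^sub>k\<close>, then \<open>Q s S\<close> and \<open>U s S\<close> are \<open>Q\<^sup>S\<close> and \<open>U\<^sup>S\<close> with index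
  \<open>k + 1\<close>.\<close>

definition Q :: "state \<Rightarrow> color \<Rightarrow> int" where
  "Q s S = int (card (susceptible_to s S)) - int (N s S)
     + int (card ((VW - susceptible_to s S) \<inter> colored s S \<inter> {v. D s S v \<ge> real r}))
     - int (card (susceptible_to s S \<inter> colored s (other S) \<inter> {v. D s (other S) v \<ge> real r}))"

definition U :: "state \<Rightarrow> color \<Rightarrow> real" where
  "U s S = (if \<bar>Q s Red\<bar> + \<bar>Q s Black\<bar> = 0 then 1 / 2
            else real_of_int \<bar>Q s S\<bar> / real_of_int (\<bar>Q s Red\<bar> + \<bar>Q s Black\<bar>))"

definition next_ring :: "ereal \<Rightarrow> nat \<Rightarrow> ereal" where
  "next_ring t v = Inf {u \<in> ereal ` ring v. t < u}"

text \<open>The node of the finite nonempty set \<open>A\<close> whose clock rings first after the current time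
  takes the color given by \<open>col\<close>.  Almost surely there are no simultaneous rings.\<close>

definition activate :: "nat set \<Rightarrow> (nat \<Rightarrow> color) \<Rightarrow> state \<Rightarrow> state" where
  "activate A col s =
     (let v = arg_min_on (next_ring (time s)) A
      in \<lparr>time = next_ring (time s) v,
          colored = (colored s)(col v := insert v (colored s (col v)))\<rparr>)"

definition initial :: state where
  "initial = \<lparr>time = 0, colored = (\<lambda>_. {})\<rparr>"

definition natural_step :: "state \<Rightarrow> state" where
  "natural_step s =
     (if susceptible s \<inter> white s = {} then s
      else activate (susceptible s \<inter> white s)
             (\<lambda>v. if v \<in> susceptible_to s Red then Red else Black) s)"

definition natural_process :: "nat \<Rightarrow> state" where
  "natural_process k = (natural_step ^^ k) initial"

definition K_star :: nat where
  "K_star = (LEAST k. susceptible (natural_process k) \<inter> white (natural_process k) = {})"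

text \<open>The step from \<open>T\<^sub>k\<close> to \<open>T\<^sub>k\<^sub>+\<^sub>1\<close> for \<open>k \<ge> K_star\<close>; everything is frozen once no white node is
  left.\<close>

definition extension_step :: "nat \<Rightarrow> state \<Rightarrow> state" where
  "extension_step k s =
     (if white s = {} then s\<lparr>time := \<infinity>\<rparr>
      else activate (white s) (\<lambda>_. if L (Suc k) < U s Red then Red else Black) s)"

primrec process :: "nat \<Rightarrow> state" where
  "process 0 = initial"
| "process (Suc k) =
     (if k < K_star then natural_step (process k) else extension_step k (process k))"

end


section \<open>The random inputs\<close>

text \<open>\<open>Gap n v j\<close>: the \<open>j\<close>-th inter-arrival time (\<open>j \<ge> 0\<close>) of the Poisson clock of node \<open>v\<close>;
  \<open>Edge n S v i\<close>: the Bernoulli variable \<open>E\<^sub>i\<close> of color \<open>S\<close> and node \<open>v\<close>; \<open>Tie n k\<close>: the uniform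
  variable \<open>L\<^sub>k\<close>.  The first argument is the size \<open>n\<close> of the graph.\<close>

datatype input =
    Gap nat nat nat
  | Edge nat color nat nat
  | Tie nat nat

definition n_W :: "(color \<Rightarrow> nat \<Rightarrow> nat) \<Rightarrow> nat \<Rightarrow> nat" where
  "n_W a n = n - a Red n - a Black n"

definition inputs :: "(color \<Rightarrow> nat \<Rightarrow> nat) \<Rightarrow> input set" where
  "inputs a =
     {Gap n v j | n v j. n \<ge> 1 \<and> v < n_W a n}
     \<union> {Edge n S v i | n S v i. n \<ge> 1 \<and> v < n_W a n \<and> i \<ge> 1}
     \<union> {Tie n k | n k. n \<ge> 1 \<and> k \<ge> 1}"

fun law :: "(nat \<Rightarrow> real) \<Rightarrow> input \<Rightarrow> real measure" where
  "law p (Gap n v j) = density lborel (exponential_density 1)"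
| "law p (Edge n S v i) = distr (measure_pmf (bernoulli_pmf (p n))) borel of_bool"
| "law p (Tie n k) = uniform_measure lborel {0<..<1}"

text \<open>Joint independence over all inputs includes independence over \<open>n\<close>.\<close>

definition percolation_inputs ::
  "'a measure \<Rightarrow> (nat \<Rightarrow> real) \<Rightarrow> (color \<Rightarrow> nat \<Rightarrow> nat) \<Rightarrow> (input \<Rightarrow> 'a \<Rightarrow> real) \<Rightarrow> bool" where
  "percolation_inputs M p a X \<longleftrightarrow>
     prob_space M \<and>
     prob_space.indep_vars M (\<lambda>_. borel) X (inputs a) \<and>
     (\<forall>i\<in>inputs a. distr M borel (X i) = law p i)"

definition activations ::
  "nat \<Rightarrow> (color \<Rightarrow> nat \<Rightarrow> nat) \<Rightarrow> (input \<Rightarrow> 'a \<Rightarrow> real) \<Rightarrow> nat \<Rightarrow> 'a \<Rightarrow> color \<Rightarrow> nat \<Rightarrow> nat" where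
  "activations r a X n \<omega> S k =
     percolation.N
       (percolation.process r (n_W a n) (\<lambda>S. a S n)
          (\<lambda>v. range (\<lambda>m. \<Sum>j\<le>m. X (Gap n v j) \<omega>))
          (\<lambda>S v i. X (Edge n S v i) \<omega>)
          (\<lambda>k. X (Tie n k) \<omega>) k) S"

definition interpolate :: "(nat \<Rightarrow> nat) \<Rightarrow> real \<Rightarrow> real" where
  "interpolate N y =
     real (N (nat \<lfloor>y\<rfloor>))
     + (y - real_of_int \<lfloor>y\<rfloor>) * (real (N (nat \<lceil>y\<rceil>)) - real (N (nat \<lfloor>y\<rfloor>)))"

definition F ::
  "nat \<Rightarrow> (color \<Rightarrow> nat \<Rightarrow> nat) \<Rightarrow> (nat \<Rightarrow> real) \<Rightarrow> (input \<Rightarrow> 'a \<Rightarrow> real)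
     \<Rightarrow> nat \<Rightarrow> 'a \<Rightarrow> real \<Rightarrow> real \<times> real" where
  "F r a q X n \<omega> x =
     (interpolate (activations r a X n \<omega> Red) (x * q n) / q n,
      interpolate (activations r a X n \<omega> Black) (x * q n) / q n)"

end

theory Submission
  imports Defs
begin

text \<open>Only the process up to its natural stopping index matters: it does not stop before the time
  horizon \<open>\<kappa> q\<close>.  Conditionally on the edges, the Poisson clocks choose the next node uniformly among
  the susceptible white ones (the clocks, restarted at a ring, are again independent Poisson clocks,
  also of the node that rang), so the number of red activations minus the sum of the fractions of
  susceptible nodes that are red has sub-Gaussian deviations.  The numbers of susceptible nodes are
  sums of independent indicators for fixed numbers of active nodes; by Chernoff bounds and a union
  bound over all such numbers they are close to their means, which are asymptotically proportional to
  \<open>\<beta>\<^sub>R\<close> and \<open>\<beta>\<^sub>B\<close>.  Hence the number of red activations is a perturbed Euler scheme for the Cauchy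
  problem, and a discrete Gronwall inequality keeps it near the solution.  All error probabilities
  are \<open>O(n\<^sup>2 exp(- c q))\<close> with \<open>q \<ge> g\<close> and \<open>g / log n \<rightarrow> \<infinity>\<close>, so the Borel-Cantelli lemma applies.\<close>

text \<open>The deviation is a martingale, but no filtration is set up for it. Its exponential
  moments are bounded by first-step analysis: after the first ring the restarted clocks have their
  original law and are independent of the node that rang, so an induction on the number of steps,
  from an arbitrary coloring, suffices. This needs a fixed eligibility rule; as a function of the
  coloring the rule takes finitely many values when the edges vary, so conditioning on the edges is
  a finite sum. The counts of nodes are instead controlled for all deterministic pairs of counts at
  once, so that the dependence of the process on the edges costs a union bound only. The drift is
  comparable with \<open>beta\<close> only near the solution (for \<open>Beyond\<close> the field
  jumps where the colors balance), so staying in a tube and not stopping are proved in one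
  induction. The components of the solution add up to the time, and so do the rescaled counts; hence
  one color is tracked. For \<open>Critical\<close> the active and the susceptible nodes are both of
  order \<open>q\<close>, whence the negative term of \<open>beta\<close> and the separate control
  of nodes with \<open>r + 1\<close> active neighbors.\<close>

section \<open>Differences of binomial variables\<close>

text \<open>\<open>bindiff p m m' l\<close> is the probability of \<open>X - Y \<ge> l\<close> for independent binomial variables
  \<open>X\<close> and \<open>Y\<close> with parameters \<open>(m, p)\<close> and \<open>(m', p)\<close>.  The recursion conditions on one trial and turns
  the estimates below into inductions.\<close>

fun bindiff :: "real \<Rightarrow> nat \<Rightarrow> nat \<Rightarrow> int \<Rightarrow> real" where
  "bindiff p 0 0 l = of_bool (l \<le> 0)"
| "bindiff p 0 (Suc m') l = (1 - p) * bindiff p 0 m' l + p * bindiff p 0 m' (l + 1)"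
| "bindiff p (Suc m) m' l = (1 - p) * bindiff p m m' l + p * bindiff p m m' (l - 1)"

lemma convex_comb_le:
  fixes p x y c :: real
  assumes "0 \<le> p" "p \<le> 1" "x \<le> c" "y \<le> c"
  shows "(1 - p) * x + p * y \<le> c"
  using convex_bound_le[of x c y "1 - p" p] assms by simp

lemma bindiff_nonneg: "0 \<le> p \<Longrightarrow> p \<le> 1 \<Longrightarrow> 0 \<le> bindiff p m m' l"
  by (induction p m m' l rule: bindiff.induct) auto

lemma bindiff_le_1: "0 \<le> p \<Longrightarrow> p \<le> 1 \<Longrightarrow> bindiff p m m' l \<le> 1"
  by (induction p m m' l rule: bindiff.induct) (auto intro!: convex_comb_le)

text \<open>Union bound over the \<open>l\<close>-subsets of the \<open>m\<close> positive trials,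
  one of which must succeed completely; negative trials can only lower the difference. In the
  induction this is Pascal's rule.\<close>

lemma bindiff_upper_choose:
  assumes p: "0 \<le> p" "p \<le> 1"
  shows "bindiff p m m' (int l) \<le> real (m choose l) * p ^ l"
proof (induction m arbitrary: l)
  case 0
  have *: "bindiff p 0 m' i \<le> of_bool (i \<le> 0)" for i
  proof (induction m' arbitrary: i)
    case (Suc m')
    have "of_bool (i + 1 \<le> 0) \<le> (of_bool (i \<le> 0) :: real)" by auto
    then show ?case
      using convex_comb_le[OF p Suc[of i] order.trans[OF Suc[of "i + 1"]]] by simp
  qed simp
  show ?case using *[of "int l"] by (cases l) auto
next
  case (Suc m)
  show ?case
  proof (cases l)
    case 0
    then show ?thesis using bindiff_le_1[OF p, of "Suc m" m' 0] by simp
  next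
    case (Suc l')
    have "bindiff p (Suc m) m' (int l) = (1 - p) * bindiff p m m' (int l) + p * bindiff p m m' (int l')"
      using Suc by simp
    also have "\<dots> \<le> 1 * (real (m choose l) * p ^ l) + p * (real (m choose l') * p ^ l')"
      using p Suc.IH[of l] Suc.IH[of l'] bindiff_nonneg[OF p, of m m' "int l"] bindiff_nonneg[OF p, of m m' "int l'"]
      by (intro add_mono mult_mono) auto
    also have "\<dots> = real (Suc m choose l) * p ^ l"
      using Suc by (simp add: algebra_simps)
    finally show ?thesis .
  qed
qed

text \<open>Exactly \<open>l\<close> positive and no negative successes suffice. Their probability
  has the exponent \<open>m - l + m'\<close> of \<open>1 - p\<close>; the cruder
  \<open>m + m'\<close> avoids truncated subtraction in the induction.\<close>

lemma bindiff_lower_choose: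
  assumes p: "0 \<le> p" "p \<le> 1"
  shows "real (m choose l) * p ^ l * (1 - p) ^ (m + m') \<le> bindiff p m m' (int l)"
proof (induction m arbitrary: l)
  case 0
  have "(1 - p) ^ m' \<le> bindiff p 0 m' 0"
  proof (induction m')
    case (Suc m')
    then have "(1 - p) * (1 - p) ^ m' \<le> (1 - p) * bindiff p 0 m' 0"
      using p by (intro mult_left_mono) auto
    moreover have "0 \<le> p * bindiff p 0 m' 1"
      using p bindiff_nonneg[OF p] by auto
    ultimately show ?case by simp
  qed simp
  then show ?case using bindiff_nonneg[OF p, of 0 m' "int l"] by (cases l) auto
next
  case (Suc m)
  have one: "(1 - p) ^ (Suc m + m') \<le> (1 - p) ^ (m + m')"
    using p by (intro power_decreasing) auto
  have A: "real (m choose l) * p ^ l * (1 - p) ^ (Suc m + m') \<le> (1 - p) * bindiff p m m' (int l)"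
    using mult_left_mono[OF Suc[of l], of "1 - p"] p by (simp add: mult_ac)
  show ?case
  proof (cases l)
    case 0
    then show ?thesis using A bindiff_nonneg[OF p, of m m' "-1"] p by (simp add: add_increasing2)
  next
    case (Suc l')
    have "real (m choose l') * p ^ l * (1 - p) ^ (Suc m + m') \<le> real (m choose l') * p ^ l * (1 - p) ^ (m + m')"
      using one p by (intro mult_left_mono) auto
    also have "\<dots> \<le> p * bindiff p m m' (int l')"
      using mult_left_mono[OF Suc.IH[of l'], of p] p Suc by (simp add: mult_ac)
    finally show ?thesis using A Suc by (simp add: algebra_simps)
  qed
qed

lemma mgf_step:
  fixes p z :: real
  assumes "0 \<le> p" "p \<le> 1" "z > 0"
  shows "1 - p + p * z \<le> exp (p * (z - 1))"
  using exp_ge_add_one_self[of "p * (z - 1)"] by (simp add: algebra_simps)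

text \<open>One trial of a Chernoff bound: conditional bounds whose exponents differ by
  \<open>t\<close> combine into a bound with one more factor \<open>exp (p * (exp t - 1))\<close>,
  which dominates the moment generating function of a Bernoulli variable.\<close>

lemma exp_convex_step:
  fixes p t u c :: real
  assumes p: "0 \<le> p" "p \<le> 1" and x: "x \<le> exp c * X" and y: "y \<le> exp (c + t) * X" and "X \<ge> 0"
  shows "(1 - p) * x + p * y \<le> exp c * (exp (p * (exp t - 1)) * X)"
proof -
  have "(1 - p) * x + p * y \<le> (1 - p) * (exp c * X) + p * (exp (c + t) * X)"
    using p x y by (intro add_mono mult_left_mono) auto
  also have "\<dots> = (exp c * X) * (1 - p + p * exp t)"
    by (simp add: algebra_simps exp_add)
  also have "\<dots> \<le> (exp c * X) * exp (p * (exp t - 1))"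
    using mgf_step[OF p, of "exp t"] \<open>X \<ge> 0\<close> by (intro mult_left_mono) auto
  finally show ?thesis by (simp add: mult_ac)
qed

text \<open>Markov's inequality for \<open>exp (t * (X - Y))\<close>: positive trials are tilted by
  \<open>t\<close>, negative ones by \<open>- t\<close>.\<close>

lemma bindiff_upper_exp:
  assumes p: "0 \<le> p" "p \<le> 1" and "0 \<le> t"
  shows "bindiff p m m' l \<le> exp (- t * real_of_int l)
           * (exp (p * (exp t - 1)) ^ m * exp (p * (exp (-t) - 1)) ^ m')"
proof (induction m arbitrary: l)
  case 0
  show ?case
  proof (induction m' arbitrary: l)
    case 0
    have "0 \<le> - (t * real_of_int l)" if "l \<le> 0"
      using that \<open>0 \<le> t\<close> by (simp add: mult_nonneg_nonpos)
    then show ?case by auto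
  next
    case (Suc m')
    have "- t * real_of_int l + - t = - t * real_of_int (l + 1)" by (simp add: algebra_simps)
    then show ?case
      using exp_convex_step[OF p Suc.IH[of l], of _ "-t", OF Suc.IH[of "l + 1", unfolded \<open>- t * real_of_int l + - t = _\<close>[symmetric]]]
      by simp
  qed
next
  case (Suc m)
  have eq: "- t * real_of_int (l - 1) = - t * real_of_int l + t" by (simp add: algebra_simps)
  show ?case
    using exp_convex_step[OF p Suc.IH[of l] Suc.IH[of "l - 1", unfolded eq]] by (simp add: mult_ac)
qed

text \<open>Markov's inequality for \<open>exp (- t * (X - Y))\<close>, applied to the event
  \<open>X - Y < l\<close>.\<close>

lemma bindiff_complement_exp:
  assumes p: "0 \<le> p" "p \<le> 1" and "0 \<le> t"
  shows "1 - bindiff p m m' l \<le> exp (t * real_of_int l)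
           * (exp (p * (exp (-t) - 1)) ^ m * exp (p * (exp t - 1)) ^ m')"
proof (induction m arbitrary: l)
  case 0
  show ?case
  proof (induction m' arbitrary: l)
    case 0
    have "0 \<le> t * real_of_int l" if "\<not> l \<le> 0"
      using that \<open>0 \<le> t\<close> by simp
    then show ?case by auto
  next
    case (Suc m')
    have eq: "t * real_of_int (l + 1) = t * real_of_int l + t" by (simp add: algebra_simps)
    show ?case
      using exp_convex_step[OF p Suc.IH[of l] Suc.IH[of "l + 1", unfolded eq]]
      by (simp add: algebra_simps)
  qed
next
  case (Suc m)
  have eq: "t * real_of_int (l - 1) = t * real_of_int l + - t" by (simp add: algebra_simps)
  show ?case
    using exp_convex_step[OF p Suc.IH[of l] Suc.IH[of "l - 1", unfolded eq]]
    by (simp add: algebra_simps)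
qed

section \<open>Sums of independent Bernoulli variables\<close>

text \<open>For negative \<open>x\<close> this follows from \<open>exp x \<le> 1 / (1 - x)\<close>
  and \<open>(1 - x) * (1 + x + x^2) = 1 - x^3 \<ge> 1\<close>.\<close>

lemma exp_le_quadratic:
  fixes x :: real
  assumes "x \<le> 1"
  shows "exp x \<le> 1 + x + x\<^sup>2"
proof (cases "0 \<le> x")
  case True
  then show ?thesis using exp_bound[of x] assms by simp
next
  case False
  have "1 + x + x\<^sup>2 - exp x \<ge> 0"
  proof -
    have "(1 - x) \<le> exp (- x)" using exp_ge_add_one_self[of "-x"] by simp
    then have "exp x \<le> 1 / (1 - x)"
      using False by (simp add: exp_minus field_simps)
    also have "\<dots> \<le> 1 + x + x\<^sup>2"
    proof -
      have "1 \<le> (1 + x + x\<^sup>2) * (1 - x) \<longleftrightarrow> x ^ 3 \<le> 0"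
        by (simp add: algebra_simps power2_eq_square power3_eq_cube)
      then show ?thesis using False by (simp add: pos_divide_le_eq power_le_zero_eq)
    qed
    finally show ?thesis by simp
  qed
  then show ?thesis by simp
qed

context prob_space
begin

lemma prob_bernoulli_distr:
  fixes Z :: "'a \<Rightarrow> real"
  assumes [measurable]: "Z \<in> borel_measurable M"
    and d: "distr M borel Z = distr (measure_pmf (bernoulli_pmf p)) borel of_bool"
    and p: "0 \<le> p" "p \<le> 1"
  shows "prob {\<omega> \<in> space M. Z \<omega> = 1} = p" "prob {\<omega> \<in> space M. Z \<omega> = 0} = 1 - p"
    "AE \<omega> in M. Z \<omega> = 0 \<or> Z \<omega> = 1"
proof -
  have *: "prob {\<omega> \<in> space M. Z \<omega> = c} = measure (measure_pmf (bernoulli_pmf p)) {b. of_bool b = c}" for c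
  proof -
    have "prob {\<omega> \<in> space M. Z \<omega> = c} = measure (distr M borel Z) {c}"
      by (subst measure_distr) (auto intro!: arg_cong[where f=prob])
    also have "\<dots> = measure (measure_pmf (bernoulli_pmf p)) {b. of_bool b = c}"
      unfolding d by (subst measure_distr) (auto intro!: arg_cong[where f="measure _"])
    finally show ?thesis .
  qed
  have "{b. of_bool b = (1::real)} = {True}" "{b. of_bool b = (0::real)} = {False}" by auto
  then show 1: "prob {\<omega> \<in> space M. Z \<omega> = 1} = p" and 0: "prob {\<omega> \<in> space M. Z \<omega> = 0} = 1 - p"
    using p by (simp_all only: *) (simp_all add: measure_pmf_single)
  have "prob ({\<omega> \<in> space M. Z \<omega> = 1} \<union> {\<omega> \<in> space M. Z \<omega> = 0}) = 1"
    by (subst finite_measure_Union) (auto simp: 0 1)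
  then have "AE \<omega> in M. \<omega> \<in> {\<omega> \<in> space M. Z \<omega> = 1} \<union> {\<omega> \<in> space M. Z \<omega> = 0}"
    by (intro AE_prob_1) auto
  then show "AE \<omega> in M. Z \<omega> = 0 \<or> Z \<omega> = 1" by eventually_elim auto
qed

text \<open>Conditioning on \<open>Z\<close> yields the recursion of \<open>bindiff\<close>, with
  \<open>c = 1\<close> for a positive and \<open>c = - 1\<close> for a negative trial.\<close>

lemma prob_bernoulli_step:
  fixes Z Y :: "'a \<Rightarrow> real"
  assumes ind: "indep_var borel Z borel Y"
    and d: "distr M borel Z = distr (measure_pmf (bernoulli_pmf p)) borel of_bool"
    and p: "0 \<le> p" "p \<le> 1"
  shows "prob {\<omega> \<in> space M. t \<le> c * Z \<omega> + Y \<omega>}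
       = (1 - p) * prob {\<omega> \<in> space M. t \<le> Y \<omega>} + p * prob {\<omega> \<in> space M. t - c \<le> Y \<omega>}"
proof -
  have [measurable]: "Z \<in> borel_measurable M" "Y \<in> borel_measurable M"
    using indep_var_rv1[OF ind] indep_var_rv2[OF ind] by auto
  note Z = prob_bernoulli_distr[OF _ d p, simplified]
  have *: "prob {\<omega> \<in> space M. Z \<omega> = z \<and> s \<le> Y \<omega>} = prob {\<omega> \<in> space M. Z \<omega> = z} * prob {\<omega> \<in> space M. s \<le> Y \<omega>}" for z s
    using indep_varD[OF ind, of "{z}" "{s..}"]
    by (simp add: vimage_def Int_def conj_ac)
  have "prob {\<omega> \<in> space M. t \<le> c * Z \<omega> + Y \<omega>}
      = prob ({\<omega> \<in> space M. Z \<omega> = 0 \<and> t \<le> Y \<omega>} \<union> {\<omega> \<in> space M. Z \<omega> = 1 \<and> t - c \<le> Y \<omega>})"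
    using Z(3) by (intro finite_measure_eq_AE) auto
  also have "\<dots> = prob {\<omega> \<in> space M. Z \<omega> = 0 \<and> t \<le> Y \<omega>} + prob {\<omega> \<in> space M. Z \<omega> = 1 \<and> t - c \<le> Y \<omega>}"
    by (intro finite_measure_Union) auto
  finally show ?thesis by (simp add: * Z)
qed

lemma prob_bernoulli_diff:
  fixes X :: "'i \<Rightarrow> 'a \<Rightarrow> real"
  assumes fin: "finite A" "finite B" and "A \<inter> B = {}"
    and ind: "indep_vars (\<lambda>_. borel) X (A \<union> B)"
    and d: "\<And>i. i \<in> A \<union> B \<Longrightarrow> distr M borel (X i) = distr (measure_pmf (bernoulli_pmf p)) borel of_bool"
    and p: "0 \<le> p" "p \<le> 1"
  shows "prob {\<omega> \<in> space M. real_of_int l \<le> (\<Sum>i\<in>A. X i \<omega>) - (\<Sum>i\<in>B. X i \<omega>)}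
       = bindiff p (card A) (card B) l"
proof -
  define c where "c i = (if i \<in> A then 1 else - 1 :: real)" for i
  have indc: "indep_vars (\<lambda>_. borel) (\<lambda>i \<omega>. c i * X i \<omega>) (A \<union> B)"
    by (rule indep_vars_compose2[OF ind, where Y="\<lambda>i x. c i * x"]) auto
  have indep: "indep_var borel (X i) borel (\<lambda>\<omega>. \<Sum>j\<in>J. c j * X j \<omega>)"
    if "insert i J \<subseteq> A \<union> B" "i \<notin> J" for i J
  proof -
    have "indep_var borel (\<lambda>\<omega>. c i * X i \<omega>) borel (\<lambda>\<omega>. \<Sum>j\<in>J. c j * X j \<omega>)"
    proof (rule indep_vars_sum[where X="\<lambda>i \<omega>. c i * X i \<omega>"])
      show "finite J" using that finite_subset[of J "A \<union> B"] fin by auto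
      show "indep_vars (\<lambda>_. borel) (\<lambda>i \<omega>. c i * X i \<omega>) (insert i J)"
        by (rule indep_vars_subset[OF indc that(1)])
    qed (rule that(2))
    \<comment> \<open>Dividing by the sign \<open>c i\<close> recovers \<open>X i\<close>, since the
      one-trial lemma asks for an unsigned Bernoulli variable.\<close>
    moreover have "(\<lambda>x. x / c i) \<in> borel_measurable borel" "id \<in> borel_measurable (borel :: real measure)"
      by auto
    ultimately have "indep_var borel ((\<lambda>x. x / c i) \<circ> (\<lambda>\<omega>. c i * X i \<omega>)) borel (id \<circ> (\<lambda>\<omega>. \<Sum>j\<in>J. c j * X j \<omega>))"
      by (rule indep_var_compose)
    moreover have "(\<lambda>x. x / c i) \<circ> (\<lambda>\<omega>. c i * X i \<omega>) = X i" by (auto simp: c_def)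
    ultimately show ?thesis by (simp only: id_comp)
  qed
  \<comment> \<open>The negative trials come first, because \<open>bindiff\<close> recurs on
    \<open>m'\<close> only when \<open>m = 0\<close>.\<close>
  have B: "prob {\<omega> \<in> space M. real_of_int l \<le> (\<Sum>i\<in>B'. c i * X i \<omega>)} = bindiff p 0 (card B') l"
    if "B' \<subseteq> B" for B' l
    using finite_subset[OF that fin(2)] that
  proof (induction B' arbitrary: l)
    case empty
    then show ?case by (auto simp: prob_space)
  next
    case (insert i B')
    have ci: "c i = -1" using insert \<open>A \<inter> B = {}\<close> by (auto simp: c_def)
    have eq: "real_of_int l - c i = real_of_int (l + 1)" using ci by simp
    have sub: "B' \<subseteq> B" "i \<in> A \<union> B" "insert i B' \<subseteq> A \<union> B" using insert by auto
    note prob_bernoulli_step[OF indep[OF sub(3) \<open>i \<notin> B'\<close>] d[OF sub(2)] p, of "real_of_int l" "c i",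
        unfolded eq insert.IH[OF sub(1)]]
    then show ?case using insert.hyps by simp
  qed
  have "prob {\<omega> \<in> space M. real_of_int l \<le> (\<Sum>i\<in>A' \<union> B. c i * X i \<omega>)} = bindiff p (card A') (card B) l"
    if "A' \<subseteq> A" for A' l
    using finite_subset[OF that fin(1)] that
  proof (induction A' arbitrary: l)
    case empty
    then show ?case using B[of B] by simp
  next
    case (insert i A')
    have ci: "c i = 1" using insert by (auto simp: c_def)
    have eq: "real_of_int l - c i = real_of_int (l - 1)" using ci by simp
    have iB: "i \<notin> A' \<union> B" using insert \<open>A \<inter> B = {}\<close> by auto
    have "finite (A' \<union> B)" using insert fin by auto
    then have sum: "(\<Sum>j\<in>insert i A' \<union> B. c j * X j \<omega>) = c i * X i \<omega> + (\<Sum>j\<in>A' \<union> B. c j * X j \<omega>)" for \<omega>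
      using iB by simp
    have sub: "A' \<subseteq> A" "i \<in> A \<union> B" "insert i (A' \<union> B) \<subseteq> A \<union> B" using insert by auto
    note prob_bernoulli_step[OF indep[OF sub(3) iB] d[OF sub(2)] p, of "real_of_int l" "c i",
        unfolded eq insert.IH[OF sub(1)]]
    then show ?case using insert.hyps unfolding sum by simp
  qed
  from this[of A] have *: "prob {\<omega> \<in> space M. real_of_int l \<le> (\<Sum>i\<in>A \<union> B. c i * X i \<omega>)} = bindiff p (card A) (card B) l"
    by simp
  have "(\<Sum>i\<in>A \<union> B. c i * X i \<omega>) = (\<Sum>i\<in>A. X i \<omega>) - (\<Sum>i\<in>B. X i \<omega>)" for \<omega>
  proof -
    have "(\<Sum>i\<in>B. c i * X i \<omega>) = (\<Sum>i\<in>B. - X i \<omega>)"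
      using \<open>A \<inter> B = {}\<close> by (intro sum.cong) (auto simp: c_def)
    moreover have "(\<Sum>i\<in>A. c i * X i \<omega>) = (\<Sum>i\<in>A. X i \<omega>)"
      by (intro sum.cong) (auto simp: c_def)
    ultimately show ?thesis
      using assms by (simp add: sum.union_disjoint sum_negf)
  qed
  then show ?thesis using * by simp
qed

text \<open>Chernoff bound in which the bound \<open>h\<close> on the mean takes the place of a
  variance. A bound in terms of \<open>card J\<close> would be too weak, as the counts of interest
  may be far smaller than the number of nodes. Signed \<open>t\<close> covers both tails.\<close>

lemma prob_sum_indicator_tail:
  fixes Z :: "'i \<Rightarrow> 'a \<Rightarrow> real" and t c h \<pi> :: real
  assumes J: "finite J" and ind: "indep_vars (\<lambda>_. borel) Z J"
    and Z: "\<And>v \<omega>. v \<in> J \<Longrightarrow> Z v \<omega> = 0 \<or> Z v \<omega> = (1::real)"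
    and mean: "\<And>v. v \<in> J \<Longrightarrow> prob {\<omega> \<in> space M. Z v \<omega> = 1} = \<pi>"
    and t: "\<bar>t\<bar> \<le> 1" and h: "card J * \<pi> \<le> h"
  shows "prob {\<omega> \<in> space M. c \<le> t * ((\<Sum>v\<in>J. Z v \<omega>) - card J * \<pi>)} \<le> exp (h * t\<^sup>2 - c)"
proof -
  have rv[measurable]: "Z v \<in> borel_measurable M" if "v \<in> J" for v
    using ind that by (auto simp: indep_vars_def)
  have bdd: "exp (t * Z v \<omega>) \<le> exp 1" if "v \<in> J" for v \<omega>
    using Z[OF that, of \<omega>] t by auto
  have int: "integrable M (\<lambda>\<omega>. exp (t * Z v \<omega>))" if "v \<in> J" for v
    using that bdd by (intro integrable_const_bound[where B="exp 1"]) auto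
  have indexp: "indep_vars (\<lambda>_. borel) (\<lambda>v \<omega>. exp (t * Z v \<omega>)) J"
    by (rule indep_vars_compose2[OF ind, where Y="\<lambda>v x. exp (t * x)"]) auto
  have one: "expectation (\<lambda>\<omega>. exp (t * Z v \<omega>)) = 1 + \<pi> * (exp t - 1)" if v: "v \<in> J" for v
  proof -
    have "expectation (\<lambda>\<omega>. exp (t * Z v \<omega>))
        = expectation (\<lambda>\<omega>. 1 + indicator {\<omega> \<in> space M. Z v \<omega> = 1} \<omega> * (exp t - 1))"
    proof (intro Bochner_Integration.integral_cong refl)
      fix \<omega> assume "\<omega> \<in> space M"
      then show "exp (t * Z v \<omega>) = 1 + indicator {\<omega> \<in> space M. Z v \<omega> = 1} \<omega> * (exp t - 1)"
        using Z[OF v, of \<omega>] by (auto simp: indicator_def)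
    qed
    also have "\<dots> = 1 + \<pi> * (exp t - 1)"
    proof -
      have [measurable]: "{\<omega> \<in> space M. Z v \<omega> = 1} \<in> events" using v by measurable
      have "integrable M (\<lambda>\<omega>. indicator {\<omega> \<in> space M. Z v \<omega> = 1} \<omega> * (exp t - 1))"
        by (intro integrable_mult_left integrable_real_indicator) (auto simp: less_top[symmetric])
      then show ?thesis using mean[OF v] by (simp add: prob_space)
    qed
    finally show ?thesis .
  qed
  have pi: "0 \<le> \<pi>" if "v \<in> J" for v using mean[OF that, symmetric] by simp
  have prodeq: "exp (t * (\<Sum>v\<in>J. Z v \<omega>)) = (\<Prod>v\<in>J. exp (t * Z v \<omega>))" for \<omega>
    using J by (simp add: exp_sum sum_distrib_left)
  have intE: "integrable M (\<lambda>\<omega>. exp (t * (\<Sum>v\<in>J. Z v \<omega>)))"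
    unfolding prodeq using indep_vars_integrable[OF J indexp int] by simp
  have "expectation (\<lambda>\<omega>. exp (t * (\<Sum>v\<in>J. Z v \<omega>))) = (\<Prod>v\<in>J. expectation (\<lambda>\<omega>. exp (t * Z v \<omega>)))"
    unfolding prodeq by (rule indep_vars_lebesgue_integral[OF J indexp int])
  also have "\<dots> = (\<Prod>v\<in>J. 1 + \<pi> * (exp t - 1))" using one by simp
  also have "\<dots> \<le> (\<Prod>v\<in>J. exp (\<pi> * (t + t\<^sup>2)))"
  proof (intro prod_mono conjI)
    fix v assume v: "v \<in> J"
    show "0 \<le> 1 + \<pi> * (exp t - 1)" using one[OF v, symmetric] by simp
    have "1 + \<pi> * (exp t - 1) \<le> 1 + \<pi> * (t + t\<^sup>2)"
      using exp_le_quadratic[of t] t pi[OF v] by (intro add_left_mono mult_left_mono) (auto simp: abs_le_iff)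
    also have "\<dots> \<le> exp (\<pi> * (t + t\<^sup>2))" by (rule exp_ge_add_one_self)
    finally show "1 + \<pi> * (exp t - 1) \<le> exp (\<pi> * (t + t\<^sup>2))" .
  qed
  also have "\<dots> = exp (card J * \<pi> * (t + t\<^sup>2))"
    by (simp add: exp_of_nat_mult[symmetric] mult_ac)
  finally have E: "expectation (\<lambda>\<omega>. exp (t * (\<Sum>v\<in>J. Z v \<omega>))) \<le> exp (card J * \<pi> * (t + t\<^sup>2))" .
  let ?K = "exp (t * (card J * \<pi>) + c)"
  have "prob {\<omega> \<in> space M. c \<le> t * ((\<Sum>v\<in>J. Z v \<omega>) - card J * \<pi>)}
      = prob {\<omega> \<in> space M. ?K \<le> exp (t * (\<Sum>v\<in>J. Z v \<omega>))}"
    by (intro arg_cong[where f=prob]) (auto simp: algebra_simps)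
  also have "\<dots> \<le> expectation (\<lambda>\<omega>. exp (t * (\<Sum>v\<in>J. Z v \<omega>))) / ?K"
    by (intro integral_Markov_inequality_measure[where A="{}", simplified] intE) auto
  also have "\<dots> \<le> exp (card J * \<pi> * (t + t\<^sup>2)) / ?K"
    using E by (intro divide_right_mono) auto
  also have "\<dots> = exp (card J * \<pi> * t\<^sup>2 - c)"
    by (simp add: exp_diff[symmetric] algebra_simps)
  also have "\<dots> \<le> exp (h * t\<^sup>2 - c)"
    using h by (simp add: mult_right_mono)
  finally show ?thesis .
qed

lemma prob_sum_indicator_concentration:
  fixes Z :: "'i \<Rightarrow> 'a \<Rightarrow> real" and C b \<epsilon> \<pi> :: real
  assumes J: "finite J" and ind: "indep_vars (\<lambda>_. borel) Z J"
    and Z: "\<And>v \<omega>. v \<in> J \<Longrightarrow> Z v \<omega> = 0 \<or> Z v \<omega> = (1::real)"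
    and mean: "\<And>v. v \<in> J \<Longrightarrow> prob {\<omega> \<in> space M. Z v \<omega> = 1} = \<pi>"
    and h: "card J * \<pi> \<le> C * b" and \<epsilon>: "0 < \<epsilon>" "\<epsilon> \<le> C" "0 < b"
  shows "prob {\<omega> \<in> space M. \<epsilon> * b \<le> \<bar>(\<Sum>v\<in>J. Z v \<omega>) - card J * \<pi>\<bar>} \<le> 2 * exp (- (\<epsilon>\<^sup>2 / (4 * C)) * b)"
proof -
  have rv[measurable]: "Z v \<in> borel_measurable M" if "v \<in> J" for v
    using ind that by (auto simp: indep_vars_def)
  \<comment> \<open>The minimizer of \<open>C * b * t^2 - t * \<epsilon> * b\<close>; the hypothesis
    \<open>\<epsilon> \<le> C\<close> keeps it below 1.\<close>
  define t where "t = \<epsilon> / (2 * C)"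
  have t: "0 < t" "t \<le> 1" using \<epsilon> by (auto simp: t_def field_simps)
  have "t * (\<epsilon> * b) - C * b * t\<^sup>2 = (\<epsilon>\<^sup>2 / (4 * C)) * b"
    using \<epsilon> by (simp add: t_def field_simps power2_eq_square)
  then have e: "C * b * t\<^sup>2 - t * (\<epsilon> * b) = - (\<epsilon>\<^sup>2 / (4 * C)) * b" by simp
  have "prob {\<omega> \<in> space M. \<epsilon> * b \<le> \<bar>(\<Sum>v\<in>J. Z v \<omega>) - card J * \<pi>\<bar>}
      \<le> prob ({\<omega> \<in> space M. t * (\<epsilon> * b) \<le> t * ((\<Sum>v\<in>J. Z v \<omega>) - card J * \<pi>)}
           \<union> {\<omega> \<in> space M. t * (\<epsilon> * b) \<le> (- t) * ((\<Sum>v\<in>J. Z v \<omega>) - card J * \<pi>)})"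
  proof (intro finite_measure_mono subsetI)
    fix \<omega> assume "\<omega> \<in> {\<omega> \<in> space M. \<epsilon> * b \<le> \<bar>(\<Sum>v\<in>J. Z v \<omega>) - card J * \<pi>\<bar>}"
    then have "\<omega> \<in> space M" "\<epsilon> * b \<le> (\<Sum>v\<in>J. Z v \<omega>) - card J * \<pi> \<or> \<epsilon> * b \<le> - ((\<Sum>v\<in>J. Z v \<omega>) - card J * \<pi>)"
      by auto
    then show "\<omega> \<in> {\<omega> \<in> space M. t * (\<epsilon> * b) \<le> t * ((\<Sum>v\<in>J. Z v \<omega>) - card J * \<pi>)}
           \<union> {\<omega> \<in> space M. t * (\<epsilon> * b) \<le> (- t) * ((\<Sum>v\<in>J. Z v \<omega>) - card J * \<pi>)}"
      using t mult_left_mono[of "\<epsilon> * b" "(\<Sum>v\<in>J. Z v \<omega>) - card J * \<pi>" t]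
        mult_left_mono[of "\<epsilon> * b" "- ((\<Sum>v\<in>J. Z v \<omega>) - card J * \<pi>)" t] by (auto simp: algebra_simps)
  qed auto
  also have "\<dots> \<le> prob {\<omega> \<in> space M. t * (\<epsilon> * b) \<le> t * ((\<Sum>v\<in>J. Z v \<omega>) - card J * \<pi>)}
           + prob {\<omega> \<in> space M. t * (\<epsilon> * b) \<le> (- t) * ((\<Sum>v\<in>J. Z v \<omega>) - card J * \<pi>)}"
    by (intro measure_Un_le) auto
  also have "\<dots> \<le> exp (C * b * t\<^sup>2 - t * (\<epsilon> * b)) + exp (C * b * (- t)\<^sup>2 - t * (\<epsilon> * b))"
    using t by (intro add_mono prob_sum_indicator_tail[OF J ind Z mean _ h]) auto
  finally show ?thesis unfolding power2_minus e by simp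
qed

end

section \<open>A single Poisson clock\<close>

definition exp1 :: "real measure" where
  "exp1 = density lborel (exponential_density 1)"

interpretation exp1: prob_space exp1
  unfolding exp1_def by (rule prob_space_exponential_density) simp

lemma sets_exp1 [measurable_cong, simp]: "sets exp1 = sets borel"
  and space_exp1 [simp]: "space exp1 = UNIV"
  by (auto simp: exp1_def)

lemma nn_integral_exp1:
  "\<phi> \<in> borel_measurable borel \<Longrightarrow> (\<integral>\<^sup>+ x. \<phi> x \<partial>exp1) = (\<integral>\<^sup>+ x. ennreal (exponential_density 1 x) * \<phi> x \<partial>lborel)"
  unfolding exp1_def by (subst nn_integral_density) auto

lemma AE_exp1_pos: "AE x in exp1. 0 < x"
proof -
  have "AE x in lborel. x \<noteq> (0::real)" by (rule AE_lborel_singleton)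
  then show ?thesis
    unfolding exp1_def by (subst AE_density) (auto simp: exponential_density_def elim!: eventually_mono)
qed

lemma exp1_memoryless:
  assumes [measurable]: "\<phi> \<in> borel_measurable borel" and "0 \<le> t"
  shows "(\<integral>\<^sup>+ x. indicator {t<..} x * \<phi> (x - t) \<partial>exp1) = ennreal (exp (- t)) * (\<integral>\<^sup>+ x. \<phi> x \<partial>exp1)"
proof -
  have "(\<integral>\<^sup>+ x. indicator {t<..} x * \<phi> (x - t) \<partial>exp1)
      = (\<integral>\<^sup>+ x. ennreal (exponential_density 1 x) * (indicator {t<..} x * \<phi> (x - t)) \<partial>lborel)"
    by (rule nn_integral_exp1) simp
  also have "\<dots> = (\<integral>\<^sup>+ x. ennreal (exponential_density 1 (t + x)) * (indicator {t<..} (t + x) * \<phi> x) \<partial>lborel)"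
    by (subst nn_integral_real_affine[where c=1 and t=t]) auto
  also have "\<dots> = (\<integral>\<^sup>+ x. ennreal (exp (- t)) * (ennreal (exponential_density 1 x) * \<phi> x) \<partial>lborel)"
  proof (rule nn_integral_cong_AE)
    show "AE x in lborel. ennreal (exponential_density 1 (t + x)) * (indicator {t<..} (t + x) * \<phi> x)
        = ennreal (exp (- t)) * (ennreal (exponential_density 1 x) * \<phi> x)"
      \<comment> \<open>At 0 the sides may differ: the density is positive there, while the
        indicator of \<open>{t<..}\<close> vanishes at \<open>t\<close>.\<close>
      using AE_lborel_singleton[of "0::real"]
    proof eventually_elim
      fix x :: real assume "x \<noteq> 0"
      then show "ennreal (exponential_density 1 (t + x)) * (indicator {t<..} (t + x) * \<phi> x)
        = ennreal (exp (- t)) * (ennreal (exponential_density 1 x) * \<phi> x)"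
      proof (cases "0 < x")
        case True
        have "exp (- (t + x)) = exp (- t) * exp (- x)" by (simp add: exp_add[symmetric])
        then have "ennreal (exp (- (t + x))) = ennreal (exp (- t)) * ennreal (exp (- x))"
          by (simp only:) (rule ennreal_mult, auto)
        then show ?thesis using True \<open>0 \<le> t\<close>
          by (simp add: exponential_density_def mult.assoc)
      qed (auto simp: exponential_density_def indicator_def)
    qed
  qed
  also have "\<dots> = ennreal (exp (- t)) * (\<integral>\<^sup>+ x. \<phi> x \<partial>exp1)"
    by (subst nn_integral_cmult) (auto simp: nn_integral_exp1)
  finally show ?thesis .
qed

text \<open>Tilting the density turns it into a multiple of the exponential density of rate
  \<open>c + 1\<close>. For natural \<open>c\<close> the value is the probability of ringing before
  \<open>c\<close> other clocks.\<close>

lemma exp1_laplace: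
  assumes "0 \<le> c"
  shows "(\<integral>\<^sup>+ x. ennreal (exp (- c * x)) \<partial>exp1) = ennreal (1 / (c + 1))"
proof -
  have "exponential_density 1 x * exp (- c * x) = 1 / (c + 1) * exponential_density (c + 1) x" for x
  proof -
    have "exp (- x) * exp (- c * x) = exp (- x * (c + 1))"
      unfolding exp_add[symmetric] by (simp add: algebra_simps)
    then show ?thesis using assms by (simp add: exponential_density_def)
  qed
  then have "(\<integral>\<^sup>+ x. ennreal (exp (- c * x)) \<partial>exp1)
      = (\<integral>\<^sup>+ x. ennreal (1 / (c + 1)) * ennreal (exponential_density (c + 1) x) \<partial>lborel)"
    using assms
    by (subst nn_integral_exp1)
      (auto intro!: nn_integral_cong simp: ennreal_mult[symmetric] exponential_density_nonneg)
  also have "\<dots> = ennreal (1 / (c + 1)) * (\<integral>\<^sup>+ x. ennreal (exponential_density (c + 1) x) \<partial>lborel)"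
    by (subst nn_integral_cmult) auto
  also have "(\<integral>\<^sup>+ x. ennreal (exponential_density (c + 1) x) \<partial>lborel) = 1"
  proof -
    interpret prob_space "density lborel (exponential_density (c + 1))"
      by (rule prob_space_exponential_density) (use assms in simp)
    show ?thesis using emeasure_space_1 by (subst (asm) emeasure_density) auto
  qed
  finally show ?thesis by simp
qed

abbreviation gaps :: "real stream measure" where
  "gaps \<equiv> stream_space exp1"

interpretation gaps: prob_space gaps
  by (rule exp1.prob_space_stream_space)

definition ring_time :: "real stream \<Rightarrow> nat \<Rightarrow> real" where
  "ring_time s m = (\<Sum>j\<le>m. s !! j)"

lemma ring_time_0: "ring_time s 0 = shd s"
  by (simp add: ring_time_def)

lemma ring_time_Stream_0 [simp]: "ring_time (x ## s) 0 = x"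
  by (simp add: ring_time_def)

lemma ring_time_Stream_Suc [simp]: "ring_time (x ## s) (Suc m) = x + ring_time s m"
  unfolding ring_time_def by (subst sum.atMost_Suc_shift) simp

lemma measurable_ring_time [measurable]: "(\<lambda>s. ring_time s m) \<in> borel_measurable gaps"
  unfolding ring_time_def by measurable

text \<open>A clock is the stream of its gaps.  If its \<open>m\<close>-th ring is the first one after time \<open>t\<close>, then
  \<open>rest m t s\<close> is the clock as seen from time \<open>t\<close>.\<close>

definition rest :: "nat \<Rightarrow> real \<Rightarrow> real stream \<Rightarrow> real stream" where
  "rest m t s = (ring_time s m - t) ## sdrop (Suc m) s"

definition first_after :: "real \<Rightarrow> real stream \<Rightarrow> nat" where
  "first_after t s = (LEAST m. t < ring_time s m)"

definition restart :: "real \<Rightarrow> real stream \<Rightarrow> real stream" where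
  "restart t s = rest (first_after t s) t s"

text \<open>For a good clock exactly one \<open>m\<close> qualifies. Fixing it allows induction on
  \<open>m\<close>, whereas \<open>first_after\<close> is a random index.\<close>

definition rings_first :: "nat \<Rightarrow> real \<Rightarrow> real stream \<Rightarrow> bool" where
  "rings_first m t s \<longleftrightarrow> t < ring_time s m \<and> (\<forall>j<m. ring_time s j \<le> t)"

lemma measurable_rest [measurable (raw)]:
  assumes [measurable]: "f \<in> borel_measurable N" "g \<in> measurable N gaps"
  shows "(\<lambda>x. rest m (f x) (g x)) \<in> measurable N gaps"
  unfolding rest_def by measurable

lemma measurable_first_after [measurable (raw)]:
  assumes [measurable]: "f \<in> borel_measurable N" "g \<in> measurable N gaps"
  shows "(\<lambda>x. first_after (f x) (g x)) \<in> measurable N (count_space UNIV)"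
  unfolding first_after_def by measurable

lemma measurable_restart [measurable (raw)]:
  assumes [measurable]: "f \<in> borel_measurable N" "g \<in> measurable N gaps"
  shows "(\<lambda>x. restart (f x) (g x)) \<in> measurable N gaps"
  unfolding restart_def
  by (rule measurable_compose_countable[where g="\<lambda>x. first_after (f x) (g x)"]) measurable

lemma measurable_rings_first [measurable (raw)]:
  assumes [measurable]: "f \<in> borel_measurable N" "g \<in> measurable N gaps"
  shows "Measurable.pred N (\<lambda>x. rings_first m (f x) (g x))"
  unfolding rings_first_def by measurable

lemma rings_first_imp_first_after: "rings_first m t s \<Longrightarrow> first_after t s = m"
  unfolding rings_first_def first_after_def
  by (intro Least_equality) (auto simp: not_le[symmetric])

lemma rings_first_restart: "rings_first m t s \<Longrightarrow> restart t s = rest m t s"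
  by (simp add: restart_def rings_first_imp_first_after)

lemma rings_first_Stream_0 [simp]: "rings_first 0 t (x ## s) \<longleftrightarrow> t < x"
  by (simp add: rings_first_def)

lemma rings_first_Stream_Suc [simp]:
  "rings_first (Suc m) t (x ## s) \<longleftrightarrow> x \<le> t \<and> rings_first m (t - x) s"
  by (auto simp: rings_first_def less_Suc_eq_0_disj algebra_simps)

lemma rest_Stream_0: "rest 0 t (x ## s) = (x - t) ## s"
  by (simp add: rest_def)

lemma rest_Stream_Suc: "rest (Suc m) t (x ## s) = rest m (t - x) s"
  by (simp add: rest_def)

text \<open>Memorylessness of the first gap; the later gaps are untouched.\<close>

lemma nn_integral_rest_0:
  assumes [measurable]: "k \<in> borel_measurable gaps" and "0 \<le> t"
  shows "(\<integral>\<^sup>+ s. of_bool (rings_first 0 t s) * k (rest 0 t s) \<partial>gaps) = ennreal (exp (- t)) * (\<integral>\<^sup>+ s. k s \<partial>gaps)"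
proof -
  have "(\<integral>\<^sup>+ s. of_bool (rings_first 0 t s) * k (rest 0 t s) \<partial>gaps)
      = (\<integral>\<^sup>+ x. \<integral>\<^sup>+ s. of_bool (rings_first 0 t (x ## s)) * k (rest 0 t (x ## s)) \<partial>gaps \<partial>exp1)"
    by (rule exp1.nn_integral_stream_space) measurable
  also have "\<dots> = (\<integral>\<^sup>+ x. indicator {t<..} x * (\<integral>\<^sup>+ s. k ((x - t) ## s) \<partial>gaps) \<partial>exp1)"
    by (intro nn_integral_cong) (auto simp: rest_Stream_0 indicator_def)
  also have "\<dots> = ennreal (exp (- t)) * (\<integral>\<^sup>+ x. \<integral>\<^sup>+ s. k (x ## s) \<partial>gaps \<partial>exp1)"
    by (rule exp1_memoryless) (use \<open>0 \<le> t\<close> in measurable)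
  also have "(\<integral>\<^sup>+ x. \<integral>\<^sup>+ s. k (x ## s) \<partial>gaps \<partial>exp1) = (\<integral>\<^sup>+ s. k s \<partial>gaps)"
    by (rule exp1.nn_integral_stream_space[symmetric]) measurable
  finally show ?thesis .
qed

text \<open>The residual clock is independent of the number of rings up to time \<open>t\<close>; summing over this
  number gives the Markov property.\<close>

lemma nn_integral_rest:
  assumes [measurable]: "h \<in> borel_measurable gaps" and "0 \<le> t"
  shows "(\<integral>\<^sup>+ s. of_bool (rings_first m t s) * h (rest m t s) \<partial>gaps)
       = (\<integral>\<^sup>+ s. of_bool (rings_first m t s) \<partial>gaps) * (\<integral>\<^sup>+ s. h s \<partial>gaps)"
  using \<open>0 \<le> t\<close>
proof (induction m arbitrary: t)
  case 0
  show ?case using nn_integral_rest_0[of h t] nn_integral_rest_0[of "\<lambda>_. 1" t] 0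
    by (simp add: gaps.emeasure_space_1)
next
  case (Suc m)
  have "(\<integral>\<^sup>+ s. of_bool (rings_first (Suc m) t s) * h (rest (Suc m) t s) \<partial>gaps)
      = (\<integral>\<^sup>+ x. \<integral>\<^sup>+ s. of_bool (rings_first (Suc m) t (x ## s)) * h (rest (Suc m) t (x ## s)) \<partial>gaps \<partial>exp1)"
    by (rule exp1.nn_integral_stream_space) measurable
  also have "\<dots> = (\<integral>\<^sup>+ x. (\<integral>\<^sup>+ s. of_bool (rings_first (Suc m) t (x ## s)) \<partial>gaps) * (\<integral>\<^sup>+ s. h s \<partial>gaps) \<partial>exp1)"
    \<comment> \<open>\<open>rings_first (Suc m)\<close> forces the first gap to be at most
      \<open>t\<close>, so the remaining time \<open>t - x\<close> is nonnegative.\<close>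
    using Suc.IH[of "t - _"] by (intro nn_integral_cong) (auto simp: rest_Stream_Suc of_bool_conj)
  also have "\<dots> = (\<integral>\<^sup>+ x. \<integral>\<^sup>+ s. of_bool (rings_first (Suc m) t (x ## s)) \<partial>gaps \<partial>exp1) * (\<integral>\<^sup>+ s. h s \<partial>gaps)"
    by (rule nn_integral_multc) measurable
  also have "(\<integral>\<^sup>+ x. \<integral>\<^sup>+ s. of_bool (rings_first (Suc m) t (x ## s)) \<partial>gaps \<partial>exp1)
      = (\<integral>\<^sup>+ s. of_bool (rings_first (Suc m) t s) \<partial>gaps)"
    by (rule exp1.nn_integral_stream_space[symmetric]) measurable
  finally show ?case .
qed

text \<open>Positive gaps and no explosion. Bounds of type \<open>nat\<close> suffice and keep the
  event measurable.\<close>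

definition good_clock :: "real stream \<Rightarrow> bool" where
  "good_clock s \<longleftrightarrow> (\<forall>j. 0 < s !! j) \<and> (\<forall>c::nat. \<exists>m. real c < ring_time s m)"

lemma measurable_good_clock [measurable]: "Measurable.pred gaps good_clock"
  unfolding good_clock_def by measurable

lemma good_clock_unbounded: "good_clock s \<Longrightarrow> \<exists>m. c < ring_time s m"
  unfolding good_clock_def by (meson less_trans reals_Archimedean2)

text \<open>The Laplace transform at 1 of a sum of \<open>m + 1\<close> independent gaps, each
  contributing \<open>1 / 2\<close>. Its decay in \<open>m\<close> rules out explosion.\<close>

lemma nn_integral_exp_ring_time:
  "(\<integral>\<^sup>+ s. ennreal (exp (- ring_time s m)) \<partial>gaps) = ennreal ((1 / 2) ^ Suc m)"
proof (induction m)
  case 0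
  have "(\<integral>\<^sup>+ s. ennreal (exp (- ring_time s 0)) \<partial>gaps) = (\<integral>\<^sup>+ x. \<integral>\<^sup>+ s. ennreal (exp (- ring_time (x ## s) 0)) \<partial>gaps \<partial>exp1)"
    by (rule exp1.nn_integral_stream_space) measurable
  then show ?case using exp1_laplace[of 1] by (simp add: gaps.emeasure_space_1)
next
  case (Suc m)
  have "(\<integral>\<^sup>+ s. ennreal (exp (- ring_time s (Suc m))) \<partial>gaps) = (\<integral>\<^sup>+ x. \<integral>\<^sup>+ s. ennreal (exp (- ring_time (x ## s) (Suc m))) \<partial>gaps \<partial>exp1)"
    by (rule exp1.nn_integral_stream_space) measurable
  also have "\<dots> = (\<integral>\<^sup>+ x. ennreal (exp (- 1 * x)) * ennreal ((1 / 2) ^ Suc m) \<partial>exp1)"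
    unfolding Suc.IH[symmetric]
    by (intro nn_integral_cong, subst nn_integral_cmult[symmetric])
      (auto intro!: nn_integral_cong simp: ennreal_mult[symmetric] exp_add[symmetric])
  also have "\<dots> = ennreal ((1 / 2) ^ Suc (Suc m))"
  proof (subst nn_integral_multc)
    have L: "(\<integral>\<^sup>+ x. ennreal (exp (- 1 * x)) \<partial>exp1) = ennreal (1 / 2)"
      using exp1_laplace[of 1] by simp
    show "(\<integral>\<^sup>+ x. ennreal (exp (- 1 * x)) \<partial>exp1) * ennreal ((1 / 2) ^ Suc m) = ennreal ((1 / 2) ^ Suc (Suc m))"
      unfolding L by (subst ennreal_mult[symmetric]) auto
  qed measurable
  finally show ?case .
qed

lemma AE_good_clock: "AE s in gaps. good_clock s"
proof -
  have pos: "AE s in gaps. 0 < s !! j" for j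
    using exp1.AE_stream_all[OF _ AE_exp1_pos] by (auto simp: stream_all_def elim!: eventually_mono)
  have unb: "AE s in gaps. \<exists>m. real c < ring_time s m" for c :: nat
  proof -
    let ?N = "{s \<in> space gaps. \<not> (\<exists>m. real c < ring_time s m)}"
    \<comment> \<open>If no ring time exceeds \<open>c\<close>, then
      \<open>exp c * exp (- ring_time s m)\<close> is at least 1 for every \<open>m\<close>, while
      its mean tends to 0.\<close>
    have "emeasure gaps ?N \<le> ennreal (exp c * (1 / 2) ^ Suc m)" for m
    proof -
      have "emeasure gaps ?N = (\<integral>\<^sup>+ s. indicator ?N s \<partial>gaps)" by simp
      also have "\<dots> \<le> (\<integral>\<^sup>+ s. ennreal (exp c) * ennreal (exp (- ring_time s m)) \<partial>gaps)"
        by (intro nn_integral_mono) (auto simp: indicator_def ennreal_mult[symmetric] exp_add[symmetric] not_less)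
      also have "\<dots> = ennreal (exp c * (1 / 2) ^ Suc m)"
      proof (subst nn_integral_cmult)
        show "ennreal (exp c) * (\<integral>\<^sup>+ s. ennreal (exp (- ring_time s m)) \<partial>gaps) = ennreal (exp c * (1 / 2) ^ Suc m)"
          unfolding nn_integral_exp_ring_time by (rule ennreal_mult[symmetric]) auto
      qed measurable
      finally show ?thesis .
    qed
    moreover have "(\<lambda>m. ennreal (exp c * (1 / 2) ^ Suc m)) \<longlonglongrightarrow> ennreal 0"
    proof (rule tendsto_ennrealI)
      show "(\<lambda>m. exp (real c) * (1 / 2) ^ Suc m) \<longlonglongrightarrow> 0"
        by (intro tendsto_mult_right_zero LIMSEQ_Suc LIMSEQ_power_zero) auto
    qed
    ultimately have "emeasure gaps ?N \<le> ennreal 0"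
      by (intro LIMSEQ_le_const[of _ "ennreal 0" "emeasure gaps ?N"]) auto
    then have "?N \<in> null_sets gaps" by (auto simp: null_sets_def)
    then show ?thesis by (rule AE_I') auto
  qed
  show ?thesis unfolding good_clock_def using pos unb by (auto simp: AE_all_countable)
qed

lemma good_clock_rings_first:
  assumes "good_clock s"
  shows "rings_first (first_after t s) t s"
proof -
  have "t < ring_time s (first_after t s)"
    unfolding first_after_def using good_clock_unbounded[OF assms] by (rule LeastI_ex)
  moreover have "ring_time s j \<le> t" if "j < first_after t s" for j
    using not_less_Least[OF that[unfolded first_after_def]] by simp
  ultimately show ?thesis by (simp add: rings_first_def)
qed

lemma suminf_rings_first:
  assumes "good_clock s"
  shows "(\<Sum>m. of_bool (rings_first m t s) * g m :: ennreal) = g (first_after t s)"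
proof -
  have "(\<Sum>m. of_bool (rings_first m t s) * g m) = (\<Sum>m\<in>{first_after t s}. of_bool (rings_first m t s) * g m)"
    by (intro suminf_finite) (auto dest: rings_first_imp_first_after)
  then show ?thesis using good_clock_rings_first[OF assms] by simp
qed

text \<open>Summing over the number of rings gives the total mass of \<open>rings_first\<close>
  times the integral of \<open>h\<close>; the case \<open>h = 1\<close> shows that this mass is 1
  without computing it.\<close>

lemma nn_integral_restart:
  assumes [measurable]: "h \<in> borel_measurable gaps" and "0 \<le> t"
  shows "(\<integral>\<^sup>+ s. h (restart t s) \<partial>gaps) = (\<integral>\<^sup>+ s. h s \<partial>gaps)"
proof -
  have eq: "(\<integral>\<^sup>+ s. k (restart t s) \<partial>gaps) = (\<Sum>m. (\<integral>\<^sup>+ s. of_bool (rings_first m t s) \<partial>gaps)) * (\<integral>\<^sup>+ s. k s \<partial>gaps)"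
    if [measurable]: "k \<in> borel_measurable gaps" for k
  proof -
    have "(\<integral>\<^sup>+ s. k (restart t s) \<partial>gaps) = (\<integral>\<^sup>+ s. (\<Sum>m. of_bool (rings_first m t s) * k (rest m t s)) \<partial>gaps)"
      using AE_good_clock
      by (intro nn_integral_cong_AE) (auto simp: suminf_rings_first restart_def elim!: eventually_mono)
    also have "\<dots> = (\<Sum>m. (\<integral>\<^sup>+ s. of_bool (rings_first m t s) * k (rest m t s) \<partial>gaps))"
      by (rule nn_integral_suminf) measurable
    also have "\<dots> = (\<Sum>m. (\<integral>\<^sup>+ s. of_bool (rings_first m t s) \<partial>gaps)) * (\<integral>\<^sup>+ s. k s \<partial>gaps)"
      using \<open>0 \<le> t\<close> by (simp add: nn_integral_rest)
    finally show ?thesis .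
  qed
  show ?thesis using eq[of "\<lambda>_. 1"] eq[of h] by (simp add: gaps.emeasure_space_1)
qed

lemma ring_time_mono:
  assumes "good_clock s" "i \<le> j" shows "ring_time s i \<le> ring_time s j"
  using assms unfolding ring_time_def good_clock_def
  by (intro sum_mono2) (auto intro: less_imp_le)

lemma ring_time_rest: "ring_time (rest m t s) j = ring_time s (m + j) - t"
  by (induction j) (auto simp: rest_def ring_time_def sdrop_snth simp del: sdrop.simps)

text \<open>The process reads sets of ring times, not streams. This is the link: looking at the old
  set after time \<open>t\<close> amounts to looking at the new one after 0.\<close>

lemma rings_restart:
  assumes g: "good_clock s"
  shows "range (ring_time (restart t s)) = {u - t | u. u \<in> range (ring_time s) \<and> t < u}"
proof -
  let ?m = "first_after t s"
  have rf: "rings_first ?m t s" by (rule good_clock_rings_first[OF g])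
  have "t < ring_time s i \<longleftrightarrow> ?m \<le> i" for i
    using rf ring_time_mono[OF g, of ?m i] unfolding rings_first_def by (meson leD le_less_linear less_le_trans)
  then have *: "{u - t | u. u \<in> range (ring_time s) \<and> t < u} = {ring_time s i - t | i. ?m \<le> i}"
    by auto
  show ?thesis unfolding * restart_def ring_time_rest
    by (auto simp: image_def le_iff_add)
qed

section \<open>Restarting all clocks at the first ring\<close>

abbreviation clocks :: "nat set \<Rightarrow> (nat \<Rightarrow> real stream) measure" where
  "clocks I \<equiv> PiM I (\<lambda>_. gaps)"

lemma prob_space_clocks: "prob_space (clocks I)"
  by (rule prob_space_PiM) (rule gaps.prob_space_axioms)

definition strict_first :: "nat set \<Rightarrow> nat \<Rightarrow> (nat \<Rightarrow> real stream) \<Rightarrow> bool" where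
  "strict_first A v \<gamma> \<longleftrightarrow> (\<forall>w\<in>A - {v}. shd (\<gamma> v) < shd (\<gamma> w))"

definition restart_all :: "nat set \<Rightarrow> nat \<Rightarrow> (nat \<Rightarrow> real stream) \<Rightarrow> (nat \<Rightarrow> real stream)" where
  "restart_all I v \<gamma> = (\<lambda>w\<in>I. restart (shd (\<gamma> v)) (\<gamma> w))"

lemma measurable_restart_all [measurable]:
  assumes "v \<in> I" shows "restart_all I v \<in> measurable (clocks I) (clocks I)"
  unfolding restart_all_def using assms by measurable

lemma pred_strict_first [measurable]:
  assumes "A \<subseteq> I" "v \<in> I" "finite A" shows "Measurable.pred (clocks I) (strict_first A v)"
proof -
  have [measurable]: "Measurable.pred (clocks I) (\<lambda>\<gamma>. shd (\<gamma> v) < shd (\<gamma> w))" if "w \<in> A" for w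
  proof -
    have [simp]: "w \<in> I" using that assms by auto
    show ?thesis using \<open>v \<in> I\<close> by measurable
  qed
  show ?thesis unfolding strict_first_def using assms by (intro pred_intros_finite) auto
qed

text \<open>\<open>restart\<close> asks for the first ring strictly after its time, so the clock
  that has just rung loses exactly its first gap.\<close>

lemma restart_own_first:
  assumes "good_clock y" shows "restart (shd y) y = stl y"
proof -
  have "0 < y !! 1" using assms unfolding good_clock_def by blast
  then have "rings_first 1 (shd y) y" by (simp add: rings_first_def ring_time_def)
  then have "restart (shd y) y = rest 1 (shd y) y" by (rule rings_first_restart)
  also have "\<dots> = stl y" by (simp add: rest_def ring_time_def)
  finally show ?thesis .
qed

text \<open>Condition on the clock \<open>y\<close> of \<open>v\<close>. Each competitor in
  \<open>A\<close> survives past \<open>shd y\<close> with probability \<open>exp (- shd y)\<close>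
  and is then fresh by memorylessness; clocks outside \<open>A\<close> are restarted at a fixed
  time. As \<open>shd y\<close> is independent of \<open>stl y\<close>, integrating
  \<open>exp (- c * shd y)\<close> for \<open>c\<close> competitors gives
  \<open>1 / card A\<close>.\<close>

lemma nn_integral_strict_first_rect:
  assumes fin: "finite I" and A: "A \<subseteq> I" "v \<in> A"
    and B[measurable]: "\<And>w. B w \<in> sets gaps"
  shows "(\<integral>\<^sup>+ \<gamma>. of_bool (strict_first A v \<gamma>) * of_bool (\<forall>w\<in>I. restart (shd (\<gamma> v)) (\<gamma> w) \<in> B w) \<partial>clocks I)
    = ennreal (1 / card A) * (\<Prod>w\<in>I. emeasure gaps (B w))"
proof -
  interpret product_sigma_finite "\<lambda>_::nat. gaps" ..
  define I' where "I' = I - {v}"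
  have I: "I = insert v I'" "v \<notin> I'" "finite I'" using A fin by (auto simp: I'_def)
  define c where "c = real (card A) - 1"
  have cA: "card (A - {v}) = card A - 1" "card A > 0"
    using A fin finite_subset[of A I] by (auto simp: card_gt_0_iff)
  then have c: "real (card (A - {v})) = c" "0 \<le> c" by (auto simp: c_def)
  define f where "f w t s = (of_bool (w \<in> A \<longrightarrow> t < shd s) * indicator (B w) (restart t s) :: ennreal)" for w t s
  have [measurable]: "f w t \<in> borel_measurable gaps" for w t
    unfolding f_def by measurable
  have fint: "(\<integral>\<^sup>+ s. f w t s \<partial>gaps) = ennreal (if w \<in> A then exp (- t) else 1) * emeasure gaps (B w)"
    if "0 \<le> t" for w t
  proof (cases "w \<in> A")
    case True
    have "(\<integral>\<^sup>+ s. f w t s \<partial>gaps) = (\<integral>\<^sup>+ s. of_bool (rings_first 0 t s) * indicator (B w) (rest 0 t s) \<partial>gaps)"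
    proof (intro nn_integral_cong)
      fix s :: "real stream"
      show "f w t s = of_bool (rings_first 0 t s) * indicator (B w) (rest 0 t s)"
        using True rings_first_restart[of 0 t s] by (auto simp: f_def rings_first_def ring_time_0)
    qed
    then show ?thesis using nn_integral_rest_0[of "indicator (B w)" t] that True by simp
  next
    case False
    then show ?thesis using nn_integral_restart[of "indicator (B w)" t] that by (simp add: f_def)
  qed
  let ?F = "\<lambda>\<gamma>. of_bool (strict_first A v \<gamma>) * of_bool (\<forall>w\<in>I. restart (shd (\<gamma> v)) (\<gamma> w) \<in> B w) :: ennreal"
  have [measurable]: "?F \<in> borel_measurable (clocks I)"
  proof -
    have [measurable]: "Measurable.pred (clocks I) (\<lambda>\<gamma>. restart (shd (\<gamma> v)) (\<gamma> w) \<in> B w)" if "w \<in> I" for w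
    proof -
      have [measurable]: "w \<in> I" "v \<in> I" using that A by auto
      show ?thesis by measurable
    qed
    have [measurable]: "Measurable.pred (clocks I) (strict_first A v)"
      using A fin finite_subset by (intro pred_strict_first) auto
    have [measurable]: "Measurable.pred (clocks I) (\<lambda>\<gamma>. \<forall>w\<in>I. restart (shd (\<gamma> v)) (\<gamma> w) \<in> B w)"
      using fin by (intro pred_intros_finite) auto
    show ?thesis by measurable
  qed
  have "(\<integral>\<^sup>+ \<gamma>. ?F \<gamma> \<partial>clocks I) = (\<integral>\<^sup>+ y. (\<integral>\<^sup>+ x. ?F (x(v := y)) \<partial>clocks I') \<partial>gaps)"
    unfolding I(1) by (rule product_nn_integral_insert_rev) (use I in \<open>simp_all flip: I(1)\<close>)
  also have "\<dots> = (\<integral>\<^sup>+ y. (\<integral>\<^sup>+ x. indicator (B v) (restart (shd y) y) * (\<Prod>w\<in>I'. f w (shd y) (x w)) \<partial>clocks I') \<partial>gaps)"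
  proof (intro nn_integral_cong)
    fix y x
    have "(\<Prod>w\<in>I'. f w (shd y) (x w)) = of_bool (\<forall>w\<in>I'. (w \<in> A \<longrightarrow> shd y < shd (x w)) \<and> restart (shd y) (x w) \<in> B w)"
      using I(3) by (induction I') (auto simp: f_def indicator_def)
    moreover have "strict_first A v (x(v := y)) \<and> (\<forall>w\<in>I. restart (shd ((x(v := y)) v)) ((x(v := y)) w) \<in> B w)
      \<longleftrightarrow> restart (shd y) y \<in> B v \<and> (\<forall>w\<in>I'. (w \<in> A \<longrightarrow> shd y < shd (x w)) \<and> restart (shd y) (x w) \<in> B w)"
      using A by (auto simp: strict_first_def I'_def)
    ultimately show "?F (x(v := y)) = indicator (B v) (restart (shd y) y) * (\<Prod>w\<in>I'. f w (shd y) (x w))"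
      by (simp only: of_bool_conj[symmetric]) (auto simp: indicator_def)
  qed
  also have "\<dots> = (\<integral>\<^sup>+ y. indicator (B v) (restart (shd y) y) * (\<Prod>w\<in>I'. \<integral>\<^sup>+ s. f w (shd y) s \<partial>gaps) \<partial>gaps)"
  proof (rule nn_integral_cong)
    fix y
    have [measurable]: "(\<lambda>x. \<Prod>w\<in>I'. f w (shd y) (x w)) \<in> borel_measurable (clocks I')"
      by (intro borel_measurable_prod_ennreal) measurable
    have "(\<integral>\<^sup>+ x. (\<Prod>w\<in>I'. f w (shd y) (x w)) \<partial>clocks I') = (\<Prod>w\<in>I'. \<integral>\<^sup>+ s. f w (shd y) s \<partial>gaps)"
      using I by (intro product_nn_integral_prod) auto
    then show "(\<integral>\<^sup>+ x. indicator (B v) (restart (shd y) y) * (\<Prod>w\<in>I'. f w (shd y) (x w)) \<partial>clocks I')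
        = indicator (B v) (restart (shd y) y) * (\<Prod>w\<in>I'. \<integral>\<^sup>+ s. f w (shd y) s \<partial>gaps)"
      by (simp add: nn_integral_cmult)
  qed
  also have "\<dots> = (\<integral>\<^sup>+ y. (indicator (B v) (stl y) * ennreal (exp (- c * shd y))) * (\<Prod>w\<in>I'. emeasure gaps (B w)) \<partial>gaps)"
  proof (rule nn_integral_cong_AE)
    show "AE y in gaps. indicator (B v) (restart (shd y) y) * (\<Prod>w\<in>I'. \<integral>\<^sup>+ s. f w (shd y) s \<partial>gaps)
      = (indicator (B v) (stl y) * ennreal (exp (- c * shd y))) * (\<Prod>w\<in>I'. emeasure gaps (B w))"
      using AE_good_clock
    proof eventually_elim
      fix y assume y: "good_clock y"
      then have pos: "0 < shd y" by (auto simp: good_clock_def dest: spec[of _ 0])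
      have "(\<Prod>w\<in>I'. \<integral>\<^sup>+ s. f w (shd y) s \<partial>gaps)
          = (\<Prod>w\<in>I'. ennreal (if w \<in> A then exp (- shd y) else 1)) * (\<Prod>w\<in>I'. emeasure gaps (B w))"
        using pos by (simp add: fint prod.distrib)
      also have "(\<Prod>w\<in>I'. ennreal (if w \<in> A then exp (- shd y) else 1)) = ennreal (\<Prod>w\<in>I'. if w \<in> A then exp (- shd y) else 1)"
        by (rule prod_ennreal) auto
      also have "(\<Prod>w\<in>I'. if w \<in> A then exp (- shd y) else 1) = exp (- shd y) ^ card (A - {v})"
      proof -
        have "A - {v} = I' \<inter> {w. w \<in> A}" using A by (auto simp: I'_def)
        then show ?thesis using I(3) by (simp add: prod.If_cases)
      qed
      also have "\<dots> = exp (- c * shd y)"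
        using c by (simp add: exp_of_nat_mult[symmetric])
      finally show "indicator (B v) (restart (shd y) y) * (\<Prod>w\<in>I'. \<integral>\<^sup>+ s. f w (shd y) s \<partial>gaps)
      = (indicator (B v) (stl y) * ennreal (exp (- c * shd y))) * (\<Prod>w\<in>I'. emeasure gaps (B w))"
        by (simp add: restart_own_first[OF y] mult.assoc)
    qed
  qed
  also have "\<dots> = (\<integral>\<^sup>+ y. indicator (B v) (stl y) * ennreal (exp (- c * shd y)) \<partial>gaps) * (\<Prod>w\<in>I'. emeasure gaps (B w))"
    by (rule nn_integral_multc) measurable
  also have "(\<integral>\<^sup>+ y. indicator (B v) (stl y) * ennreal (exp (- c * shd y)) \<partial>gaps)
      = (\<integral>\<^sup>+ x. \<integral>\<^sup>+ s. indicator (B v) (stl (x ## s)) * ennreal (exp (- c * shd (x ## s))) \<partial>gaps \<partial>exp1)"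
    by (rule exp1.nn_integral_stream_space) measurable
  also have "\<dots> = (\<integral>\<^sup>+ x. emeasure gaps (B v) * ennreal (exp (- c * x)) \<partial>exp1)"
    by (intro nn_integral_cong) (simp add: nn_integral_multc)
  also have "\<dots> = emeasure gaps (B v) * ennreal (1 / card A)"
    using exp1_laplace[OF \<open>0 \<le> c\<close>] by (subst nn_integral_cmult) (auto simp: c_def)
  finally show ?thesis unfolding I(1) using I by (simp add: mult_ac)
qed

text \<open>A measure on the finite product is determined by rectangles. Multiplied by
  \<open>card A\<close>, the image measure is the original law; so the winner is uniform on
  \<open>A\<close> and independent of the restarted clocks.\<close>

lemma nn_integral_strict_first:
  assumes fin: "finite I" and A: "A \<subseteq> I" "v \<in> A" and h[measurable]: "h \<in> borel_measurable (clocks I)"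
  shows "(\<integral>\<^sup>+ \<gamma>. of_bool (strict_first A v \<gamma>) * h (restart_all I v \<gamma>) \<partial>clocks I)
    = ennreal (1 / card A) * (\<integral>\<^sup>+ \<gamma>. h \<gamma> \<partial>clocks I)"
proof -
  interpret product_sigma_finite "\<lambda>_::nat. gaps" ..
  have cA: "card A > 0" using A fin finite_subset[of A I] by (auto simp: card_gt_0_iff)
  have [measurable]: "Measurable.pred (clocks I) (strict_first A v)" "restart_all I v \<in> measurable (clocks I) (clocks I)"
    using A fin finite_subset[of A I] by (auto intro!: pred_strict_first)
  define N where "N = distr (density (clocks I) (\<lambda>\<gamma>. of_bool (strict_first A v \<gamma>))) (clocks I) (restart_all I v)"
  have sN: "sets N = sets (clocks I)" by (simp add: N_def)
  have "scale_measure (ennreal (card A)) N = clocks I"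
  proof (rule PiM_eqI)
    fix B assume B: "\<And>w. w \<in> I \<Longrightarrow> B w \<in> sets gaps"
    \<comment> \<open>The rectangle lemma asks for measurable sides at all indices, but they are
      given for those in \<open>I\<close> only.\<close>
    define B' where "B' w = (if w \<in> I then B w else {})" for w
    have B': "B' w \<in> sets gaps" for w using B by (auto simp: B'_def)
    have PB: "Pi\<^sub>E I B = Pi\<^sub>E I B'" by (rule PiE_cong) (simp add: B'_def)
    have [measurable]: "Pi\<^sub>E I B' \<in> sets (clocks I)" using B' fin by (intro sets_PiM_I_finite) auto
    have "emeasure N (Pi\<^sub>E I B') = (\<integral>\<^sup>+ \<gamma>. of_bool (strict_first A v \<gamma>) * indicator (restart_all I v -` Pi\<^sub>E I B' \<inter> space (clocks I)) \<gamma> \<partial>clocks I)"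
      unfolding N_def by (subst emeasure_distr, simp, simp, subst emeasure_density) auto
    also have "\<dots> = (\<integral>\<^sup>+ \<gamma>. of_bool (strict_first A v \<gamma>) * of_bool (\<forall>w\<in>I. restart (shd (\<gamma> v)) (\<gamma> w) \<in> B' w) \<partial>clocks I)"
      by (intro nn_integral_cong) (auto simp: restart_all_def indicator_def PiE_iff)
    also have "\<dots> = ennreal (1 / card A) * (\<Prod>w\<in>I. emeasure gaps (B' w))"
      by (rule nn_integral_strict_first_rect[OF fin A B'])
    finally have "emeasure N (Pi\<^sub>E I B') = ennreal (1 / card A) * (\<Prod>w\<in>I. emeasure gaps (B' w))" .
    moreover have "ennreal (card A) * ennreal (1 / card A) = 1"
      using cA by (simp add: ennreal_mult[symmetric])
    ultimately show "emeasure (scale_measure (ennreal (card A)) N) (Pi\<^sub>E I B) = (\<Prod>w\<in>I. emeasure gaps (B w))"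
      unfolding PB by (simp add: mult.assoc[symmetric] B'_def)
  qed (use fin sN in auto)
  then have "(\<integral>\<^sup>+ \<gamma>. h \<gamma> \<partial>clocks I) = (\<integral>\<^sup>+ \<gamma>. h \<gamma> \<partial>scale_measure (ennreal (card A)) N)" by simp
  also have "\<dots> = ennreal (card A) * (\<integral>\<^sup>+ \<gamma>. h \<gamma> \<partial>N)"
    by (rule nn_integral_scale_measure) (simp add: measurable_cong_sets[OF sN refl])
  also have "(\<integral>\<^sup>+ \<gamma>. h \<gamma> \<partial>N) = (\<integral>\<^sup>+ \<gamma>. of_bool (strict_first A v \<gamma>) * h (restart_all I v \<gamma>) \<partial>clocks I)"
    unfolding N_def by (subst nn_integral_distr, simp, simp, subst nn_integral_density) auto
  finally have e: "(\<integral>\<^sup>+ \<gamma>. h \<gamma> \<partial>clocks I) = ennreal (card A) * (\<integral>\<^sup>+ \<gamma>. of_bool (strict_first A v \<gamma>) * h (restart_all I v \<gamma>) \<partial>clocks I)" .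
  have "ennreal (1 / card A) * ennreal (card A) = 1"
    using cA by (simp add: ennreal_mult[symmetric])
  then show ?thesis unfolding e by (simp add: mult.assoc[symmetric])
qed

section \<open>The chain of activations for given edges\<close>

text \<open>\<open>A C S\<close> is the set of white nodes that may take color \<open>S\<close> in the coloring \<open>C\<close>.  Fixing the function
  \<open>A\<close> amounts to conditioning on all edges.\<close>

type_synonym coloring = "color \<Rightarrow> nat set"

definition avail :: "(coloring \<Rightarrow> coloring) \<Rightarrow> coloring \<Rightarrow> nat set" where
  "avail A C = A C Red \<union> A C Black"

definition color_of :: "(coloring \<Rightarrow> coloring) \<Rightarrow> coloring \<Rightarrow> nat \<Rightarrow> color" where
  "color_of A C v = (if v \<in> A C Red then Red else Black)"

definition add_node :: "(coloring \<Rightarrow> coloring) \<Rightarrow> coloring \<Rightarrow> nat \<Rightarrow> coloring" where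
  "add_node A C v = C(color_of A C v := insert v (C (color_of A C v)))"

definition red_rate :: "(coloring \<Rightarrow> coloring) \<Rightarrow> coloring \<Rightarrow> real" where
  "red_rate A C = card (A C Red) / card (avail A C)"

definition gstep :: "(coloring \<Rightarrow> coloring) \<Rightarrow> (nat \<Rightarrow> real set) \<Rightarrow> state \<Rightarrow> state" where
  "gstep A ring s = (if avail A (colored s) = {} then s
     else percolation.activate ring (avail A (colored s)) (color_of A (colored s)) s)"

definition run :: "(coloring \<Rightarrow> coloring) \<Rightarrow> (nat \<Rightarrow> real set) \<Rightarrow> coloring \<Rightarrow> nat \<Rightarrow> coloring" where
  "run A ring C k = colored ((gstep A ring ^^ k) \<lparr>time = 0, colored = C\<rparr>)"

text \<open>The initial coloring is arbitrary because the inductions peel off the first step and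
  continue from the coloring that it produces.\<close>

definition deviation :: "(coloring \<Rightarrow> coloring) \<Rightarrow> (nat \<Rightarrow> real set) \<Rightarrow> coloring \<Rightarrow> nat \<Rightarrow> real" where
  "deviation A ring C k = real (card (run A ring C k Red)) - real (card (C Red)) - (\<Sum>j<k. red_rate A (run A ring C j))"

abbreviation rings :: "(nat \<Rightarrow> real stream) \<Rightarrow> nat \<Rightarrow> real set" where
  "rings \<gamma> \<equiv> \<lambda>v. range (ring_time (\<gamma> v))"

section \<open>Shifting the time origin\<close>

lemma Inf_ereal_add: "Inf ((+) (ereal t) ` S) = ereal t + Inf S"
proof (rule antisym)
  have "Inf ((+) (ereal t) ` S) - ereal t \<le> s" if "s \<in> S" for s
  proof -
    have "Inf ((+) (ereal t) ` S) \<le> ereal t + s" using that by (intro Inf_lower) auto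
    then show ?thesis by (simp add: ereal_minus_le_iff add.commute)
  qed
  then have "Inf ((+) (ereal t) ` S) - ereal t \<le> Inf S" by (intro Inf_greatest)
  then show "Inf ((+) (ereal t) ` S) \<le> ereal t + Inf S" by (simp add: ereal_minus_le_iff add.commute)
qed (auto intro!: Inf_greatest add_left_mono Inf_lower)

text \<open>The time \<open>\<tau>\<close> is an extended real, since the next ring of a clock
  without further rings is infinite, being the infimum of the empty set.\<close>

lemma next_ring_shift:
  assumes R: "R' v = {u - t | u. u \<in> R v \<and> t < u}" and "0 \<le> \<tau>"
  shows "percolation.next_ring R (ereal t + \<tau>) v = ereal t + percolation.next_ring R' \<tau> v"
proof -
  have "{u \<in> ereal ` R v. ereal t + \<tau> < u} = (+) (ereal t) ` {u \<in> ereal ` R' v. \<tau> < u}" (is "?L = ?R")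
  proof
    show "?L \<subseteq> ?R"
    proof
      fix u assume "u \<in> ?L"
      then obtain x where x: "u = ereal x" "x \<in> R v" "ereal t + \<tau> < ereal x" by auto
      then have \<tau>: "\<tau> < ereal (x - t)" by (cases \<tau>) auto
      then have "t < x" using \<open>0 \<le> \<tau>\<close> by (cases \<tau>) auto
      then have "x - t \<in> R' v" using x R by auto
      then show "u \<in> ?R" using \<tau> x by (intro image_eqI[of _ _ "ereal (x - t)"]) auto
    qed
    show "?R \<subseteq> ?L"
    proof
      fix u assume "u \<in> ?R"
      then obtain x where x: "x \<in> R v" "\<tau> < ereal (x - t)" "u = ereal x"
        using R by auto
      then show "u \<in> ?L" by (cases \<tau>) auto
    qed
  qed
  then show ?thesis unfolding percolation.next_ring_def by (simp only: Inf_ereal_add)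
qed

lemma next_ring_ge: "t \<le> percolation.next_ring R t v"
  unfolding percolation.next_ring_def by (intro Inf_greatest) auto

lemma ereal_add_less_cancel: "ereal t + a < ereal t + b \<longleftrightarrow> a < b"
  by (cases a; cases b) auto

text \<open>\<open>arg_min_on\<close> chooses among the minimizers. The choices agree because the
  predicates that define the minimizers are equal, ties included.\<close>

lemma arg_min_on_add:
  assumes "\<And>v. v \<in> S \<Longrightarrow> f v = ereal t + g v"
  shows "arg_min_on f S = arg_min_on g S"
proof -
  have "is_arg_min f (\<lambda>x. x \<in> S) v \<longleftrightarrow> is_arg_min g (\<lambda>x. x \<in> S) v" for v
    unfolding is_arg_min_def using assms
    by (metis ereal_add_less_cancel)
  then have "is_arg_min f (\<lambda>x. x \<in> S) = is_arg_min g (\<lambda>x. x \<in> S)" by blast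
  then show ?thesis unfolding arg_min_on_def arg_min_def by simp
qed

lemma gstep_shift:
  assumes R: "\<And>v. v \<in> I \<Longrightarrow> R' v = {u - t | u. u \<in> R v \<and> t < u}"
    and A: "\<And>C. avail A C \<subseteq> I" "finite I"
    and s: "time s = ereal t + time s'" "colored s = colored s'" "0 \<le> time s'"
  shows "time (gstep A R s) = ereal t + time (gstep A R' s')"
    "colored (gstep A R s) = colored (gstep A R' s')" "0 \<le> time (gstep A R' s')"
proof -
  let ?V = "avail A (colored s')"
  have n: "percolation.next_ring R (time s) v = ereal t + percolation.next_ring R' (time s') v" if "v \<in> ?V" for v
    unfolding s(1) using that R A s by (intro next_ring_shift) auto
  have a: "arg_min_on (percolation.next_ring R (time s)) ?V = arg_min_on (percolation.next_ring R' (time s')) ?V"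
    by (rule arg_min_on_add) (rule n)
  have m: "arg_min_on (percolation.next_ring R' (time s')) ?V \<in> ?V" if "?V \<noteq> {}"
    using arg_min_if_finite(1)[OF _ that] finite_subset[OF A(1) A(2)] by blast
  show "time (gstep A R s) = ereal t + time (gstep A R' s')"
  proof (cases "?V = {}")
    case False
    then have "time (gstep A R s) = percolation.next_ring R (time s) (arg_min_on (percolation.next_ring R' (time s')) ?V)"
      using s by (simp add: gstep_def percolation.activate_def Let_def a[unfolded s(1)])
    also have "\<dots> = ereal t + percolation.next_ring R' (time s') (arg_min_on (percolation.next_ring R' (time s')) ?V)"
      by (rule n[OF m[OF False]])
    finally show ?thesis using False by (simp add: gstep_def percolation.activate_def Let_def)
  qed (use s in \<open>auto simp: gstep_def\<close>)
  show "colored (gstep A R s) = colored (gstep A R' s')"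
    using s by (auto simp: gstep_def percolation.activate_def Let_def a[unfolded s(1)])
  show "0 \<le> time (gstep A R' s')"
    using s order.trans[OF s(3) next_ring_ge] by (auto simp: gstep_def percolation.activate_def Let_def)
qed

lemma run_shift:
  assumes R: "\<And>v. v \<in> I \<Longrightarrow> R' v = {u - t | u. u \<in> R v \<and> t < u}"
    and A: "\<And>C. avail A C \<subseteq> I" "finite I"
  shows "colored ((gstep A R ^^ k) \<lparr>time = ereal t, colored = C\<rparr>) = run A R' C k"
proof -
  let ?s = "\<lambda>k. (gstep A R ^^ k) \<lparr>time = ereal t, colored = C\<rparr>"
  let ?s' = "\<lambda>k. (gstep A R' ^^ k) \<lparr>time = 0, colored = C\<rparr>"
  have "time (?s k) = ereal t + time (?s' k) \<and> colored (?s k) = colored (?s' k) \<and> 0 \<le> time (?s' k)"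
  proof (induction k)
    case (Suc k)
    then show ?case using gstep_shift[OF R A, where s="?s k" and s'="?s' k"] by auto
  qed simp
  then show ?thesis by (simp add: run_def)
qed

lemma next_ring_good:
  assumes g: "good_clock (\<gamma> v)"
  shows "percolation.next_ring (rings \<gamma>) 0 v = ereal (shd (\<gamma> v))"
  unfolding percolation.next_ring_def
proof (rule Inf_eqI)
  have pos: "0 < shd (\<gamma> v)" using g by (auto simp: good_clock_def dest: spec[of _ 0])
  fix u assume "u \<in> {u \<in> ereal ` rings \<gamma> v. 0 < u}"
  then show "ereal (shd (\<gamma> v)) \<le> u" using ring_time_mono[OF g, of 0] by (auto simp: ring_time_0)
next
  fix y assume y: "\<And>u. u \<in> {u \<in> ereal ` rings \<gamma> v. 0 < u} \<Longrightarrow> y \<le> u"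
  have pos: "0 < shd (\<gamma> v)" using g by (auto simp: good_clock_def dest: spec[of _ 0])
  then show "y \<le> ereal (shd (\<gamma> v))" using ring_time_0[of "\<gamma> v"] by (intro y) (auto intro!: image_eqI[of _ _ "shd (\<gamma> v)"] simp: image_iff, metis)
qed

lemma gstep_first:
  assumes I: "\<And>v. v \<in> I \<Longrightarrow> good_clock (\<gamma> v)" "finite I" and A: "\<And>C. avail A C \<subseteq> I"
    and v: "v \<in> avail A C" "strict_first (avail A C) v \<gamma>"
  shows "gstep A (rings \<gamma>) \<lparr>time = 0, colored = C\<rparr> = \<lparr>time = ereal (shd (\<gamma> v)), colored = add_node A C v\<rparr>"
proof -
  let ?f = "percolation.next_ring (rings \<gamma>) 0"
  have f: "?f w = ereal (shd (\<gamma> w))" if "w \<in> avail A C" for w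
    using that A I by (intro next_ring_good) auto
  have fin: "finite (avail A C)" using finite_subset[OF A I(2)] .
  have "arg_min_on ?f (avail A C) = v"
  proof (rule ccontr)
    assume ne: "arg_min_on ?f (avail A C) \<noteq> v"
    have "arg_min_on ?f (avail A C) \<in> avail A C" using fin v by (intro arg_min_if_finite) auto
    moreover have "?f (arg_min_on ?f (avail A C)) \<le> ?f v" using fin v by (intro arg_min_least) auto
    ultimately show False using ne v f by (auto simp: strict_first_def) (metis Diff_iff leD singletonD)
  qed
  then show ?thesis using v f[OF v(1)]
    by (auto simp: gstep_def percolation.activate_def Let_def add_node_def)
qed

text \<open>After the first ring only later rings matter, and these are the rings of the restarted
  clocks with the origin moved to that time.\<close>

lemma run_Suc_first:
  assumes I: "\<And>v. v \<in> I \<Longrightarrow> good_clock (\<gamma> v)" "finite I" and A: "\<And>C. avail A C \<subseteq> I"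
    and v: "v \<in> avail A C" "strict_first (avail A C) v \<gamma>"
  shows "run A (rings \<gamma>) C (Suc k) = run A (rings (restart_all I v \<gamma>)) (add_node A C v) k"
proof -
  have "run A (rings \<gamma>) C (Suc k) = colored ((gstep A (rings \<gamma>) ^^ k) \<lparr>time = ereal (shd (\<gamma> v)), colored = add_node A C v\<rparr>)"
    unfolding run_def funpow_Suc_right using gstep_first[OF I A v] by simp
  also have "\<dots> = run A (rings (restart_all I v \<gamma>)) (add_node A C v) k"
    using I(1) by (intro run_shift[where I=I, OF _ A I(2)]) (simp add: restart_all_def rings_restart)
  finally show ?thesis .
qed

lemma run_0 [simp]: "run A R C 0 = C"
  by (simp add: run_def)

lemma run_stuck: "avail A C = {} \<Longrightarrow> run A R C k = C"
  unfolding run_def by (induction k) (auto simp: gstep_def)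

lemma deviation_0 [simp]: "deviation A R C 0 = 0"
  by (simp add: deviation_def)

text \<open>In a stuck chain \<open>red_rate\<close> is \<open>0 / 0 = 0\<close>, so the
  compensating sum stops growing along with the count.\<close>

lemma deviation_stuck: "avail A C = {} \<Longrightarrow> deviation A R C k = 0"
  by (simp add: deviation_def run_stuck red_rate_def)

lemma deviation_Suc_first:
  assumes I: "\<And>v. v \<in> I \<Longrightarrow> good_clock (\<gamma> v)" "finite I" and A: "\<And>C. avail A C \<subseteq> I"
    and new: "A C Red \<inter> C Red = {}" "finite (C Red)"
    and v: "v \<in> avail A C" "strict_first (avail A C) v \<gamma>"
  shows "deviation A (rings \<gamma>) C (Suc k)
    = (of_bool (v \<in> A C Red) - red_rate A C) + deviation A (rings (restart_all I v \<gamma>)) (add_node A C v) k"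
proof -
  have "real (card (add_node A C v Red)) = card (C Red) + of_bool (v \<in> A C Red)"
  proof (cases "v \<in> A C Red")
    case True
    then have "v \<notin> C Red" using new by blast
    then show ?thesis using True new by (simp add: add_node_def color_of_def)
  qed (simp add: add_node_def color_of_def)
  moreover have "run A (rings \<gamma>) C (Suc j) = run A (rings (restart_all I v \<gamma>)) (add_node A C v) j" for j
    by (rule run_Suc_first[OF I A v])
  ultimately show ?thesis
    unfolding deviation_def sum.lessThan_Suc_shift by simp
qed

text \<open>Almost surely \<open>exp_dev l A I k C \<gamma>\<close> is the exponential of \<open>l\<close> times the deviation after \<open>k\<close> steps.
  The sum over the node that rings first makes it measurable in the clocks.\<close>

primrec exp_dev :: "real \<Rightarrow> (coloring \<Rightarrow> coloring) \<Rightarrow> nat set \<Rightarrow> nat \<Rightarrow> coloring \<Rightarrow> (nat \<Rightarrow> real stream) \<Rightarrow> ennreal" where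
  "exp_dev l A I 0 C \<gamma> = 1"
| "exp_dev l A I (Suc k) C \<gamma> = (if avail A C = {} then 1 else
     (\<Sum>v\<in>avail A C. ennreal (exp (l * (of_bool (v \<in> A C Red) - red_rate A C))) *
        (of_bool (strict_first (avail A C) v \<gamma>) * exp_dev l A I k (add_node A C v) (restart_all I v \<gamma>))))"

lemma measurable_exp_dev:
  assumes "finite I" "\<And>C. avail A C \<subseteq> I"
  shows "exp_dev l A I k C \<in> borel_measurable (clocks I)"
proof (induction k arbitrary: C)
  case (Suc k)
  have fin: "finite (avail A C)" using finite_subset[OF assms(2,1)] .
  have [measurable]: "(\<lambda>\<gamma>. exp_dev l A I k (add_node A C v) (restart_all I v \<gamma>)) \<in> borel_measurable (clocks I)"
    "Measurable.pred (clocks I) (strict_first (avail A C) v)" if "v \<in> avail A C" for v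
  proof -
    have "v \<in> I" using that assms by auto
    then show "(\<lambda>\<gamma>. exp_dev l A I k (add_node A C v) (restart_all I v \<gamma>)) \<in> borel_measurable (clocks I)"
      by (intro measurable_compose[OF measurable_restart_all Suc.IH])
    show "Measurable.pred (clocks I) (strict_first (avail A C) v)"
      using that \<open>v \<in> I\<close> assms fin by (intro pred_strict_first) auto
  qed
  have "(\<lambda>\<gamma>. exp_dev l A I (Suc k) C \<gamma>) \<in> borel_measurable (clocks I)"
    unfolding exp_dev.simps by (cases "avail A C = {}") (simp_all, measurable)
  then show ?case by simp
qed (simp add: exp_dev.simps(1)[abs_def])

section \<open>Sub-Gaussian bounds for the deviation\<close>

lemma sum_exp_uniform_le:
  fixes l :: real
  assumes fin: "finite V" "V \<noteq> {}" and "\<bar>l\<bar> \<le> 1" "B \<subseteq> V"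
  shows "(\<Sum>v\<in>V. exp (l * (of_bool (v \<in> B) - card B / card V))) \<le> card V * exp (l\<^sup>2)"
proof -
  let ?u = "card B / card V"
  have cV: "0 < card V" using fin by (simp add: card_gt_0_iff)
  have u: "0 \<le> ?u" "?u \<le> 1" using cV card_mono[OF fin(1) \<open>B \<subseteq> V\<close>] by auto
  have x: "exp (l * (of_bool (v \<in> B) - ?u)) \<le> 1 + l * (of_bool (v \<in> B) - ?u) + l\<^sup>2" for v
  proof -
    have "\<bar>of_bool (v \<in> B) - ?u\<bar> \<le> 1" using u by auto
    then have a: "\<bar>l * (of_bool (v \<in> B) - ?u)\<bar> \<le> \<bar>l\<bar>"
      using mult_left_mono[of _ 1 "\<bar>l\<bar>"] by (simp add: abs_mult)
    then have "(l * (of_bool (v \<in> B) - ?u))\<^sup>2 \<le> l\<^sup>2"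
      using abs_le_square_iff[of "l * (of_bool (v \<in> B) - ?u)" l] by simp
    moreover have "l * (of_bool (v \<in> B) - ?u) \<le> 1" using a \<open>\<bar>l\<bar> \<le> 1\<close> by linarith
    ultimately show ?thesis using exp_le_quadratic[of "l * (of_bool (v \<in> B) - ?u)"] by linarith
  qed
  have s: "(\<Sum>v\<in>V. of_bool (v \<in> B) :: real) = card B"
    using fin(1) \<open>B \<subseteq> V\<close> by (simp add: of_bool_def sum.If_cases Int_absorb1)
  have "(\<Sum>v\<in>V. exp (l * (of_bool (v \<in> B) - ?u))) \<le> (\<Sum>v\<in>V. 1 + l * (of_bool (v \<in> B) - ?u) + l\<^sup>2)"
    by (intro sum_mono x)
  \<comment> \<open>The linear terms cancel, since the indicator of \<open>B\<close> averages to
    \<open>card B / card V\<close> over \<open>V\<close>.\<close>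
  also have "\<dots> = card V * (1 + l\<^sup>2)"
    using cV by (simp add: sum.distrib sum_distrib_left[symmetric] sum_subtractf s algebra_simps)
  also have "\<dots> \<le> card V * exp (l\<^sup>2)"
    by (intro mult_left_mono exp_ge_add_one_self) auto
  finally show ?thesis .
qed

text \<open>The winner is uniform and independent of the restarted clocks, so each step costs at
  most a factor \<open>exp (l^2)\<close>, whatever the coloring it starts from.\<close>

lemma nn_integral_exp_dev_le:
  assumes fin: "finite I" and A: "\<And>C. avail A C \<subseteq> I" and l: "\<bar>l\<bar> \<le> 1"
  shows "(\<integral>\<^sup>+ \<gamma>. exp_dev l A I k C \<gamma> \<partial>clocks I) \<le> ennreal (exp (l\<^sup>2 * k))"
proof (induction k arbitrary: C)
  case 0
  show ?case using prob_space.emeasure_space_1[OF prob_space_clocks] by simp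
next
  case (Suc k)
  let ?V = "avail A C"
  show ?case
  proof (cases "?V = {}")
    case True
    then show ?thesis using prob_space.emeasure_space_1[OF prob_space_clocks] by (simp add: ennreal_leI)
  next
    case False
    have finV: "finite ?V" using finite_subset[OF A fin] .
    then have cV: "0 < card ?V" using False by (simp add: card_gt_0_iff)
    have m: "(\<lambda>\<gamma>. of_bool (strict_first ?V v \<gamma>) * exp_dev l A I k (add_node A C v) (restart_all I v \<gamma>)) \<in> borel_measurable (clocks I)"
      if "v \<in> ?V" for v
    proof -
      have "v \<in> I" using that A by auto
      then have [measurable]: "(\<lambda>\<gamma>. exp_dev l A I k (add_node A C v) (restart_all I v \<gamma>)) \<in> borel_measurable (clocks I)"
        by (intro measurable_compose[OF measurable_restart_all measurable_exp_dev[OF fin A]])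
      have [measurable]: "Measurable.pred (clocks I) (strict_first ?V v)"
        using that \<open>v \<in> I\<close> A finV by (intro pred_strict_first) auto
      show ?thesis by measurable
    qed
    have "(\<integral>\<^sup>+ \<gamma>. exp_dev l A I (Suc k) C \<gamma> \<partial>clocks I)
      = (\<Sum>v\<in>?V. \<integral>\<^sup>+ \<gamma>. ennreal (exp (l * (of_bool (v \<in> A C Red) - red_rate A C))) * (of_bool (strict_first ?V v \<gamma>) * exp_dev l A I k (add_node A C v) (restart_all I v \<gamma>)) \<partial>clocks I)"
      using False m by (simp add: nn_integral_sum)
    also have "\<dots> = (\<Sum>v\<in>?V. ennreal (exp (l * (of_bool (v \<in> A C Red) - red_rate A C))) *
        (ennreal (1 / card ?V) * (\<integral>\<^sup>+ \<gamma>. exp_dev l A I k (add_node A C v) \<gamma> \<partial>clocks I)))"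
      by (intro sum.cong refl, subst nn_integral_cmult[OF m])
        (auto simp: nn_integral_strict_first[OF fin A] measurable_exp_dev[OF fin A])
    also have "\<dots> \<le> (\<Sum>v\<in>?V. ennreal (exp (l * (of_bool (v \<in> A C Red) - red_rate A C))) *
        (ennreal (1 / card ?V) * ennreal (exp (l\<^sup>2 * k))))"
      by (intro sum_mono mult_left_mono Suc.IH) auto
    also have "\<dots> = ennreal ((\<Sum>v\<in>?V. exp (l * (of_bool (v \<in> A C Red) - red_rate A C))) * (1 / card ?V * exp (l\<^sup>2 * k)))"
      by (simp add: ennreal_mult[symmetric] sum_distrib_right sum_divide_distrib)
    also have "\<dots> \<le> ennreal ((card ?V * exp (l\<^sup>2)) * (1 / card ?V * exp (l\<^sup>2 * k)))"
      unfolding red_rate_def using False finV l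
      by (intro ennreal_leI mult_right_mono sum_exp_uniform_le) (auto simp: avail_def)
    also have "\<dots> = ennreal (exp (l\<^sup>2 * Suc k))"
      using cV by (simp add: exp_add[symmetric] algebra_simps)
    finally show ?thesis .
  qed
qed

lemma AE_good_clocks: "finite I \<Longrightarrow> AE \<gamma> in clocks I. \<forall>v\<in>I. good_clock (\<gamma> v)"
  by (intro AE_finite_allI AE_PiM_component AE_good_clock gaps.prob_space_axioms)

text \<open>The events for different \<open>v\<close> are disjoint and have probability
  \<open>1 / card V\<close> each, so together they have probability 1. That ties are null comes out
  as a consequence.\<close>

lemma AE_strict_first:
  assumes fin: "finite I" and V: "V \<subseteq> I" "V \<noteq> {}"
  shows "AE \<gamma> in clocks I. \<exists>v\<in>V. strict_first V v \<gamma>"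
proof -
  interpret C: prob_space "clocks I" by (rule prob_space_clocks)
  have finV: "finite V" using finite_subset V fin by auto
  then have cV: "0 < card V" using V by (simp add: card_gt_0_iff)
  let ?E = "\<lambda>v. {\<gamma> \<in> space (clocks I). strict_first V v \<gamma>}"
  have E[measurable]: "?E v \<in> sets (clocks I)" if "v \<in> V" for v
    by (intro predE pred_strict_first) (use that V finV in auto)
  have e: "emeasure (clocks I) (?E v) = ennreal (1 / card V)" if "v \<in> V" for v
  proof -
    have "emeasure (clocks I) (?E v) = (\<integral>\<^sup>+ \<gamma>. of_bool (strict_first V v \<gamma>) * 1 \<partial>clocks I)"
    proof -
      have "(\<integral>\<^sup>+ \<gamma>. of_bool (strict_first V v \<gamma>) * 1 \<partial>clocks I) = (\<integral>\<^sup>+ \<gamma>. indicator (?E v) \<gamma> \<partial>clocks I)"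
        by (intro nn_integral_cong) (auto simp: indicator_def)
      then show ?thesis using E[OF that] by simp
    qed
    then show ?thesis using nn_integral_strict_first[OF fin V(1) that, of "\<lambda>_. 1"] C.emeasure_space_1 by simp
  qed
  have "emeasure (clocks I) (\<Union>v\<in>V. ?E v) = (\<Sum>v\<in>V. emeasure (clocks I) (?E v))"
  proof (rule sum_emeasure[symmetric])
    show "disjoint_family_on ?E V"
      by (auto simp: disjoint_family_on_def strict_first_def) (metis Diff_iff less_asym singletonD)
  qed (use finV E in auto)
  also have "\<dots> = (\<Sum>v\<in>V. ennreal (1 / card V))" by (rule sum.cong) (auto simp: e)
  also have "\<dots> = ennreal (\<Sum>v\<in>V. 1 / card V)" by (rule sum_ennreal) auto
  also have "\<dots> = 1" using cV by simp
  finally have "C.prob (\<Union>v\<in>V. ?E v) = 1" by (simp add: measure_def)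
  then have "AE \<gamma> in clocks I. \<gamma> \<in> (\<Union>v\<in>V. ?E v)" by (rule C.AE_prob_1)
  then show ?thesis by eventually_elim auto
qed

text \<open>On the event that \<open>v\<close> wins, the law of the restarted clocks is a multiple
  of the original one and charges none of its null sets.\<close>

lemma AE_restart_all:
  assumes fin: "finite I" and V: "V \<subseteq> I" "v \<in> V" and P: "AE \<gamma> in clocks I. P \<gamma>"
  shows "AE \<gamma> in clocks I. strict_first V v \<gamma> \<longrightarrow> P (restart_all I v \<gamma>)"
proof -
  from P obtain N where N: "{\<gamma> \<in> space (clocks I). \<not> P \<gamma>} \<subseteq> N" "emeasure (clocks I) N = 0" "N \<in> sets (clocks I)"
    by (rule AE_E)
  note N(3)[measurable]
  have v: "v \<in> I" and [measurable]: "Measurable.pred (clocks I) (strict_first V v)"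
    using V fin finite_subset[of V I] by (auto intro!: pred_strict_first)
  note [measurable] = measurable_restart_all[OF v]
  have "(\<integral>\<^sup>+ \<gamma>. of_bool (strict_first V v \<gamma>) * indicator N (restart_all I v \<gamma>) \<partial>clocks I) = 0"
    using N by (subst nn_integral_strict_first[OF fin V]) auto
  then have "AE \<gamma> in clocks I. of_bool (strict_first V v \<gamma>) * indicator N (restart_all I v \<gamma>) = (0 :: ennreal)"
    by (subst (asm) nn_integral_0_iff_AE) auto
  moreover have "AE \<gamma> in clocks I. restart_all I v \<gamma> \<in> space (clocks I)"
    by (intro AE_I2) (rule measurable_space[OF measurable_restart_all[OF v]])
  ultimately show ?thesis
    by eventually_elim (use N in \<open>auto simp: indicator_def split: if_splits\<close>)
qed

text \<open>Almost surely exactly one node wins strictly, so a single summand of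
  \<open>exp_dev\<close> survives and the recursion follows that of
  \<open>deviation\<close>.\<close>

lemma AE_exp_dev:
  assumes fin: "finite I" and A: "\<And>C. avail A C \<subseteq> I" and new: "\<And>C. A C Red \<inter> C Red = {}" and C: "finite (C Red)"
  shows "AE \<gamma> in clocks I. exp_dev l A I k C \<gamma> = ennreal (exp (l * deviation A (rings \<gamma>) C k))"
  using C
proof (induction k arbitrary: C)
  case (Suc k)
  let ?V = "avail A C"
  show ?case
  proof (cases "?V = {}")
    case True
    then show ?thesis by (simp add: deviation_stuck)
  next
    case False
    have finV: "finite ?V" using finite_subset[OF A fin] .
    have "AE \<gamma> in clocks I. \<forall>v\<in>?V. strict_first ?V v \<gamma> \<longrightarrow>
      exp_dev l A I k (add_node A C v) (restart_all I v \<gamma>)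
       = ennreal (exp (l * deviation A (rings (restart_all I v \<gamma>)) (add_node A C v) k))"
      using Suc.prems by (intro AE_finite_allI[OF finV] AE_restart_all[OF fin A] Suc.IH) (auto simp: add_node_def)
    with AE_good_clocks[OF fin] AE_strict_first[OF fin A False] show ?thesis
    proof eventually_elim
      fix \<gamma>
      assume good: "\<forall>v\<in>I. good_clock (\<gamma> v)" and ex: "\<exists>v\<in>?V. strict_first ?V v \<gamma>"
        and IH: "\<forall>v\<in>?V. strict_first ?V v \<gamma> \<longrightarrow> exp_dev l A I k (add_node A C v) (restart_all I v \<gamma>)
          = ennreal (exp (l * deviation A (rings (restart_all I v \<gamma>)) (add_node A C v) k))"
      from ex obtain v where v: "v \<in> ?V" "strict_first ?V v \<gamma>" by auto
      have u: "strict_first ?V w \<gamma> \<longleftrightarrow> w = v" if "w \<in> ?V" for w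
        using v that unfolding strict_first_def by (metis Diff_iff less_asym singletonD)
      have "exp_dev l A I (Suc k) C \<gamma> = (\<Sum>w\<in>?V. if w = v then ennreal (exp (l * (of_bool (v \<in> A C Red) - red_rate A C))) *
         exp_dev l A I k (add_node A C v) (restart_all I v \<gamma>) else 0)"
        using False u by (auto intro!: sum.cong)
      also have "\<dots> = ennreal (exp (l * (of_bool (v \<in> A C Red) - red_rate A C))) *
         ennreal (exp (l * deviation A (rings (restart_all I v \<gamma>)) (add_node A C v) k))"
        using v finV IH by simp
      also have "\<dots> = ennreal (exp (l * deviation A (rings \<gamma>) C (Suc k)))"
      proof -
        have "deviation A (rings \<gamma>) C (Suc k) = (of_bool (v \<in> A C Red) - red_rate A C)
            + deviation A (rings (restart_all I v \<gamma>)) (add_node A C v) k"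
          using good by (intro deviation_Suc_first[OF _ fin A new Suc.prems v]) auto
        then show ?thesis
          by (simp only: distrib_left exp_add) (rule ennreal_mult[symmetric], auto)
      qed
      finally show "exp_dev l A I (Suc k) C \<gamma> = ennreal (exp (l * deviation A (rings \<gamma>) C (Suc k)))" .
    qed
  qed
qed simp

text \<open>Exponential Markov inequality with both signs of \<open>l\<close>. The conclusion speaks
  of a measurable cover of the exceptional set, because the exponential of \<open>deviation\<close>
  agrees with the measurable \<open>exp_dev\<close> only almost surely.\<close>

lemma deviation_tail:
  assumes fin: "finite I" and A: "\<And>C. avail A C \<subseteq> I" and new: "\<And>C. A C Red \<inter> C Red = {}" and C: "finite (C Red)"
    and l: "0 \<le> l" "l \<le> 1"
  shows "\<exists>B\<in>sets (clocks I). emeasure (clocks I) B \<le> ennreal (2 * exp (l\<^sup>2 * k - l * c))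
    \<and> (\<forall>\<gamma>\<in>space (clocks I) - B. \<bar>deviation A (rings \<gamma>) C k\<bar> < c)"
proof -
  have tail: "\<exists>B\<in>sets (clocks I). emeasure (clocks I) B \<le> ennreal (exp (l\<^sup>2 * k - l * c))
    \<and> (\<forall>\<gamma>\<in>space (clocks I) - B. \<mu> * deviation A (rings \<gamma>) C k < l * c)" if \<mu>: "\<bar>\<mu>\<bar> = l" for \<mu>
  proof -
    have [measurable]: "exp_dev \<mu> A I k C \<in> borel_measurable (clocks I)"
      by (rule measurable_exp_dev[OF fin A])
    from AE_exp_dev[where A=A and C=C and I=I and l=\<mu> and k=k, OF fin A new C] obtain N where
      N: "{\<gamma> \<in> space (clocks I). \<not> exp_dev \<mu> A I k C \<gamma> = ennreal (exp (\<mu> * deviation A (rings \<gamma>) C k))} \<subseteq> N"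
        "emeasure (clocks I) N = 0" "N \<in> sets (clocks I)"
      by (rule AE_E)
    let ?B = "{\<gamma> \<in> space (clocks I). 1 \<le> ennreal (exp (- (l * c))) * exp_dev \<mu> A I k C \<gamma>}"
    have "emeasure (clocks I) ?B \<le> ennreal (exp (- (l * c))) * (\<integral>\<^sup>+ \<gamma>. exp_dev \<mu> A I k C \<gamma> * indicator (space (clocks I)) \<gamma> \<partial>clocks I)"
      using nn_integral_Markov_inequality[of "exp_dev \<mu> A I k C" "space (clocks I)" "clocks I" "ennreal (exp (- (l * c)))"]
      by (simp add: conj_commute)
    also have "(\<integral>\<^sup>+ \<gamma>. exp_dev \<mu> A I k C \<gamma> * indicator (space (clocks I)) \<gamma> \<partial>clocks I) = (\<integral>\<^sup>+ \<gamma>. exp_dev \<mu> A I k C \<gamma> \<partial>clocks I)"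
      by (intro nn_integral_cong) auto
    also have "ennreal (exp (- (l * c))) * (\<integral>\<^sup>+ \<gamma>. exp_dev \<mu> A I k C \<gamma> \<partial>clocks I) \<le> ennreal (exp (- (l * c))) * ennreal (exp (\<mu>\<^sup>2 * k))"
      using \<mu> l by (intro mult_left_mono nn_integral_exp_dev_le[OF fin A]) auto
    also have "\<dots> = ennreal (exp (l\<^sup>2 * k - l * c))"
      using \<mu> by (auto simp: ennreal_mult[symmetric] exp_add[symmetric] power2_abs[symmetric, of \<mu>])
    finally have B: "emeasure (clocks I) ?B \<le> ennreal (exp (l\<^sup>2 * k - l * c))" .
    have "emeasure (clocks I) (?B \<union> N) \<le> emeasure (clocks I) ?B + emeasure (clocks I) N"
      using N by (intro emeasure_subadditive) auto
    with B N have BN: "emeasure (clocks I) (?B \<union> N) \<le> ennreal (exp (l\<^sup>2 * k - l * c))" by simp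
    have "\<mu> * deviation A (rings \<gamma>) C k < l * c" if \<gamma>: "\<gamma> \<in> space (clocks I) - (?B \<union> N)" for \<gamma>
    proof (rule ccontr)
      assume "\<not> ?thesis"
      then have "1 \<le> exp (- (l * c)) * exp (\<mu> * deviation A (rings \<gamma>) C k)"
        by (simp add: exp_add[symmetric])
      then have "1 \<le> ennreal (exp (- (l * c))) * ennreal (exp (\<mu> * deviation A (rings \<gamma>) C k))"
        by (simp add: ennreal_mult[symmetric])
      then show False using \<gamma> N by auto
    qed
    then show ?thesis using BN N by (intro bexI[of _ "?B \<union> N"]) auto
  qed
  obtain B1 where B1: "B1 \<in> sets (clocks I)" "emeasure (clocks I) B1 \<le> ennreal (exp (l\<^sup>2 * k - l * c))"
    "\<And>\<gamma>. \<gamma> \<in> space (clocks I) - B1 \<Longrightarrow> l * deviation A (rings \<gamma>) C k < l * c"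
    using tail[of l] l by auto
  obtain B2 where B2: "B2 \<in> sets (clocks I)" "emeasure (clocks I) B2 \<le> ennreal (exp (l\<^sup>2 * k - l * c))"
    "\<And>\<gamma>. \<gamma> \<in> space (clocks I) - B2 \<Longrightarrow> - l * deviation A (rings \<gamma>) C k < l * c"
    using tail[of "- l"] l by auto
  have "emeasure (clocks I) (B1 \<union> B2) \<le> emeasure (clocks I) B1 + emeasure (clocks I) B2"
    using B1 B2 by (intro emeasure_subadditive) auto
  also have "\<dots> \<le> ennreal (exp (l\<^sup>2 * k - l * c)) + ennreal (exp (l\<^sup>2 * k - l * c))"
    using B1 B2 by (intro add_mono) auto
  also have "\<dots> = ennreal (2 * exp (l\<^sup>2 * k - l * c))"
    by (simp add: ennreal_plus[symmetric] del: ennreal_plus)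
  finally have m: "emeasure (clocks I) (B1 \<union> B2) \<le> ennreal (2 * exp (l\<^sup>2 * k - l * c))" .
  have "\<bar>deviation A (rings \<gamma>) C k\<bar> < c" if \<gamma>: "\<gamma> \<in> space (clocks I) - (B1 \<union> B2)" for \<gamma>
  proof -
    have 1: "l * deviation A (rings \<gamma>) C k < l * c" and 2: "l * (- deviation A (rings \<gamma>) C k) < l * c"
      using B1(3)[of \<gamma>] B2(3)[of \<gamma>] \<gamma> by auto
    have "l \<noteq> 0" using 1 by auto
    then have "0 < l" using l by simp
    then have "deviation A (rings \<gamma>) C k < c" "- deviation A (rings \<gamma>) C k < c"
      using 1 2 by (simp_all only: mult_less_cancel_left_pos)
    then show ?thesis by (simp add: abs_less_iff)
  qed
  with m B1 B2 show ?thesis by (intro bexI[of _ "B1 \<union> B2"]) auto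
qed

section \<open>The percolation process before its natural stop\<close>

lemma gstep_avail_empty: "avail A (colored s) = {} \<Longrightarrow> gstep A R s = s"
  by (simp add: gstep_def)

lemma gstep_add_node:
  assumes "finite (avail A (colored s))" "avail A (colored s) \<noteq> {}"
  obtains v where "v \<in> avail A (colored s)" "colored (gstep A R s) = add_node A (colored s) v"
proof -
  let ?v = "arg_min_on (percolation.next_ring R (time s)) (avail A (colored s))"
  have "?v \<in> avail A (colored s)" using assms by (intro arg_min_if_finite)
  moreover have "colored (gstep A R s) = add_node A (colored s) ?v"
    using assms by (simp add: gstep_def percolation.activate_def Let_def add_node_def)
  ultimately show thesis by (rule that)
qed

lemma run_Suc: "run A R C (Suc k) = colored (gstep A R ((gstep A R ^^ k) \<lparr>time = 0, colored = C\<rparr>))"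
  by (simp add: run_def)

lemma run_Suc_cases:
  assumes "finite (avail A (run A R C k))"
  obtains "avail A (run A R C k) = {}" "run A R C (Suc k) = run A R C k"
  | v where "v \<in> avail A (run A R C k)" "run A R C (Suc k) = add_node A (run A R C k) v"
proof (cases "avail A (run A R C k) = {}")
  case True
  then show thesis by (intro that(1)) (auto simp: run_Suc gstep_avail_empty, simp add: run_def gstep_avail_empty)
next
  case False
  then show thesis
    using assms that(2) gstep_add_node[of A "(gstep A R ^^ k) \<lparr>time = 0, colored = C\<rparr>" R]
    unfolding run_Suc by (metis run_def)
qed

section \<open>The natural process as the chain with rule \<open>sus\<close>\<close>

context percolation
begin

definition dsum :: "color \<Rightarrow> nat \<Rightarrow> nat \<Rightarrow> real" where
  "dsum S v m = (\<Sum>i=1..m. E S v i)"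

text \<open>The counts are parameters here; the set belonging to a state of the process arises by
  inserting its random counts.\<close>

definition ahead :: "color \<Rightarrow> nat \<Rightarrow> nat \<Rightarrow> nat set" where
  "ahead S m m' = {v \<in> VW. real r \<le> dsum S v m - dsum (other S) v m'}"

definition crowded :: "nat \<Rightarrow> nat \<Rightarrow> nat set" where
  "crowded m m' = {v \<in> VW. real r + 1 \<le> dsum Red v m + dsum Black v m'}"

text \<open>Outside the relevant colorings \<open>sus\<close> is set to \<open>{}\<close>, so that it takes finitely many values only when
  the edges vary.\<close>

definition sus :: "coloring \<Rightarrow> coloring" where
  "sus C S = (if C Red \<union> C Black \<subseteq> VW
     then ahead S (card (C S) + a S) (card (C (other S)) + a (other S)) - (C Red \<union> C Black) else {})"

lemma sus_subset: "avail sus C \<subseteq> VW" "sus C S \<inter> C Red = {}" "sus C S \<inter> C Black = {}"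
  by (auto simp: avail_def sus_def ahead_def)

lemma finite_VW: "finite VW"
  by (simp add: VW_def)

lemma finite_avail_sus: "finite (avail sus C)"
  using finite_subset[OF sus_subset(1) finite_VW] .

lemma sus_eq:
  "colored s Red \<union> colored s Black \<subseteq> VW \<Longrightarrow> sus (colored s) S = susceptible_to s S \<inter> white s"
  by (auto simp: sus_def susceptible_to_def ahead_def D_def N_def dsum_def white_def)

lemma natural_step_eq:
  assumes "colored s Red \<union> colored s Black \<subseteq> VW"
  shows "natural_step s = gstep sus ring s"
proof -
  have V: "susceptible s \<inter> white s = avail sus (colored s)"
    by (auto simp: susceptible_def avail_def sus_eq[OF assms])
  show ?thesis
  proof (cases "avail sus (colored s) = {}")
    case False
    let ?v = "arg_min_on (next_ring (time s)) (avail sus (colored s))"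
    have "?v \<in> avail sus (colored s)"
      using False finite_avail_sus by (intro arg_min_if_finite)
    then have "?v \<in> white s" by (simp flip: V)
    then have "(if ?v \<in> susceptible_to s Red then Red else Black) = color_of sus (colored s) ?v"
      by (simp add: color_of_def sus_eq[OF assms])
    then show ?thesis using False
      by (simp add: natural_step_def gstep_def V activate_def Let_def)
  qed (simp add: natural_step_def gstep_def V)
qed

abbreviation nat_run :: "nat \<Rightarrow> coloring" where
  "nat_run \<equiv> run sus ring (\<lambda>_. {})"

lemma nat_run_subset: "nat_run k S \<subseteq> VW"
proof (induction k arbitrary: S)
  case (Suc k)
  show ?case
  proof (rule run_Suc_cases[OF finite_avail_sus, of ring "\<lambda>_. {}" k])
    fix v assume "v \<in> avail sus (nat_run k)" "nat_run (Suc k) = add_node sus (nat_run k) v"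
    then show ?thesis using Suc sus_subset(1) by (auto simp: add_node_def)
  qed (use Suc in auto)
qed simp

lemma finite_nat_run: "finite (nat_run k S)"
  using finite_subset[OF nat_run_subset finite_VW] .

lemma natural_process_eq: "natural_process k = (gstep sus ring ^^ k) \<lparr>time = 0, colored = (\<lambda>_. {})\<rparr>"
proof (induction k)
  case (Suc k)
  have "colored (natural_process k) = nat_run k" using Suc by (simp add: run_def)
  then have "natural_step (natural_process k) = gstep sus ring (natural_process k)"
    using nat_run_subset[of k] by (intro natural_step_eq) auto
  then show ?case using Suc by (simp add: natural_process_def)
qed (simp add: natural_process_def initial_def)

lemma colored_natural_process: "colored (natural_process k) = nat_run k"
  by (simp add: natural_process_eq run_def)

lemma stop_iff: "susceptible (natural_process k) \<inter> white (natural_process k) = {} \<longleftrightarrow> avail sus (nat_run k) = {}"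
proof -
  have "colored (natural_process k) Red \<union> colored (natural_process k) Black \<subseteq> VW"
    using nat_run_subset[of k] by (simp add: colored_natural_process)
  from sus_eq[OF this] show ?thesis
    by (auto simp: susceptible_def avail_def colored_natural_process)
qed

lemma nat_run_disjoint: "nat_run k Red \<inter> nat_run k Black = {}"
proof (induction k)
  case (Suc k)
  show ?case
  proof (rule run_Suc_cases[OF finite_avail_sus, of ring "\<lambda>_. {}" k])
    fix v assume v: "v \<in> avail sus (nat_run k)" "nat_run (Suc k) = add_node sus (nat_run k) v"
    then have "v \<notin> nat_run k Red" "v \<notin> nat_run k Black"
      using sus_subset(2,3)[of "nat_run k"] unfolding avail_def by blast+
    then show ?thesis using Suc v(2) by (auto simp: add_node_def)
  qed (use Suc in auto)
qed simp

lemma card_add_node_sus: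
  assumes "v \<in> avail sus C" "finite (C Red)" "finite (C Black)"
  shows "card (add_node sus C v S) = card (C S) + of_bool (S = color_of sus C v)"
proof -
  have "v \<notin> C Red" "v \<notin> C Black" using assms(1) sus_subset(2,3)[of C] by (auto simp: avail_def)
  then show ?thesis using assms by (cases S) (auto simp: add_node_def)
qed

lemma card_nat_run:
  assumes "\<And>j. j < k \<Longrightarrow> avail sus (nat_run j) \<noteq> {}"
  shows "card (nat_run k Red) + card (nat_run k Black) = k"
  using assms
proof (induction k)
  case (Suc k)
  show ?case
  proof (rule run_Suc_cases[OF finite_avail_sus, of ring "\<lambda>_. {}" k])
    fix v assume v: "v \<in> avail sus (nat_run k)" "nat_run (Suc k) = add_node sus (nat_run k) v"
    then show ?thesis using Suc
      by (cases "color_of sus (nat_run k) v") (simp_all add: card_add_node_sus[OF v(1) finite_nat_run finite_nat_run])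
  qed (use Suc in auto)
qed simp

lemma card_nat_run_Suc:
  "card (nat_run k S) \<le> card (nat_run (Suc k) S)" "card (nat_run (Suc k) S) \<le> Suc (card (nat_run k S))"
proof -
  have "card (nat_run k S) \<le> card (nat_run (Suc k) S) \<and> card (nat_run (Suc k) S) \<le> Suc (card (nat_run k S))"
  proof (rule run_Suc_cases[OF finite_avail_sus, of ring "\<lambda>_. {}" k])
    fix v assume v: "v \<in> avail sus (nat_run k)" "nat_run (Suc k) = add_node sus (nat_run k) v"
    then show ?thesis
      by (simp add: card_add_node_sus[OF v(1) finite_nat_run finite_nat_run])
  qed auto
  then show "card (nat_run k S) \<le> card (nat_run (Suc k) S)" "card (nat_run (Suc k) S) \<le> Suc (card (nat_run k S))"
    by auto
qed

text \<open>Every step colors a new node, and there are \<open>nW\<close> of them. Hence the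
  \<open>LEAST\<close> in \<open>K_star\<close> is attained.\<close>

lemma exists_stop: "\<exists>k. avail sus (nat_run k) = {}"
proof (rule ccontr)
  assume "\<not> ?thesis"
  then have "card (nat_run (Suc nW) Red) + card (nat_run (Suc nW) Black) = Suc nW"
    by (intro card_nat_run) auto
  moreover have "card (nat_run (Suc nW) Red \<union> nat_run (Suc nW) Black) \<le> card VW"
    using nat_run_subset finite_VW by (intro card_mono) auto
  moreover have "card (nat_run (Suc nW) Red \<union> nat_run (Suc nW) Black) = card (nat_run (Suc nW) Red) + card (nat_run (Suc nW) Black)"
    using nat_run_disjoint finite_nat_run by (intro card_Un_disjoint)
  ultimately show False by (simp add: VW_def)
qed

lemma K_star_ge:
  assumes "\<And>j. j < k \<Longrightarrow> avail sus (nat_run j) \<noteq> {}"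
  shows "k \<le> K_star"
proof (rule ccontr)
  assume "\<not> ?thesis"
  moreover have "avail sus (nat_run K_star) = {}"
    unfolding K_star_def stop_iff by (rule LeastI_ex[OF exists_stop])
  ultimately show False using assms by auto
qed

lemma process_eq_nat_run:
  assumes "\<And>j. j < k \<Longrightarrow> avail sus (nat_run j) \<noteq> {}"
  shows "N (process k) S = card (nat_run k S)"
proof -
  have "process j = natural_process j" if "j \<le> K_star" for j
    using that by (induction j) (auto simp: natural_process_def)
  from this[OF K_star_ge[OF assms]] show ?thesis
    by (simp add: N_def colored_natural_process)
qed

text \<open>A crude comparison, for the regimes in which the active nodes are few compared with the
  susceptible ones.\<close>

lemma sus_card_bounds:
  fixes C :: coloring and S :: color
  assumes C: "C Red \<union> C Black \<subseteq> VW"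
  defines "T \<equiv> ahead S (card (C S) + a S) (card (C (other S)) + a (other S))"
  shows "card (sus C S) \<le> card T" "card T \<le> card (sus C S) + (card (C Red) + card (C Black))"
proof -
  have fT: "finite T" using finite_subset[OF _ finite_VW, of T] by (auto simp: T_def ahead_def)
  have s: "sus C S = T - (C Red \<union> C Black)" using C by (simp add: sus_def T_def)
  show "card (sus C S) \<le> card T" unfolding s using fT by (intro card_mono) auto
  have "card T \<le> card (sus C S \<union> (C Red \<union> C Black))"
    using fT finite_subset[OF C finite_VW] s by (intro card_mono) auto
  also have "\<dots> \<le> card (sus C S) + card (C Red \<union> C Black)" by (rule card_Un_le)
  also have "\<dots> \<le> card (sus C S) + (card (C Red) + card (C Black))" by (simp add: card_Un_le)
  finally show "card T \<le> card (sus C S) + (card (C Red) + card (C Black))" .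
qed

end

locale percolation01 = percolation +
  assumes E01: "\<And>S v i. v < nW \<Longrightarrow> 1 \<le> i \<Longrightarrow> E S v i = 0 \<or> E S v i = 1"
    and r_pos: "1 \<le> r"
begin

lemma dsum_nat: "v \<in> VW \<Longrightarrow> \<exists>d::nat. dsum S v m = real d"
proof (induction m)
  case 0
  then show ?case by (auto simp: dsum_def intro: exI[of _ 0])
next
  case (Suc m)
  then obtain d where "dsum S v m = real d" by auto
  moreover have "dsum S v (Suc m) = dsum S v m + E S v (Suc m)" by (simp add: dsum_def)
  ultimately show ?case using E01[of v "Suc m" S] Suc.prems
    by (auto simp: VW_def intro: exI[of _ d] exI[of _ "Suc d"])
qed

lemma dsum_mono: "v \<in> VW \<Longrightarrow> m \<le> m' \<Longrightarrow> dsum S v m \<le> dsum S v m'"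
  unfolding dsum_def
proof (rule sum_mono2)
  fix i assume "v \<in> VW" "i \<in> {1..m'} - {1..m}"
  then show "0 \<le> E S v i" using E01[of v i S] by (auto simp: VW_def)
qed auto

text \<open>At its activation \<open>v\<close> has a lead of \<open>r\<close> for color
  \<open>S\<close>, hence at least \<open>r\<close> neighbors of that color, and their number can
  only grow with the count.\<close>

lemma nat_run_reached:
  "v \<in> nat_run k S \<Longrightarrow> real r \<le> dsum S v (card (nat_run k S) + a S)"
proof (induction k)
  case (Suc k)
  have vV: "v \<in> VW" using nat_run_subset Suc.prems by auto
  have mono: "dsum S v (card (nat_run k S) + a S) \<le> dsum S v (card (nat_run (Suc k) S) + a S)"
    using card_nat_run_Suc(1)[of k S] by (intro dsum_mono[OF vV]) auto
  show ?case
  proof (cases "v \<in> nat_run k S")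
    case True
    then show ?thesis using Suc.IH mono by simp
  next
    case False
    show ?thesis
    proof (rule run_Suc_cases[OF finite_avail_sus, of ring "\<lambda>_. {}" k])
      fix w assume w: "w \<in> avail sus (nat_run k)" "nat_run (Suc k) = add_node sus (nat_run k) w"
      then have "w = v" "color_of sus (nat_run k) w = S"
        using Suc.prems False by (auto simp: add_node_def split: if_splits)
      then have "v \<in> sus (nat_run k) S" using w by (cases S) (auto simp: color_of_def avail_def split: if_splits)
      then have "real r \<le> dsum S v (card (nat_run k S) + a S) - dsum (other S) v (card (nat_run k (other S)) + a (other S))"
        by (auto simp: sus_def ahead_def split: if_splits)
      moreover have "0 \<le> dsum (other S) v (card (nat_run k (other S)) + a (other S))"
        using dsum_nat[OF vV] by (metis of_nat_0_le_iff)
      ultimately show ?thesis using mono by simp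
    qed (use Suc.prems False in auto)
  qed
qed simp

text \<open>In the critical regime the active nodes are as many as the susceptible ones and cannot be
  neglected.  An active node that is not susceptible to its own color any more, or is susceptible to
  the other one, has at least \<open>r + 1\<close> active neighbors, and there are few such nodes.\<close>

lemma sus_card_crowded:
  fixes k :: nat and S :: color
  defines "C \<equiv> nat_run k"
  defines "T \<equiv> ahead S (card (C S) + a S) (card (C (other S)) + a (other S))"
    and "Z \<equiv> crowded (card (C Red) + a Red) (card (C Black) + a Black)"
  shows "\<bar>real (card (sus C S)) - (real (card T) - real (card (C S)))\<bar> \<le> real (card Z)"
proof -
  have C: "C Red \<union> C Black \<subseteq> VW" unfolding C_def using nat_run_subset by auto
  have finC: "finite (C S')" for S' unfolding C_def by (rule finite_nat_run)
  have finT: "finite T" using finite_subset[OF _ finite_VW, of T] by (auto simp: T_def ahead_def)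
  have finZ: "finite Z" using finite_subset[OF _ finite_VW, of Z] by (auto simp: Z_def crowded_def)
  have s: "sus C S = T - (C Red \<union> C Black)" using C by (simp add: sus_def T_def)
  have CS: "C Red \<union> C Black = C S \<union> C (other S)" "C S \<inter> C (other S) = {}"
    using nat_run_disjoint[of k] by (cases S; auto simp: C_def)+
  have Zsum: "v \<in> Z \<longleftrightarrow> v \<in> VW \<and> real r + 1 \<le> dsum S v (card (C S) + a S) + dsum (other S) v (card (C (other S)) + a (other S))" for v
    by (cases S) (auto simp: Z_def crowded_def add.commute)
  have reached: "real r \<le> dsum S' v (card (C S') + a S')" if "v \<in> C S'" for v S'
    using nat_run_reached[of v k S'] that by (simp add: C_def)
  \<comment> \<open>\<open>v\<close> has at least \<open>r\<close> neighbors of its own color but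
    does not lead by \<open>r\<close>, so it has at least one of the other color.\<close>
  have 1: "C S - T \<subseteq> Z"
  proof
    fix v assume v: "v \<in> C S - T"
    then have vV: "v \<in> VW" using C CS by auto
    obtain d1 d2 :: nat where d: "dsum S v (card (C S) + a S) = d1" "dsum (other S) v (card (C (other S)) + a (other S)) = d2"
      using dsum_nat[OF vV] by metis
    have "r \<le> d1" "\<not> real r \<le> real d1 - real d2" using reached[of v S] v vV d by (auto simp: T_def ahead_def)
    then show "v \<in> Z" unfolding Zsum d using vV by (cases d2) auto
  qed
  \<comment> \<open>Here \<open>d2 \<ge> r\<close> and \<open>d1 \<ge> d2 + r\<close>, so the sum is
    at least \<open>3 * r\<close>.\<close>
  have 2: "T \<inter> C (other S) \<subseteq> Z"
  proof
    fix v assume v: "v \<in> T \<inter> C (other S)"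
    then have vV: "v \<in> VW" using C CS by auto
    obtain d1 d2 :: nat where d: "dsum S v (card (C S) + a S) = d1" "dsum (other S) v (card (C (other S)) + a (other S)) = d2"
      using dsum_nat[OF vV] by metis
    have "r \<le> d2" "real r \<le> real d1 - real d2" using reached[of v "other S"] v vV d by (auto simp: T_def ahead_def)
    then show "v \<in> Z" unfolding Zsum d using vV r_pos by simp
  qed
  \<comment> \<open>The difference to be bounded equals
    \<open>card (C S - T) - card (T \<inter> C (other S))\<close>. The two terms enter with opposite
    signs, so a single \<open>card Z\<close> is enough.\<close>
  have "card (T - C S) = card (sus C S) + card (T \<inter> C (other S))"
  proof -
    have "T - C S = sus C S \<union> (T \<inter> C (other S))" "sus C S \<inter> (T \<inter> C (other S)) = {}" using s CS by auto
    then show ?thesis using finT s by (simp add: card_Un_disjoint)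
  qed
  moreover have "card T = card (T - C S) + card (T \<inter> C S)"
    using finT by (metis Int_Diff_Un Int_Diff_disjoint card_Un_disjoint finite_Diff finite_Int add.commute)
  moreover have "card (C S) = card (C S - T) + card (T \<inter> C S)"
    using finC[of S] by (metis Int_Diff_Un Int_Diff_disjoint Int_commute card_Un_disjoint finite_Diff finite_Int add.commute)
  moreover have "card (C S - T) \<le> card Z" "card (T \<inter> C (other S)) \<le> card Z"
    using 1 2 finZ by (auto intro: card_mono)
  ultimately show ?thesis by (simp add: abs_le_iff)
qed

end

section \<open>Random edges and clocks\<close>

text \<open>Allows passing from \<open>clock_at\<close>, which is \<open>undefined\<close> off the
  non-seed nodes, to the actual ring times.\<close>

lemma run_cong:
  assumes R: "\<And>v. v \<in> I \<Longrightarrow> R v = R' v" and A: "\<And>C. avail A C \<subseteq> I" "finite I"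
  shows "run A R C k = run A R' C k"
proof -
  have g: "gstep A R s = gstep A R' s" for s
  proof -
    let ?V = "avail A (colored s)"
    have n: "percolation.next_ring R (time s) v = percolation.next_ring R' (time s) v" if "v \<in> ?V" for v
    proof -
      have "R v = R' v" using that R A(1) by blast
      then show ?thesis by (simp add: percolation.next_ring_def)
    qed
    have a: "arg_min_on (percolation.next_ring R (time s)) ?V = arg_min_on (percolation.next_ring R' (time s)) ?V"
      by (rule arg_min_on_add[where t=0]) (simp add: n)
    have m: "arg_min_on (percolation.next_ring R' (time s)) ?V \<in> ?V" if "?V \<noteq> {}"
      using arg_min_if_finite(1)[OF _ that] finite_subset[OF A(1) A(2)] by blast
    show ?thesis using n[OF m] by (auto simp: gstep_def percolation.activate_def Let_def a)
  qed
  then have "gstep A R = gstep A R'" by blast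
  then show ?thesis by (simp add: run_def)
qed

lemma sus_cong:
  assumes "\<And>S v i. v < nW \<Longrightarrow> 1 \<le> i \<Longrightarrow> E S v i = E' S v i"
  shows "percolation.sus r nW a E = percolation.sus r nW a E'"
proof -
  have "percolation.dsum E S v m = percolation.dsum E' S v m" if "v < nW" for S v m
    unfolding percolation.dsum_def using that assms by (intro sum.cong) auto
  then have "percolation.ahead r nW E S m m' = percolation.ahead r nW E' S m m'" for S m m'
    unfolding percolation.ahead_def percolation.VW_def by auto
  then show ?thesis unfolding percolation.sus_def[abs_def] by (intro ext) presburger
qed

lemma finite_color: "finite (UNIV :: color set)"
proof -
  have "(UNIV :: color set) = {Red, Black}" using color.exhaust by auto
  then show ?thesis by (metis finite.emptyI finite.insertI)
qed

lemma (in prob_space) indep_vars_reindex: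
  assumes ind: "indep_vars M' X (h ` I)" and h: "inj_on h I"
  shows "indep_vars (\<lambda>i. M' (h i)) (\<lambda>i. X (h i)) I"
  unfolding indep_vars_def2
proof safe
  fix i assume "i \<in> I"
  then show "random_variable (M' (h i)) (X (h i))" using ind by (auto simp: indep_vars_def2)
next
  have s: "indep_sets (\<lambda>i. {X i -` A \<inter> space M | A. A \<in> sets (M' i)}) (h ` I)"
    using ind by (simp add: indep_vars_def2)
  show "indep_sets (\<lambda>i. {X (h i) -` A \<inter> space M | A. A \<in> sets (M' (h i))}) I"
  proof (rule indep_setsI)
    fix i assume "i \<in> I"
    then show "{X (h i) -` A \<inter> space M | A. A \<in> sets (M' (h i))} \<subseteq> events"
      using s by (auto simp: indep_sets_def)
  next
    fix A J assume J: "J \<noteq> {}" "J \<subseteq> I" "finite J"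
      and A: "\<forall>j\<in>J. A j \<in> {X (h j) -` A \<inter> space M | A. A \<in> sets (M' (h j))}"
    have hJ: "inj_on h J" using h J inj_on_subset by blast
    let ?g = "the_inv_into J h"
    have g: "?g (h j) = j" if "j \<in> J" for j using hJ that by (rule the_inv_into_f_f)
    have "prob (\<Inter>j\<in>h ` J. A (?g j)) = (\<Prod>j\<in>h ` J. prob (A (?g j)))"
      using J A g by (intro indep_setsD[OF s]) auto
    moreover have "(\<Inter>j\<in>h ` J. A (?g j)) = (\<Inter>j\<in>J. A j)" using g by auto
    moreover have "(\<Prod>j\<in>h ` J. prob (A (?g j))) = (\<Prod>j\<in>J. prob (A j))"
      using g by (simp add: prod.reindex[OF hJ])
    ultimately show "prob (\<Inter>j\<in>J. A j) = (\<Prod>j\<in>J. prob (A j))" by simp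
  qed
qed

section \<open>Counts of nodes at a fixed graph size\<close>

locale inputs_at = prob_space M for M :: "'a measure" +
  fixes p :: "nat \<Rightarrow> real" and a :: "color \<Rightarrow> nat \<Rightarrow> nat" and X :: "input \<Rightarrow> 'a \<Rightarrow> real" and n :: nat and r :: nat
  assumes inputs: "percolation_inputs M p a X" and n_pos: "1 \<le> n" and p01: "0 \<le> p n" "p n \<le> 1"
begin

abbreviation "VW \<equiv> {..<n_W a n}"
abbreviation "edges v \<equiv> {Edge n S v i | S i. 1 \<le> i}"
abbreviation "edge \<omega> \<equiv> \<lambda>S v i. X (Edge n S v i) \<omega>"
abbreviation "ringing \<omega> \<equiv> \<lambda>v. range (\<lambda>m. \<Sum>j\<le>m. X (Gap n v j) \<omega>)"
abbreviation "seeds \<equiv> \<lambda>S. a S n"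
abbreviation "sus_at \<omega> \<equiv> percolation.sus r (n_W a n) seeds (edge \<omega>)"
abbreviation "ahead_at \<omega> \<equiv> percolation.ahead r (n_W a n) (edge \<omega>)"
abbreviation "crowded_at \<omega> \<equiv> percolation.crowded r (n_W a n) (edge \<omega>)"

lemma ind: "indep_vars (\<lambda>_. borel) X (inputs a)"
  and law: "\<And>i. i \<in> inputs a \<Longrightarrow> distr M borel (X i) = law p i"
  using inputs by (auto simp: percolation_inputs_def)

lemma Edge_in: "v \<in> VW \<Longrightarrow> 1 \<le> i \<Longrightarrow> Edge n S v i \<in> inputs a"
  and Gap_in: "v \<in> VW \<Longrightarrow> Gap n v j \<in> inputs a"
  using n_pos by (auto simp: inputs_def)

lemma rv: "i \<in> inputs a \<Longrightarrow> X i \<in> borel_measurable M"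
  using ind by (auto simp: indep_vars_def)

lemma AE_edge01: "AE \<omega> in M. \<forall>v\<in>VW. \<forall>S. \<forall>i\<ge>1. edge \<omega> S v i = 0 \<or> edge \<omega> S v i = 1"
proof -
  have e: "AE \<omega> in M. \<forall>i\<in>{1..}. edge \<omega> S v i = 0 \<or> edge \<omega> S v i = 1" if v: "v \<in> VW" for v S
  proof (rule AE_ball_countable')
    fix i assume "i \<in> {1::nat..}"
    then have i: "Edge n S v i \<in> inputs a" using Edge_in v by auto
    show "AE \<omega> in M. edge \<omega> S v i = 0 \<or> edge \<omega> S v i = 1"
      using law[OF i] by (intro prob_bernoulli_distr(3)[OF rv[OF i] _ p01]) simp
  qed auto
  have "AE \<omega> in M. \<forall>v\<in>VW. \<forall>S\<in>UNIV. \<forall>i\<in>{1..}. edge \<omega> S v i = 0 \<or> edge \<omega> S v i = 1"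
    by (rule AE_finite_allI, simp, rule AE_finite_allI[OF finite_color], rule e)
  then show ?thesis by eventually_elim auto
qed

text \<open>The edges in \<open>P v\<close> count positively and those in \<open>Q v\<close>
  negatively. The indicator of \<open>v\<close> depends on edges of \<open>v\<close> alone, so the
  indicators are independent over \<open>v\<close>; their common mean is a value of
  \<open>bindiff\<close>.\<close>

lemma count_concentration:
  fixes P Q :: "nat \<Rightarrow> input set" and l :: int and C b \<epsilon> :: real
  assumes PQ: "\<And>v. v \<in> VW \<Longrightarrow> P v \<union> Q v \<subseteq> edges v" "\<And>v. v \<in> VW \<Longrightarrow> P v \<inter> Q v = {}"
    and fin: "\<And>v. finite (P v)" "\<And>v. finite (Q v)"
    and card: "\<And>v. v \<in> VW \<Longrightarrow> card (P v) = m" "\<And>v. v \<in> VW \<Longrightarrow> card (Q v) = m'"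
    and mean: "real (n_W a n) * bindiff (p n) m m' l \<le> C * b" and \<epsilon>: "0 < \<epsilon>" "\<epsilon> \<le> C" "0 < b"
  defines "T \<equiv> \<lambda>\<omega>. {v \<in> VW. real_of_int l \<le> (\<Sum>i\<in>P v. X i \<omega>) - (\<Sum>i\<in>Q v. X i \<omega>)}"
  shows "{\<omega> \<in> space M. \<epsilon> * b \<le> \<bar>real (card (T \<omega>)) - n_W a n * bindiff (p n) m m' l\<bar>} \<in> events" (is "?E \<in> _")
    and "prob {\<omega> \<in> space M. \<epsilon> * b \<le> \<bar>real (card (T \<omega>)) - n_W a n * bindiff (p n) m m' l\<bar>} \<le> 2 * exp (- (\<epsilon>\<^sup>2 / (4 * C)) * b)"
proof -
  define Y where "Y v g = (of_bool (real_of_int l \<le> (\<Sum>i\<in>P v. g i) - (\<Sum>i\<in>Q v. g i)) :: real)" for v and g :: "input \<Rightarrow> real"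
  \<comment> \<open>Going through the restriction to \<open>edges v\<close> exhibits the indicator
    as a function of one block of inputs, so that independence of disjoint blocks applies.\<close>
  define Z where "Z v \<omega> = Y v (restrict (\<lambda>i. X i \<omega>) (edges v))" for v \<omega>
  have edges_in: "edges v \<subseteq> inputs a" if "v \<in> VW" for v using Edge_in that by auto
  have Zeq: "Z v \<omega> = of_bool (real_of_int l \<le> (\<Sum>i\<in>P v. X i \<omega>) - (\<Sum>i\<in>Q v. X i \<omega>))" if "v \<in> VW" for v \<omega>
  proof -
    have "(\<Sum>i\<in>P v. restrict (\<lambda>i. X i \<omega>) (edges v) i) = (\<Sum>i\<in>P v. X i \<omega>)"
      "(\<Sum>i\<in>Q v. restrict (\<lambda>i. X i \<omega>) (edges v) i) = (\<Sum>i\<in>Q v. X i \<omega>)"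
      using PQ(1)[OF that] by (intro sum.cong refl restrict_apply'; blast)+
    then show ?thesis by (simp add: Z_def Y_def)
  qed
  have ind1: "indep_vars (\<lambda>v. PiM (edges v) (\<lambda>_. borel)) (\<lambda>v \<omega>. restrict (\<lambda>i. X i \<omega>) (edges v)) VW"
  proof (rule indep_vars_restrict[OF ind])
    show "disjoint_family_on edges VW" by (auto simp: disjoint_family_on_def)
  qed (rule edges_in)
  have indZ: "indep_vars (\<lambda>_. borel) Z VW"
    unfolding Z_def
  proof (rule indep_vars_compose2[OF ind1, where Y=Y])
    fix v assume v: "v \<in> VW"
    have [measurable]: "(\<lambda>g. g i) \<in> borel_measurable (PiM (edges v) (\<lambda>_. borel :: real measure))" if "i \<in> P v \<union> Q v" for i
      using PQ(1)[OF v] that by (intro measurable_component_singleton) auto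
    show "Y v \<in> borel_measurable (PiM (edges v) (\<lambda>_. borel))"
      unfolding Y_def by measurable
  qed
  have mean1: "prob {\<omega> \<in> space M. Z v \<omega> = 1} = bindiff (p n) m m' l" if v: "v \<in> VW" for v
  proof -
    have "prob {\<omega> \<in> space M. Z v \<omega> = 1} = prob {\<omega> \<in> space M. real_of_int l \<le> (\<Sum>i\<in>P v. X i \<omega>) - (\<Sum>i\<in>Q v. X i \<omega>)}"
      by (intro arg_cong[where f=prob]) (auto simp: Zeq[OF v])
    also have "\<dots> = bindiff (p n) (card (P v)) (card (Q v)) l"
    proof (rule prob_bernoulli_diff[OF fin PQ(2)[OF v] _ _ p01])
      show "indep_vars (\<lambda>_. borel) X (P v \<union> Q v)"
        using PQ(1)[OF v] edges_in[OF v] by (intro indep_vars_subset[OF ind]) auto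
      fix i assume "i \<in> P v \<union> Q v"
      then have "i \<in> edges v" "i \<in> inputs a" using PQ(1)[OF v] edges_in[OF v] by auto
      then show "distr M borel (X i) = distr (measure_pmf (bernoulli_pmf (p n))) borel of_bool"
        using law by auto
    qed
    finally show ?thesis by (simp add: card[OF v])
  qed
  have cT: "real (card (T \<omega>)) = (\<Sum>v\<in>VW. Z v \<omega>)" for \<omega>
  proof -
    have "(\<Sum>v\<in>VW. Z v \<omega>) = (\<Sum>v\<in>VW. of_bool (v \<in> T \<omega>))"
      by (intro sum.cong refl) (simp add: Zeq T_def)
    also have "\<dots> = real (card (T \<omega>))"
      by (simp add: of_bool_def sum.If_cases T_def Int_def conj_commute)
    finally show ?thesis by simp
  qed
  have [measurable]: "Z v \<in> borel_measurable M" if "v \<in> VW" for v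
    using indZ that by (auto simp: indep_vars_def)
  show "?E \<in> events" unfolding cT by measurable
  show "prob ?E \<le> 2 * exp (- (\<epsilon>\<^sup>2 / (4 * C)) * b)"
    unfolding cT using prob_sum_indicator_concentration[OF finite_lessThan indZ _ mean1 _ \<epsilon>] mean
    by (simp add: Z_def Y_def)
qed

lemma ahead_concentration:
  fixes S :: color and C b \<epsilon> :: real
  assumes mean: "real (n_W a n) * bindiff (p n) m m' r \<le> C * b" and \<epsilon>: "0 < \<epsilon>" "\<epsilon> \<le> C" "0 < b"
  defines "B \<equiv> {\<omega> \<in> space M. \<epsilon> * b \<le> \<bar>real (card (ahead_at \<omega> S m m')) - n_W a n * bindiff (p n) m m' r\<bar>}"
  shows "B \<in> events" "prob B \<le> 2 * exp (- (\<epsilon>\<^sup>2 / (4 * C)) * b)"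
proof -
  let ?P = "\<lambda>v. Edge n S v ` {1..m}" and ?Q = "\<lambda>v. Edge n (other S) v ` {1..m'}"
  have inj: "inj_on (Edge n S' v) J" for S' v J by (auto simp: inj_on_def)
  have oS: "other S \<noteq> S" by (cases S) auto
  have eq: "ahead_at \<omega> S m m' = {v \<in> VW. real_of_int (int r) \<le> (\<Sum>i\<in>?P v. X i \<omega>) - (\<Sum>i\<in>?Q v. X i \<omega>)}" for \<omega>
    by (simp add: percolation.ahead_def percolation.VW_def percolation.dsum_def sum.reindex[OF inj] comp_def)
  have *: "?P v \<union> ?Q v \<subseteq> edges v" "?P v \<inter> ?Q v = {}" "finite (?P v)" "finite (?Q v)" "card (?P v) = m" "card (?Q v) = m'" for v
    using oS by (auto simp: card_image[OF inj])
  show "B \<in> events" "prob B \<le> 2 * exp (- (\<epsilon>\<^sup>2 / (4 * C)) * b)"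
    unfolding B_def eq by (rule count_concentration[OF * mean \<epsilon>])+
qed

text \<open>A total number of neighbors is a difference without negative trials: both colors are
  pooled into \<open>m + m'\<close> positive ones.\<close>

lemma crowded_concentration:
  fixes C b \<epsilon> :: real
  assumes mean: "real (n_W a n) * bindiff (p n) (m + m') 0 (r + 1) \<le> C * b" and \<epsilon>: "0 < \<epsilon>" "\<epsilon> \<le> C" "0 < b"
  defines "B \<equiv> {\<omega> \<in> space M. \<epsilon> * b \<le> \<bar>real (card (crowded_at \<omega> m m')) - n_W a n * bindiff (p n) (m + m') 0 (r + 1)\<bar>}"
  shows "B \<in> events" "prob B \<le> 2 * exp (- (\<epsilon>\<^sup>2 / (4 * C)) * b)"
proof -
  let ?P = "\<lambda>v. Edge n Red v ` {1..m} \<union> Edge n Black v ` {1..m'}" and ?Q = "\<lambda>v::nat. {} :: input set"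
  have inj: "inj_on (Edge n S' v) J" for S' v J by (auto simp: inj_on_def)
  have disj: "Edge n Red v ` {1..m} \<inter> Edge n Black v ` {1..m'} = {}" for v by auto
  have su: "(\<Sum>i\<in>?P v. X i \<omega>) = (\<Sum>i\<in>{1..m}. edge \<omega> Red v i) + (\<Sum>i\<in>{1..m'}. edge \<omega> Black v i)" for v \<omega>
    by (subst sum.union_disjoint[OF _ _ disj]) (auto simp: sum.reindex[OF inj])
  have eq: "crowded_at \<omega> m m' = {v \<in> VW. real_of_int (int (r + 1)) \<le> (\<Sum>i\<in>?P v. X i \<omega>) - (\<Sum>i\<in>?Q v. X i \<omega>)}" for \<omega>
    unfolding percolation.crowded_def percolation.VW_def percolation.dsum_def su by (simp add: add.commute)
  have *: "?P v \<union> ?Q v \<subseteq> edges v" "?P v \<inter> ?Q v = {}" "finite (?P v)" "finite (?Q v)" "card (?P v) = m + m'" "card (?Q v) = 0" for v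
    by (auto simp: card_Un_disjoint[OF finite_imageI[OF finite_atLeastAtMost] finite_imageI[OF finite_atLeastAtMost] disj] card_image[OF inj]
        simp del: One_nat_def)
  show "B \<in> events" "prob B \<le> 2 * exp (- (\<epsilon>\<^sup>2 / (4 * C)) * b)"
    unfolding B_def eq by (rule count_concentration[OF * mean \<epsilon>])+
qed


section \<open>Clocks as independent streams of gaps\<close>

abbreviation "gap_idx v \<equiv> {Gap n v j | j. True}"

definition clock_at :: "'a \<Rightarrow> nat \<Rightarrow> real stream" where
  "clock_at \<omega> = (\<lambda>v\<in>VW. to_stream (\<lambda>j. X (Gap n v j) \<omega>))"

lemma rings_clock_at: "v \<in> VW \<Longrightarrow> rings (clock_at \<omega>) v = ringing \<omega> v"
  by (simp add: clock_at_def ring_time_def to_stream_def fun_eq_iff)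

lemma distr_stream:
  assumes v: "v \<in> VW"
  shows "(\<lambda>\<omega>. to_stream (\<lambda>j. X (Gap n v j) \<omega>)) \<in> measurable M gaps" (is "?s \<in> _")
    and "distr M gaps (\<lambda>\<omega>. to_stream (\<lambda>j. X (Gap n v j) \<omega>)) = gaps"
proof -
  let ?G = "\<lambda>\<omega>. \<lambda>j\<in>UNIV. X (Gap n v j) \<omega>"
  have rvG: "X (Gap n v j) \<in> measurable M exp1" for j
    using rv[OF Gap_in[OF v]] by (simp add: measurable_cong_sets[OF refl sets_exp1])
  have G: "?G \<in> measurable M (PiM UNIV (\<lambda>_. exp1))"
    by (intro measurable_restrict rvG)
  have sG: "?s = (\<lambda>\<omega>. to_stream (?G \<omega>))" by (simp add: restrict_UNIV)
  show "?s \<in> measurable M gaps"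
    unfolding sG by (rule measurable_compose[OF G measurable_to_stream])
  have lawG: "distr M exp1 (X (Gap n v j)) = exp1" for j
    using law[OF Gap_in[OF v]] distr_cong[OF refl sets_exp1, of M "X (Gap n v j)" "X (Gap n v j)"] by (simp add: exp1_def)
  have "indep_vars (\<lambda>_. borel) X (range (\<lambda>j. Gap n v j))"
    using Gap_in[OF v] by (intro indep_vars_subset[OF ind]) auto
  from indep_vars_reindex[OF this] have "indep_vars (\<lambda>_. borel) (\<lambda>j. X (Gap n v j)) UNIV"
    by (simp add: inj_on_def)
  then have "indep_vars (\<lambda>_. exp1) (\<lambda>j. X (Gap n v j)) UNIV"
    unfolding indep_vars_def2 by (simp add: measurable_cong_sets[OF refl sets_exp1])
  then have "distr M (PiM UNIV (\<lambda>_. exp1)) ?G = PiM UNIV (\<lambda>_. exp1)"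
    using indep_vars_iff_distr_eq_PiM'[of UNIV X] rvG by (subst (asm) indep_vars_iff_distr_eq_PiM') (auto simp: lawG)
  then have "distr (distr M (PiM UNIV (\<lambda>_. exp1)) ?G) gaps to_stream = gaps"
    by (simp add: stream_space_eq_distr[symmetric])
  then show "distr M gaps ?s = gaps"
    unfolding sG by (subst (asm) distr_distr[OF measurable_to_stream G]) (simp add: comp_def)
qed

lemma distr_clock_at:
  shows "clock_at \<in> measurable M (clocks VW)" and "VW \<noteq> {} \<Longrightarrow> distr M (clocks VW) clock_at = clocks VW"
proof -
  show "clock_at \<in> measurable M (clocks VW)"
    unfolding clock_at_def by (intro measurable_restrict distr_stream)
  assume ne: "VW \<noteq> {}"
  have ind1: "indep_vars (\<lambda>v. PiM (gap_idx v) (\<lambda>_. borel)) (\<lambda>v \<omega>. restrict (\<lambda>i. X i \<omega>) (gap_idx v)) VW"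
  proof (rule indep_vars_restrict[OF ind])
    show "disjoint_family_on gap_idx VW" by (auto simp: disjoint_family_on_def)
  qed (use Gap_in in auto)
  have "indep_vars (\<lambda>_. gaps) (\<lambda>v \<omega>. to_stream (\<lambda>j. restrict (\<lambda>i. X i \<omega>) (gap_idx v) (Gap n v j))) VW"
  proof (rule indep_vars_compose2[OF ind1, where Y="\<lambda>v g. to_stream (\<lambda>j. g (Gap n v j))"])
    fix v
    show "(\<lambda>g. to_stream (\<lambda>j. g (Gap n v j))) \<in> measurable (PiM (gap_idx v) (\<lambda>_. borel)) gaps"
    proof (rule measurable_stream_space2)
      fix j
      have "(\<lambda>g. g (Gap n v j)) \<in> measurable (PiM (gap_idx v) (\<lambda>_. borel :: real measure)) borel"
        by (rule measurable_component_singleton) auto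
      then show "(\<lambda>g. to_stream (\<lambda>j. g (Gap n v j)) !! j) \<in> measurable (PiM (gap_idx v) (\<lambda>_. borel)) exp1"
        by (simp add: to_stream_def measurable_cong_sets[OF refl sets_exp1])
    qed
  qed
  then have "indep_vars (\<lambda>_. gaps) (\<lambda>v \<omega>. to_stream (\<lambda>j. X (Gap n v j) \<omega>)) VW"
    by (simp cong: restrict_cong)
  then have "distr M (clocks VW) clock_at = PiM VW (\<lambda>v. distr M gaps (\<lambda>\<omega>. to_stream (\<lambda>j. X (Gap n v j) \<omega>)))"
    unfolding clock_at_def by (subst (asm) indep_vars_iff_distr_eq_PiM'[OF ne]) (auto intro: distr_stream(1))
  also have "\<dots> = clocks VW" by (intro PiM_cong refl) (simp add: distr_stream(2))
  finally show "distr M (clocks VW) clock_at = clocks VW" .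
qed

section \<open>Conditioning on the edges\<close>

abbreviation "edge_idx \<equiv> \<Union>v\<in>VW. edges v"
abbreviation "gaps_idx \<equiv> \<Union>v\<in>VW. gap_idx v"

definition sus_of :: "(input \<Rightarrow> real) \<Rightarrow> coloring \<Rightarrow> coloring" where
  "sus_of y = percolation.sus r (n_W a n) seeds (\<lambda>S v i. y (Edge n S v i))"

lemma sus_of_restrict: "sus_of (restrict (\<lambda>i. X i \<omega>) edge_idx) = sus_at \<omega>"
  unfolding sus_of_def by (rule sus_cong) auto

text \<open>A rule is a function on infinitely many colorings, but \<open>sus_of y\<close> is empty
  outside the colorings within \<open>VW\<close>, so this finite table determines it.\<close>

definition sus_code :: "(coloring \<Rightarrow> coloring) \<Rightarrow> (nat set \<times> nat set \<times> color \<times> nat) set" where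
  "sus_code A = {(V, B, S, v). V \<subseteq> VW \<and> B \<subseteq> VW \<and> v \<in> VW \<and> v \<in> A (case_color V B) S}"

abbreviation "codes \<equiv> Pow VW \<times> Pow VW \<times> (UNIV :: color set) \<times> VW"

lemma finite_codes: "finite codes"
  using finite_color by auto

lemma case_color_eta: "case_color (C Red) (C Black) = (C :: coloring)"
proof
  fix S show "case_color (C Red) (C Black) S = C S" by (cases S) auto
qed

lemma sus_code_inj:
  assumes "sus_code (sus_of y) = sus_code (sus_of y')"
  shows "sus_of y = sus_of y'"
proof (intro ext set_eqI)
  have *: "v \<in> sus_of y C S \<longleftrightarrow> (C Red, C Black, S, v) \<in> sus_code (sus_of y)" for y C S v
  proof -
    have "v \<in> sus_of y C S \<Longrightarrow> C Red \<subseteq> VW \<and> C Black \<subseteq> VW \<and> v \<in> VW"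
      by (auto simp: sus_of_def percolation.sus_def percolation.ahead_def percolation.VW_def split: if_splits)
    then show ?thesis by (auto simp: sus_code_def case_color_eta)
  qed
  fix C S v show "v \<in> sus_of y C S \<longleftrightarrow> v \<in> sus_of y' C S" unfolding * assms ..
qed

lemma finite_range_sus_of: "finite (range sus_of)"
proof (rule inj_on_finite[where f=sus_code and B="Pow codes"])
  show "inj_on sus_code (range sus_of)" by (auto simp: inj_on_def intro: sus_code_inj)
  show "sus_code ` range sus_of \<subseteq> Pow codes" by (auto simp: sus_code_def)
  show "finite (Pow codes)" using finite_codes by blast
qed

text \<open>Equality of rules is equality of their finite tables, and each entry of a table amounts
  to an inequality between sums of finitely many edges.\<close>

lemma measurable_sus_of: "{y \<in> space (PiM edge_idx (\<lambda>_. borel)). sus_of y = sus_of y0} \<in> sets (PiM edge_idx (\<lambda>_. borel))"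
proof -
  let ?P = "PiM edge_idx (\<lambda>_. borel :: real measure)"
  have "{y \<in> space ?P. sus_of y = sus_of y0}
      = {y \<in> space ?P. \<forall>x\<in>codes. (x \<in> sus_code (sus_of y)) = (x \<in> sus_code (sus_of y0))}"
  proof -
    have "sus_of y = sus_of y0 \<longleftrightarrow> (\<forall>x\<in>codes. (x \<in> sus_code (sus_of y)) = (x \<in> sus_code (sus_of y0)))" for y
    proof
      assume r: "\<forall>x\<in>codes. (x \<in> sus_code (sus_of y)) = (x \<in> sus_code (sus_of y0))"
      have "sus_code (sus_of y) \<subseteq> codes" for y by (auto simp: sus_code_def)
      with r have "sus_code (sus_of y) = sus_code (sus_of y0)" by blast
      then show "sus_of y = sus_of y0" by (rule sus_code_inj)
    qed simp
    then show ?thesis by blast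
  qed
  also have "\<dots> \<in> sets ?P"
  proof (intro predE pred_intros_finite finite_codes)
    fix x assume x: "x \<in> codes"
    then obtain V B S v where xe: "x = (V, B, S, v)" and v: "v \<in> VW" by (cases x) auto
    have [measurable]: "(\<lambda>y. \<Sum>i = 1..m. y (Edge n S' v i)) \<in> borel_measurable ?P" for S' m
    proof (rule borel_measurable_sum)
      fix i :: nat assume "i \<in> {1..m}"
      then have "Edge n S' v i \<in> edge_idx" using v by auto
      then show "(\<lambda>y. y (Edge n S' v i)) \<in> borel_measurable ?P" by (rule measurable_component_singleton)
    qed
    define m where "m = card (case_color V B S) + a S n"
    define m' where "m' = card (case_color V B (other S)) + a (other S) n"
    define G where "G \<longleftrightarrow> V \<subseteq> VW \<and> B \<subseteq> VW \<and> v \<in> VW \<and> v \<notin> V \<and> v \<notin> B"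
    have eq: "x \<in> sus_code (sus_of y) \<longleftrightarrow>
      G \<and> real r \<le> (\<Sum>i=1..m. y (Edge n S v i)) - (\<Sum>i=1..m'. y (Edge n (other S) v i))" for y
      unfolding xe sus_code_def sus_of_def percolation.sus_def percolation.ahead_def percolation.VW_def percolation.dsum_def
        m_def m'_def G_def by auto
    have "Measurable.pred ?P (\<lambda>y. x \<in> sus_code (sus_of y))"
      unfolding eq by measurable
    then show "Measurable.pred ?P (\<lambda>y. (x \<in> sus_code (sus_of y)) = (x \<in> sus_code (sus_of y0)))" by simp
  qed
  finally show ?thesis .
qed

text \<open>For each of the finitely many rules there is an exceptional set of clocks of small
  probability. Edges and clocks are independent, and the events that the edges produce a given rule
  are disjoint, so averaging over the rules keeps the bound.\<close>

lemma deviation_prob: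
  assumes l: "0 \<le> l" "l \<le> 1" and c: "0 < c"
  shows "\<exists>B\<in>events. prob B \<le> 2 * exp (l\<^sup>2 * k - l * c)
    \<and> (\<forall>\<omega>\<in>space M - B. \<bar>deviation (sus_at \<omega>) (ringing \<omega>) (\<lambda>_. {}) k\<bar> < c)"
proof (cases "VW = {}")
  \<comment> \<open>Without non-seed nodes the chain is stuck at once. The law of
    \<open>clock_at\<close> is identified for a nonempty index set only.\<close>
  case True
  have "avail (sus_at \<omega>) (\<lambda>_. {}) = {}" for \<omega>
    using percolation.sus_subset(1)[of r "n_W a n" seeds "edge \<omega>" "\<lambda>_. {}"] True by (simp add: percolation.VW_def)
  then show ?thesis using c by (intro bexI[of _ "{}"]) (auto simp: deviation_stuck)
next
  case False
  let ?Y = "\<lambda>\<omega>. restrict (\<lambda>i. X i \<omega>) edge_idx"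
  have avail: "avail (sus_of y) C \<subseteq> VW" "sus_of y C S \<inter> C Red = {}" for y C S
    using percolation.sus_subset[of r "n_W a n"] by (auto simp: sus_of_def percolation.VW_def)
  have "\<forall>A\<in>range sus_of. \<exists>B. B \<in> sets (clocks VW) \<and> emeasure (clocks VW) B \<le> ennreal (2 * exp (l\<^sup>2 * k - l * c))
    \<and> (\<forall>\<gamma>\<in>space (clocks VW) - B. \<bar>deviation A (rings \<gamma>) (\<lambda>_. {}) k\<bar> < c)"
  proof
    fix A assume "A \<in> range sus_of"
    then obtain y where y: "A = sus_of y" by auto
    show "\<exists>B. B \<in> sets (clocks VW) \<and> emeasure (clocks VW) B \<le> ennreal (2 * exp (l\<^sup>2 * k - l * c))
    \<and> (\<forall>\<gamma>\<in>space (clocks VW) - B. \<bar>deviation A (rings \<gamma>) (\<lambda>_. {}) k\<bar> < c)"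
      using deviation_tail[where A="sus_of y" and I=VW and C="\<lambda>_. {}" and l=l and k=k and c=c, OF finite_lessThan avail _ l]
      unfolding y by blast
  qed
  from bchoice[OF this] obtain Bad where Bad: "\<And>A. A \<in> range sus_of \<Longrightarrow> Bad A \<in> sets (clocks VW)"
    "\<And>A. A \<in> range sus_of \<Longrightarrow> emeasure (clocks VW) (Bad A) \<le> ennreal (2 * exp (l\<^sup>2 * k - l * c))"
    "\<And>A \<gamma>. A \<in> range sus_of \<Longrightarrow> \<gamma> \<in> space (clocks VW) - Bad A \<Longrightarrow> \<bar>deviation A (rings \<gamma>) (\<lambda>_. {}) k\<bar> < c"
    by blast
  let ?E = "\<lambda>A. {y \<in> space (PiM edge_idx (\<lambda>_. borel)). sus_of y = A}"
  have E: "?E A \<in> sets (PiM edge_idx (\<lambda>_. borel))" if "A \<in> range sus_of" for A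
    using measurable_sus_of that by auto
  have ind0: "indep_var (PiM edge_idx (\<lambda>_. borel)) ?Y (PiM gaps_idx (\<lambda>_. borel)) (\<lambda>\<omega>. restrict (\<lambda>i. X i \<omega>) gaps_idx)"
    using Edge_in Gap_in by (intro indep_var_restrict[OF ind]) auto
  have mc: "(\<lambda>g. \<lambda>v\<in>VW. to_stream (\<lambda>j. g (Gap n v j))) \<in> measurable (PiM gaps_idx (\<lambda>_. borel)) (clocks VW)"
  proof (rule measurable_restrict, rule measurable_stream_space2)
    fix v j assume "v \<in> VW"
    then have "(\<lambda>g. g (Gap n v j)) \<in> measurable (PiM gaps_idx (\<lambda>_. borel :: real measure)) borel"
      by (intro measurable_component_singleton) auto
    then show "(\<lambda>g. to_stream (\<lambda>j. g (Gap n v j)) !! j) \<in> measurable (PiM gaps_idx (\<lambda>_. borel)) exp1"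
      by (simp add: to_stream_def measurable_cong_sets[OF refl sets_exp1])
  qed
  have cl: "(\<lambda>g. \<lambda>v\<in>VW. to_stream (\<lambda>j. g (Gap n v j))) \<circ> (\<lambda>\<omega>. restrict (\<lambda>i. X i \<omega>) gaps_idx) = clock_at"
  proof
    fix \<omega>
    have "restrict (\<lambda>i. X i \<omega>) gaps_idx (Gap n v j) = X (Gap n v j) \<omega>" if "v \<in> VW" for v j
      using that by (intro restrict_apply') auto
    then show "((\<lambda>g. \<lambda>v\<in>VW. to_stream (\<lambda>j. g (Gap n v j))) \<circ> (\<lambda>\<omega>. restrict (\<lambda>i. X i \<omega>) gaps_idx)) \<omega> = clock_at \<omega>"
      unfolding clock_at_def comp_def by (intro restrict_ext) simp
  qed
  let ?Z = "\<lambda>\<omega>. restrict (\<lambda>i. X i \<omega>) gaps_idx" and ?g = "\<lambda>g. \<lambda>v\<in>VW. to_stream (\<lambda>j. g (Gap n v j))"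
  have mY: "?Y \<in> measurable M (PiM edge_idx (\<lambda>_. borel))" using indep_var_rv1[OF ind0] .
  have mZ: "?Z \<in> measurable M (PiM gaps_idx (\<lambda>_. borel))" using indep_var_rv2[OF ind0] .
  have gZ: "?g (?Z \<omega>) = clock_at \<omega>" for \<omega> using fun_cong[OF cl, of \<omega>] by simp
  let ?H = "\<lambda>A. ?g -` Bad A \<inter> space (PiM gaps_idx (\<lambda>_. borel))"
  have H: "?H A \<in> sets (PiM gaps_idx (\<lambda>_. borel))" if "A \<in> range sus_of" for A
    using measurable_sets[OF mc Bad(1)[OF that]] .
  have ZH: "?Z -` ?H A \<inter> space M = clock_at -` Bad A \<inter> space M" for A
    using measurable_space[OF mZ] by (auto simp only: vimage_def gZ mem_Collect_eq Int_iff)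
  \<comment> \<open>The edges produce the rule \<open>A\<close> and the clocks are exceptional for
    it.\<close>
  let ?B = "\<lambda>A. (\<lambda>\<omega>. (?Y \<omega>, ?Z \<omega>)) -` (?E A \<times> ?H A) \<inter> space M"
  have EY: "?Y -` ?E A \<inter> space M \<in> events" if "A \<in> range sus_of" for A
    using measurable_sets[OF mY E[OF that]] .
  have BA: "?B A = (?Y -` ?E A \<inter> space M) \<inter> (?Z -` ?H A \<inter> space M)" for A by auto
  have Bev: "?B A \<in> events" if "A \<in> range sus_of" for A
    unfolding BA using EY[OF that] measurable_sets[OF mZ H[OF that]] by (rule sets.Int)
  have pB: "prob (?B A) \<le> prob (?Y -` ?E A \<inter> space M) * (2 * exp (l\<^sup>2 * k - l * c))" if A: "A \<in> range sus_of" for A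
  proof -
    have "emeasure M (clock_at -` Bad A \<inter> space M) = emeasure (distr M (clocks VW) clock_at) (Bad A)"
      by (rule emeasure_distr[OF distr_clock_at(1) Bad(1)[OF A], symmetric])
    also have "\<dots> \<le> ennreal (2 * exp (l\<^sup>2 * k - l * c))"
      unfolding distr_clock_at(2)[OF False] by (rule Bad(2)[OF A])
    finally have "prob (clock_at -` Bad A \<inter> space M) \<le> 2 * exp (l\<^sup>2 * k - l * c)"
      by (simp add: emeasure_eq_measure)
    then show ?thesis
      unfolding indep_varD[OF ind0 E[OF A] H[OF A]] ZH by (intro mult_left_mono) auto
  qed
  let ?U = "\<Union>A\<in>range sus_of. ?B A"
  have "prob ?U \<le> (\<Sum>A\<in>range sus_of. prob (?B A))"
    using Bev by (intro finite_measure_subadditive_finite finite_range_sus_of) auto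
  also have "\<dots> \<le> (\<Sum>A\<in>range sus_of. prob (?Y -` ?E A \<inter> space M) * (2 * exp (l\<^sup>2 * k - l * c)))"
    by (intro sum_mono pB)
  also have "\<dots> = prob (\<Union>A\<in>range sus_of. ?Y -` ?E A \<inter> space M) * (2 * exp (l\<^sup>2 * k - l * c))"
  proof -
    have "prob (\<Union>A\<in>range sus_of. ?Y -` ?E A \<inter> space M) = (\<Sum>A\<in>range sus_of. prob (?Y -` ?E A \<inter> space M))"
      using EY by (intro finite_measure_finite_Union finite_range_sus_of) (auto simp: disjoint_family_on_def)
    then show ?thesis by (simp only: sum_distrib_right)
  qed
  also have "\<dots> \<le> 1 * (2 * exp (l\<^sup>2 * k - l * c))" by (intro mult_right_mono) auto
  finally have p: "prob ?U \<le> 2 * exp (l\<^sup>2 * k - l * c)" by simp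
  have "\<bar>deviation (sus_at \<omega>) (ringing \<omega>) (\<lambda>_. {}) k\<bar> < c" if \<omega>: "\<omega> \<in> space M - ?U" for \<omega>
  proof -
    have s: "sus_at \<omega> = sus_of (?Y \<omega>)" by (rule sus_of_restrict[symmetric])
    have \<omega>M: "\<omega> \<in> space M" using \<omega> by (rule DiffD1)
    have notU: "\<omega> \<notin> ?U" by (rule notI) (rule DiffD2[OF \<omega>])
    have Yin: "?Y \<omega> \<in> space (PiM edge_idx (\<lambda>_. borel))" by (rule measurable_space[OF mY \<omega>M])
    have Zin: "?Z \<omega> \<in> space (PiM gaps_idx (\<lambda>_. borel))" by (rule measurable_space[OF mZ \<omega>M])
    have mem: "sus_of (?Y \<omega>) \<in> range sus_of" by (rule rangeI)
    have nB: "clock_at \<omega> \<notin> Bad (sus_of (?Y \<omega>))"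
    proof
      assume "clock_at \<omega> \<in> Bad (sus_of (?Y \<omega>))"
      then have "?g (?Z \<omega>) \<in> Bad (sus_of (?Y \<omega>))" unfolding gZ .
      then have z: "?Z \<omega> \<in> ?H (sus_of (?Y \<omega>))" by (rule IntI[OF vimageI2 Zin])
      have y: "?Y \<omega> \<in> ?E (sus_of (?Y \<omega>))" by (rule CollectI, rule conjI, rule Yin, rule refl)
      have "\<omega> \<in> ?B (sus_of (?Y \<omega>))"
        by (rule IntI, rule vimageI2, rule SigmaI, rule y, rule z, rule \<omega>M)
      then have "\<omega> \<in> ?U" by (rule UN_I[OF mem])
      with notU show False ..
    qed
    have "clock_at \<omega> \<in> space (clocks VW)" by (rule measurable_space[OF distr_clock_at(1) \<omega>M])
    then have "\<bar>deviation (sus_at \<omega>) (rings (clock_at \<omega>)) (\<lambda>_. {}) k\<bar> < c"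
      unfolding s by (rule Bad(3)[OF mem DiffI[OF _ nB]])
    moreover have "run (sus_at \<omega>) (rings (clock_at \<omega>)) C j = run (sus_at \<omega>) (ringing \<omega>) C j" for C j
      unfolding s by (rule run_cong[where I=VW, OF rings_clock_at avail(1) finite_lessThan])
    ultimately show ?thesis unfolding deviation_def by simp
  qed
  then have dev: "\<forall>\<omega>\<in>space M - ?U. \<bar>deviation (sus_at \<omega>) (ringing \<omega>) (\<lambda>_. {}) k\<bar> < c"
    by (rule ballI)
  have "?U \<in> events" using Bev by (rule sets.finite_UN[OF finite_range_sus_of])
  then show ?thesis by (rule bexI[rotated]) (rule conjI[OF p dev])
qed

end

section \<open>Poisson limits\<close>

text \<open>The expectation of \<open>c X\<close> for a Poisson variable \<open>X\<close> with mean
  \<open>w\<close>.\<close>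

definition poisE :: "(nat \<Rightarrow> real) \<Rightarrow> real \<Rightarrow> real" where
  "poisE c w = exp (- w) * (\<Sum>i. c i / fact i * w ^ i)"

lemma summable_poisE:
  fixes w :: real
  assumes "\<And>i. \<bar>c i\<bar> \<le> B" shows "summable (\<lambda>i. c i / fact i * w ^ i)"
proof (rule summable_comparison_test')
  show "summable (\<lambda>i. B * (inverse (fact i) * \<bar>w\<bar> ^ i))"
    by (intro summable_mult summable_exp)
  fix i
  have "\<bar>c i\<bar> * (inverse (fact i) * \<bar>w\<bar> ^ i) \<le> B * (inverse (fact i) * \<bar>w\<bar> ^ i)"
    using assms by (intro mult_right_mono) auto
  then show "norm (c i / fact i * w ^ i) \<le> B * (inverse (fact i) * \<bar>w\<bar> ^ i)"
    by (simp add: abs_mult power_abs divide_inverse)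
qed

lemma poisE_bound:
  assumes c: "\<And>i. \<bar>c i\<bar> \<le> B" and w: "0 \<le> w"
  shows "\<bar>poisE c w\<bar> \<le> B"
proof -
  have s: "summable (\<lambda>i. B * (inverse (fact i) * w ^ i))" by (intro summable_mult summable_exp)
  have "\<bar>\<Sum>i. c i / fact i * w ^ i\<bar> \<le> (\<Sum>i. \<bar>c i / fact i * w ^ i\<bar>)"
  proof (rule summable_rabs)
    show "summable (\<lambda>i. \<bar>c i / fact i * w ^ i\<bar>)"
      using summable_poisE[of "\<lambda>i. \<bar>c i\<bar>" B w] c w by (simp add: abs_mult)
  qed
  also have "\<dots> \<le> (\<Sum>i. B * (inverse (fact i) * w ^ i))"
  proof (rule suminf_le[OF _ _ s])
    show "summable (\<lambda>i. \<bar>c i / fact i * w ^ i\<bar>)"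
      using summable_poisE[of "\<lambda>i. \<bar>c i\<bar>" B w] c w by (simp add: abs_mult)
    fix i
    have "\<bar>c i\<bar> * (inverse (fact i) * w ^ i) \<le> B * (inverse (fact i) * w ^ i)"
      using c w by (intro mult_right_mono) auto
    then show "\<bar>c i / fact i * w ^ i\<bar> \<le> B * (inverse (fact i) * w ^ i)"
      using w by (simp add: abs_mult divide_inverse)
  qed
  also have "\<dots> = B * exp w"
    unfolding exp_def by (subst suminf_mult) (auto simp: summable_exp divide_inverse scaleR_conv_of_real)
  finally have "exp (- w) * \<bar>\<Sum>i. c i / fact i * w ^ i\<bar> \<le> exp (- w) * (B * exp w)" by (intro mult_left_mono) auto
  moreover have "exp (- w) * (B * exp w) = B" by (simp add: exp_minus)
  moreover have "\<bar>poisE c w\<bar> = exp (- w) * \<bar>\<Sum>i. c i / fact i * w ^ i\<bar>"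
    unfolding poisE_def by (simp only: abs_mult abs_exp_cancel)
  ultimately show ?thesis by linarith
qed

lemma poisE_0: "poisE c 0 = c 0"
proof -
  have "(\<Sum>i. c i / fact i * 0 ^ i) = (\<Sum>i\<in>{0}. c i / fact i * 0 ^ i)"
    by (rule suminf_finite) auto
  then show ?thesis by (simp add: poisE_def)
qed

lemma poisE_diff:
  assumes "\<And>i. \<bar>c i\<bar> \<le> B" "\<And>i. \<bar>d i\<bar> \<le> B"
  shows "poisE (\<lambda>i. c i - d i) w = poisE c w - poisE d w"
proof -
  have "(\<Sum>i. (c i - d i) / fact i * w ^ i) = (\<Sum>i. c i / fact i * w ^ i - d i / fact i * w ^ i)"
    by (intro arg_cong[where f=suminf]) (auto simp: field_simps)
  also have "\<dots> = (\<Sum>i. c i / fact i * w ^ i) - (\<Sum>i. d i / fact i * w ^ i)"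
    by (rule suminf_diff[symmetric]) (rule summable_poisE[of _ B], rule assms)+
  finally show ?thesis by (simp add: poisE_def right_diff_distrib)
qed

text \<open>The series contributes the shifted sequence and \<open>exp (- w)\<close> the negative of
  the original one. So differentiation is a forward difference of \<open>c\<close>, and derivatives
  are bounded as long as \<open>c\<close> is.\<close>

lemma DERIV_poisE:
  assumes c: "\<And>i. \<bar>c i\<bar> \<le> B"
  shows "(poisE c has_real_derivative poisE (\<lambda>i. c (Suc i) - c i) w) (at w)"
proof -
  have "((\<lambda>w. \<Sum>i. c i / fact i * w ^ i) has_real_derivative (\<Sum>i. diffs (\<lambda>i. c i / fact i) i * w ^ i)) (at w)"
    by (rule termdiffs_strong_converges_everywhere) (rule summable_poisE[OF c])
  moreover have "diffs (\<lambda>i. c i / fact i) = (\<lambda>i. c (Suc i) / fact i)"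
    by (auto simp: diffs_def field_simps simp del: of_nat_Suc)
  ultimately have D: "((\<lambda>w. \<Sum>i. c i / fact i * w ^ i) has_real_derivative (\<Sum>i. c (Suc i) / fact i * w ^ i)) (at w)"
    by simp
  have E: "((\<lambda>w. exp (- w)) has_real_derivative - exp (- w)) (at w)"
    by (auto intro!: derivative_eq_intros)
  have "(poisE c has_real_derivative
     exp (- w) * (\<Sum>i. c (Suc i) / fact i * w ^ i) - exp (- w) * (\<Sum>i. c i / fact i * w ^ i)) (at w)"
    using DERIV_mult[OF E D] unfolding poisE_def[abs_def] by (simp only: mult_minus_left mult.commute add.commute diff_conv_add_uminus)
  moreover have "poisE (\<lambda>i. c (Suc i) - c i) w = poisE (\<lambda>i. c (Suc i)) w - poisE c w"
    by (rule poisE_diff[of _ B]) (rule c)+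
  ultimately show ?thesis by (simp add: poisE_def)
qed

lemma shift_diff_bound:
  fixes c :: "nat \<Rightarrow> real"
  assumes c: "\<And>i. \<bar>c i\<bar> \<le> B" shows "\<bar>c (Suc i) - c i\<bar> \<le> 2 * B"
  using c[of i] c[of "Suc i"] by linarith

lemma poisE_Lipschitz:
  assumes c: "\<And>i. \<bar>c i\<bar> \<le> B" and w: "0 \<le> w" "0 \<le> w'"
  shows "\<bar>poisE c w - poisE c w'\<bar> \<le> 2 * B * \<bar>w - w'\<bar>"
proof -
  have "norm (poisE c w - poisE c w') \<le> 2 * B * norm (w - w')"
  proof (rule field_differentiable_bound[where S="{0..}"])
    fix z :: real assume z: "z \<in> {0..}"
    show "(poisE c has_field_derivative poisE (\<lambda>i. c (Suc i) - c i) z) (at z within {0..})"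
      by (rule has_field_derivative_at_within[OF DERIV_poisE[where c=c, OF c]])
    show "norm (poisE (\<lambda>i. c (Suc i) - c i) z) \<le> 2 * B"
      using poisE_bound[of "\<lambda>i. c (Suc i) - c i" "2 * B" z] shift_diff_bound[where c=c, OF c] z by auto
  qed (use w in auto)
  then show ?thesis by simp
qed

text \<open>Conditioning on a Bernoulli trial with parameter \<open>p\<close> gives the first-order
  expansion of \<open>poisE\<close> in its mean. So replacing the trial by an independent Poisson
  increment costs order \<open>p^2\<close>.\<close>

lemma poisE_Taylor:
  assumes c: "\<And>i. \<bar>c i\<bar> \<le> B" and w: "0 \<le> w" "0 \<le> p"
  shows "\<bar>poisE c (w + p) - ((1 - p) * poisE c w + p * poisE (\<lambda>i. c (Suc i)) w)\<bar> \<le> 4 * B * p\<^sup>2"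
proof (cases "p = 0")
  case False
  let ?d = "\<lambda>i. c (Suc i) - c i"
  have dc: "poisE ?d w = poisE (\<lambda>i. c (Suc i)) w - poisE c w"
    by (rule poisE_diff[of _ B]) (rule c)+
  obtain z where z: "w < z" "z < w + p" "poisE c (w + p) - poisE c w = (w + p - w) * poisE ?d z"
    using MVT2[of w "w + p" "poisE c" "poisE ?d"] DERIV_poisE[where c=c, OF c] False w by auto
  have "poisE c (w + p) - ((1 - p) * poisE c w + p * poisE (\<lambda>i. c (Suc i)) w) = p * (poisE ?d z - poisE ?d w)"
  proof -
    have sc: "poisE (\<lambda>i. c (Suc i)) w = poisE c w + poisE ?d w" using dc by simp
    show ?thesis unfolding sc using z(3) by (simp add: algebra_simps)
  qed
  also have "\<bar>\<dots>\<bar> \<le> p * (2 * (2 * B) * \<bar>z - w\<bar>)"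
    using poisE_Lipschitz[of ?d "2 * B" z w] shift_diff_bound[where c=c, OF c] z w
    by (simp add: abs_mult mult_left_mono)
  also have "\<dots> \<le> p * (2 * (2 * B) * p)"
  proof -
    have "0 \<le> B" using c[of 0] by simp
    then show ?thesis using z w by (intro mult_left_mono) auto
  qed
  finally show ?thesis by (simp add: power2_eq_square mult_ac)
qed (use c[of 0] in auto)

text \<open>\<open>hpois l u w\<close> is the probability of \<open>X - Y \<ge> l\<close> for independent Poisson variables \<open>X\<close> and \<open>Y\<close> with
  means \<open>u\<close> and \<open>w\<close>.\<close>

definition hpois_in :: "int \<Rightarrow> real \<Rightarrow> real" where
  "hpois_in l w = poisE (\<lambda>i. of_bool (l + int i \<le> 0)) w"

definition hpois :: "int \<Rightarrow> real \<Rightarrow> real \<Rightarrow> real" where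
  "hpois l u w = poisE (\<lambda>k. hpois_in (l - int k) w) u"

lemma hpois_in_bound: "0 \<le> w \<Longrightarrow> \<bar>hpois_in l w\<bar> \<le> 1"
  unfolding hpois_in_def by (rule poisE_bound) auto

lemma convex_comb_error:
  fixes p x x' y y' e z d :: real
  assumes "0 \<le> p" "p \<le> 1" "\<bar>x - x'\<bar> \<le> e" "\<bar>y - y'\<bar> \<le> e" "\<bar>z - ((1 - p) * x' + p * y')\<bar> \<le> d"
  shows "\<bar>((1 - p) * x + p * y) - z\<bar> \<le> e + d"
proof -
  have "\<bar>(1 - p) * (x - x') + p * (y - y')\<bar> \<le> (1 - p) * \<bar>x - x'\<bar> + p * \<bar>y - y'\<bar>"
    using assms(1,2) by (intro order.trans[OF abs_triangle_ineq]) (simp add: abs_mult)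
  also have "\<dots> \<le> e" using assms by (intro convex_comb_le)
  finally have "\<bar>((1 - p) * x + p * y) - ((1 - p) * x' + p * y')\<bar> \<le> e" by (simp add: algebra_simps)
  then show ?thesis using assms(5) by linarith
qed

text \<open>Trials are replaced by Poisson increments one at a time, each at cost
  \<open>4 * p^2\<close>: both functions obey the same recursion up to that error.\<close>

lemma bindiff_poisson:
  assumes p: "0 \<le> p" "p \<le> 1"
  shows "\<bar>bindiff p m m' l - hpois l (m * p) (m' * p)\<bar> \<le> 4 * real (m + m') * p\<^sup>2"
proof (induction m arbitrary: l)
  case 0
  have "\<bar>bindiff p 0 m' l - hpois_in l (m' * p)\<bar> \<le> 4 * real m' * p\<^sup>2"
  proof (induction m' arbitrary: l)
    case 0
    show ?case by (simp add: hpois_in_def poisE_0)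
  next
    case (Suc m')
    have T: "\<bar>hpois_in l (m' * p + p) - ((1 - p) * hpois_in l (m' * p) + p * hpois_in (l + 1) (m' * p))\<bar> \<le> 4 * 1 * p\<^sup>2"
      using poisE_Taylor[of "\<lambda>i. of_bool (l + int i \<le> 0)" 1 "m' * p" p] p
      by (simp add: hpois_in_def add_ac)
    show ?case using convex_comb_error[OF p Suc[of l] Suc[of "l + 1"] T]
      by (simp add: algebra_simps)
  qed
  then show ?case by (simp add: hpois_def poisE_0)
next
  case (Suc m)
  have T: "\<bar>hpois l (m * p + p) (m' * p) - ((1 - p) * hpois l (m * p) (m' * p) + p * hpois (l - 1) (m * p) (m' * p))\<bar> \<le> 4 * 1 * p\<^sup>2"
    using poisE_Taylor[of "\<lambda>k. hpois_in (l - int k) (m' * p)" 1 "m * p" p] p hpois_in_bound[of "m' * p"]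
    by (simp add: hpois_def algebra_simps)
  show ?case using convex_comb_error[OF p Suc[of l] Suc[of "l - 1"] T]
    by (simp add: algebra_simps)
qed

lemma hpois_Lipschitz:
  assumes "0 \<le> u" "0 \<le> u'" "0 \<le> w" "0 \<le> w'"
  shows "\<bar>hpois l u w - hpois l u' w'\<bar> \<le> 2 * \<bar>u - u'\<bar> + 2 * \<bar>w - w'\<bar>"
proof -
  have "\<bar>hpois l u w - hpois l u' w\<bar> \<le> 2 * 1 * \<bar>u - u'\<bar>"
    unfolding hpois_def using assms by (intro poisE_Lipschitz hpois_in_bound)
  moreover have "\<bar>hpois l u' w - hpois l u' w'\<bar> \<le> 2 * \<bar>w - w'\<bar>"
  proof -
    have "hpois l u' w - hpois l u' w' = poisE (\<lambda>k. hpois_in (l - int k) w - hpois_in (l - int k) w') u'"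
      unfolding hpois_def using assms by (intro poisE_diff[of _ 1, symmetric] hpois_in_bound)
    also have "\<bar>\<dots>\<bar> \<le> 2 * 1 * \<bar>w - w'\<bar>"
      using assms unfolding hpois_in_def by (intro poisE_bound poisE_Lipschitz) auto
    finally show ?thesis by simp
  qed
  ultimately show ?thesis by linarith
qed

lemma hpois_in_eq: "hpois_in (int r - int (r + j)) w = exp (- w) * (\<Sum>i=0..j. w ^ i / fact i)"
proof -
  have "(\<Sum>i. of_bool (int r - int (r + j) + int i \<le> 0) / fact i * w ^ i)
      = (\<Sum>i\<in>{0..j}. of_bool (int r - int (r + j) + int i \<le> 0) / fact i * w ^ i)"
    by (rule suminf_finite) auto
  also have "\<dots> = (\<Sum>i=0..j. w ^ i / fact i)" by (intro sum.cong) auto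
  finally show ?thesis by (simp add: hpois_in_def poisE_def)
qed

text \<open>Conditioning on \<open>X = r + j\<close> leaves the event \<open>Y \<le> j\<close>, and
  values of \<open>X\<close> below \<open>r\<close> contribute nothing. The index is shifted as in
  \<open>beta\<close>.\<close>

lemma hpois_eq_series:
  assumes "0 \<le> w"
  shows "summable (\<lambda>j. \<Sum>i=0..j. u ^ (r + j) / fact (r + j) * (w ^ i / fact i) * exp (- (u + w)))"
    and "hpois (int r) u w = (\<Sum>j. \<Sum>i=0..j. u ^ (r + j) / fact (r + j) * (w ^ i / fact i) * exp (- (u + w)))"
proof -
  let ?t = "\<lambda>k. hpois_in (int r - int k) w / fact k * u ^ k"
  have s: "summable ?t" by (rule summable_poisE[of _ 1]) (rule hpois_in_bound[OF assms])
  have z: "?t k = 0" if "k < r" for k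
  proof -
    have "hpois_in (int r - int k) w = poisE (\<lambda>i. 0) w"
      unfolding hpois_in_def using that by (intro arg_cong[where f="\<lambda>c. poisE c w"]) auto
    then show ?thesis by (simp add: poisE_def)
  qed
  have eq: "exp (- u) * ?t (j + r) = (\<Sum>i=0..j. u ^ (r + j) / fact (r + j) * (w ^ i / fact i) * exp (- (u + w)))" for j
  proof -
    have "exp (- u) * ?t (j + r) = (u ^ (r + j) / fact (r + j)) * (exp (- u) * exp (- w)) * (\<Sum>i=0..j. w ^ i / fact i)"
      using hpois_in_eq[of r j w] by (simp add: add.commute mult_ac)
    also have "exp (- u) * exp (- w) = exp (- (u + w))" by (simp add: exp_add[symmetric])
    finally have "exp (- u) * ?t (j + r) = u ^ (r + j) / fact (r + j) * exp (- (u + w)) * (\<Sum>i=0..j. w ^ i / fact i)" .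
    then show ?thesis unfolding sum_distrib_left
      by (rule trans) (intro sum.cong refl, simp only: mult_ac)
  qed
  have s2: "summable (\<lambda>j. exp (- u) * ?t (j + r))"
    by (rule summable_mult[OF summable_ignore_initial_segment[OF s]])
  then show "summable (\<lambda>j. \<Sum>i=0..j. u ^ (r + j) / fact (r + j) * (w ^ i / fact i) * exp (- (u + w)))"
    unfolding eq .
  have "(\<Sum>k. ?t k) = (\<Sum>j. ?t (j + r)) + (\<Sum>k<r. ?t k)"
    by (rule suminf_split_initial_segment[OF s])
  also have "(\<Sum>k<r. ?t k) = 0" using z by (intro sum.neutral) auto
  finally have "hpois (int r) u w = exp (- u) * (\<Sum>j. ?t (j + r))"
    by (simp add: hpois_def poisE_def)
  also have "\<dots> = (\<Sum>j. exp (- u) * ?t (j + r))"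
    by (rule suminf_mult[OF summable_ignore_initial_segment[OF s], symmetric])
  finally show "hpois (int r) u w = (\<Sum>j. \<Sum>i=0..j. u ^ (r + j) / fact (r + j) * (w ^ i / fact i) * exp (- (u + w)))"
    unfolding eq .
qed

lemma hpois_pos:
  assumes "0 < u" "0 \<le> w" shows "0 < hpois (int r) u w"
proof -
  have nn: "0 \<le> u ^ (r + j) / fact (r + j) * (w ^ i / fact i) * exp (- (u + w))" for i j
    using assms by auto
  show ?thesis
    unfolding hpois_eq_series(2)[OF assms(2)]
  proof (rule suminf_pos2[OF hpois_eq_series(1)[OF assms(2)], where i=0])
    show "0 \<le> (\<Sum>i=0..j. u ^ (r + j) / fact (r + j) * (w ^ i / fact i) * exp (- (u + w)))" for j
      by (intro sum_nonneg nn)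
    show "0 < (\<Sum>i=0..0. u ^ (r + 0) / fact (r + 0) * (w ^ i / fact i) * exp (- (u + w)))"
      using assms by simp
  qed
qed

lemma beta_Inverse_p:
  assumes "0 \<le> component (other S) x + \<alpha> (other S)"
  shows "beta Inverse_p r \<alpha> S x = hpois (int r) (component S x + \<alpha> S) (component (other S) x + \<alpha> (other S))"
proof -
  have "component Red x + component Black x + \<alpha> Red + \<alpha> Black
      = (component S x + \<alpha> S) + (component (other S) x + \<alpha> (other S))" by (cases S) auto
  then show ?thesis unfolding beta.simps hpois_eq_series(2)[OF assms] by (simp only:)
qed

section \<open>Stability of the Euler scheme\<close>

text \<open>The condition on \<open>u\<close> is required in the tube of radius \<open>\<eta>\<close> around \<open>y\<close> only, and \<open>G\<close> (the
  process still runs) is obtained along with the estimate.\<close>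

lemma euler_stability:
  fixes y \<phi> :: "real \<Rightarrow> real" and N u :: "nat \<Rightarrow> real" and G :: "nat \<Rightarrow> bool" and q K \<epsilon> L \<eta> :: real
  assumes pos: "0 < q" "0 \<le> K" "0 \<le> \<epsilon>" "0 \<le> L"
    and small: "\<epsilon> * (1 + 2 * K) * exp (L * K) \<le> \<eta>" and y0: "y 0 = 0"
    and euler: "\<And>j. real (Suc j) \<le> K * q \<Longrightarrow> \<bar>y (real (Suc j) / q) - y (real j / q) - \<phi> (real j / q) / q\<bar> \<le> \<epsilon> / q"
    and step: "\<And>k. real k \<le> K * q \<Longrightarrow> (\<And>j. j < k \<Longrightarrow> G j) \<Longrightarrow> \<bar>N k / q - y (real k / q)\<bar> \<le> \<eta> \<Longrightarrow>
      G k \<and> \<bar>u k - \<phi> (real k / q)\<bar> \<le> \<epsilon> + L * \<bar>N k / q - y (real k / q)\<bar>"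
    and dev: "\<And>k. real k \<le> K * q \<Longrightarrow> \<bar>N k - (\<Sum>j<k. u j)\<bar> \<le> \<epsilon> * q"
  shows "real k \<le> K * q \<Longrightarrow> G k \<and> \<bar>N k / q - y (real k / q)\<bar> \<le> \<epsilon> * (1 + 2 * K) * exp (L * K)"
proof -
  define e where "e k = \<bar>N k / q - y (real k / q)\<bar>" for k
  \<comment> \<open>One \<open>\<epsilon>\<close> comes from the deviation;
    \<open>2 * \<epsilon> * K\<close> comes from the drift and Euler errors, which amount to
    \<open>2 * \<epsilon> / q\<close> at each of at most \<open>K * q\<close> steps.\<close>
  define c where "c = \<epsilon> * (1 + 2 * K)"
  have c0: "0 \<le> c" using pos by (simp add: c_def)
  have pw: "c * (1 + L / q) ^ k \<le> c * exp (L * K)" if "real k \<le> K * q" for k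
  proof -
    have "(1 + L / q) ^ k \<le> exp (L / q) ^ k" using pos by (intro power_mono exp_ge_add_one_self) auto
    also have "\<dots> = exp (L * (k / q))" by (simp add: exp_of_nat_mult[symmetric] mult_ac)
    also have "real k / q \<le> K" using that pos by (simp add: pos_divide_le_eq)
    then have "L * (k / q) \<le> L * K" using pos by (intro mult_left_mono)
    then have "exp (L * (k / q)) \<le> exp (L * K)" by (simp only: exp_le_cancel_iff)
    finally show ?thesis using c0 by (rule mult_left_mono)
  qed
  have main: "G k \<and> \<bar>u k - \<phi> (real k / q)\<bar> \<le> \<epsilon> + L * e k \<and> e k \<le> c * (1 + L / q) ^ k" if "real k \<le> K * q" for k
    using that
  proof (induction k rule: less_induct)
    case (less k)
    have jk: "real j \<le> K * q" "real (Suc j) \<le> K * q" if "j < k" for j using that less.prems by auto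
    note IH = less.IH[OF _ jk(1)]
    let ?dy = "\<lambda>j. y (real (Suc j) / q) - y (real j / q)"
    have "y (real k / q) = (\<Sum>j<k. ?dy j)"
      using sum_lessThan_telescope[of "\<lambda>j. y (real j / q)" k] y0 by simp
    then have "N k / q - y (real k / q) = (N k - (\<Sum>j<k. u j)) / q + (\<Sum>j<k. u j / q - ?dy j)"
      by (simp add: diff_divide_distrib sum_subtractf sum_divide_distrib)
    then have "e k \<le> \<bar>(N k - (\<Sum>j<k. u j)) / q\<bar> + \<bar>\<Sum>j<k. u j / q - ?dy j\<bar>"
      unfolding e_def by (simp only: abs_triangle_ineq)
    also have "\<bar>(N k - (\<Sum>j<k. u j)) / q\<bar> \<le> \<epsilon>"
      using dev[OF less.prems] pos by (simp add: field_simps)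
    also have "\<bar>\<Sum>j<k. u j / q - ?dy j\<bar> \<le> (\<Sum>j<k. (2 * \<epsilon> + L * (c * (1 + L / q) ^ j)) / q)"
    proof (rule order.trans[OF sum_abs sum_mono])
      fix j assume "j \<in> {..<k}"
      then have j: "j < k" by simp
      have "\<bar>u j - \<phi> (real j / q)\<bar> \<le> \<epsilon> + L * (c * (1 + L / q) ^ j)"
        using IH[OF j j] pos mult_left_mono[of "e j" "c * (1 + L / q) ^ j" L] by linarith
      then have "\<bar>u j / q - \<phi> (real j / q) / q\<bar> \<le> (\<epsilon> + L * (c * (1 + L / q) ^ j)) / q"
        using pos by (simp add: diff_divide_distrib[symmetric] divide_right_mono)
      moreover have "\<bar>?dy j - \<phi> (real j / q) / q\<bar> \<le> \<epsilon> / q" by (rule euler[OF jk(2)[OF j]])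
      ultimately have "\<bar>u j / q - ?dy j\<bar> \<le> (\<epsilon> + L * (c * (1 + L / q) ^ j)) / q + \<epsilon> / q" by linarith
      then show "\<bar>u j / q - ?dy j\<bar> \<le> (2 * \<epsilon> + L * (c * (1 + L / q) ^ j)) / q"
        by (simp add: add_divide_distrib[symmetric])
    qed
    also have "\<dots> = 2 * \<epsilon> * (k / q) + c * (L / q * (\<Sum>j<k. (1 + L / q) ^ j))"
      by (simp add: add_divide_distrib sum.distrib sum_distrib_left sum_divide_distrib mult_ac)
    \<comment> \<open>The geometric sum reproduces the Gronwall factor:
      \<open>c + c * ((1 + L / q) ^ k - 1)\<close> is again
      \<open>c * (1 + L / q) ^ k\<close>.\<close>
    also have "L / q * (\<Sum>j<k. (1 + L / q) ^ j) = (1 + L / q) ^ k - 1"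
      using power_diff_1_eq[of "1 + L / q" k] by (cases k) auto
    finally have "e k \<le> \<epsilon> + (2 * \<epsilon> * (k / q) + c * ((1 + L / q) ^ k - 1))" by simp
    also have "2 * \<epsilon> * (k / q) \<le> 2 * \<epsilon> * K"
      using less.prems pos by (intro mult_left_mono) (auto simp: field_simps)
    finally have ek: "e k \<le> c * (1 + L / q) ^ k"
      by (simp add: c_def algebra_simps)
    \<comment> \<open>The bound on \<open>e k\<close> rests on the rates before \<open>k\<close>
      only; it places step \<open>k\<close> inside the tube, where \<open>step\<close>
      applies.\<close>
    then have "e k \<le> \<eta>" using pw[OF less.prems] small by (simp add: c_def)
    with step[OF less.prems] IH ek show ?case unfolding e_def by blast
  qed
  assume k: "real k \<le> K * q"
  show ?thesis using main[OF k] pw[OF k] unfolding e_def c_def by auto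
qed

section \<open>The solution of the Cauchy problem\<close>

lemma compact_Collect_nonpos:
  fixes h :: "real \<Rightarrow> real"
  assumes "continuous_on {a..b} h" shows "compact {t \<in> {a..b}. h t \<le> 0}"
proof -
  have "closed {t \<in> {a..b}. h t \<le> 0}"
    by (rule continuous_on_closed_Collect_le[OF assms continuous_on_const closed_atLeastAtMost])
  moreover have "bounded {t \<in> {a..b}. h t \<le> 0}"
    by (rule bounded_subset[OF bounded_closed_interval[of a b]]) auto
  ultimately show ?thesis by (simp add: compact_eq_bounded_closed)
qed

locale solution =
  fixes reg :: regime and r :: nat and \<alpha> :: "color \<Rightarrow> real" and f :: "real \<Rightarrow> real \<times> real" and \<kappa>\<^sub>f :: ereal
  assumes r2: "2 \<le> r" and \<alpha>_less: "\<alpha> Black < \<alpha> Red" and \<alpha>_Black: "0 < \<alpha> Black"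
    and sol: "cauchy_solution (beta reg r \<alpha>) \<kappa>\<^sub>f f"
begin

abbreviation "fc S x \<equiv> component S (f x)"
abbreviation "bet S x \<equiv> beta reg r \<alpha> S (f x)"
abbreviation "rate x \<equiv> bet Red x / (bet Red x + bet Black x)"

lemma \<alpha>_pos: "0 < \<alpha> S"
  using \<alpha>_less \<alpha>_Black by (cases S) auto

lemma fc_nonneg: "0 \<le> x \<Longrightarrow> ereal x < \<kappa>\<^sub>f \<Longrightarrow> 0 \<le> fc S x"
  using sol by (cases S) (auto simp: cauchy_solution_def)

lemma fc_0 [simp]: "fc S 0 = 0"
  using sol by (cases S) (auto simp: cauchy_solution_def)

lemma domain_mono: "t \<le> x \<Longrightarrow> ereal x < \<kappa>\<^sub>f \<Longrightarrow> ereal t < \<kappa>\<^sub>f"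
  by (rule le_less_trans[of _ "ereal x"]) auto

lemma continuous_fc: "ereal x < \<kappa>\<^sub>f \<Longrightarrow> continuous_on {0..x} (\<lambda>t. fc S t)"
proof -
  assume x: "ereal x < \<kappa>\<^sub>f"
  have "continuous_on {0..x} f"
    using sol domain_mono[OF _ x] unfolding cauchy_solution_def by (auto intro: continuous_on_subset)
  then show ?thesis by (cases S) (auto intro!: continuous_intros)
qed

lemma bet_sum_nz: "0 < x \<Longrightarrow> ereal x < \<kappa>\<^sub>f \<Longrightarrow> bet Red x + bet Black x \<noteq> 0"
  using sol by (auto simp: cauchy_solution_def)

lemma DERIV_fc:
  assumes "0 < x" "ereal x < \<kappa>\<^sub>f"
  shows "((\<lambda>t. fc S t) has_real_derivative bet S x / (bet Red x + bet Black x)) (at x)"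
proof -
  have D: "(f has_vector_derivative (bet Red x / (bet Red x + bet Black x), bet Black x / (bet Red x + bet Black x))) (at x)"
    using sol assms by (auto simp: cauchy_solution_def)
  show ?thesis
    using bounded_linear.has_vector_derivative[OF bounded_linear_fst D] bounded_linear.has_vector_derivative[OF bounded_linear_snd D]
    by (cases S) (auto simp: has_real_derivative_iff_has_vector_derivative)
qed

text \<open>The components of the field add up to 1, as the denominator does not vanish along a
  solution. Hence the red component determines the black one.\<close>

lemma fc_sum:
  assumes "0 \<le> x" "ereal x < \<kappa>\<^sub>f" shows "fc Red x + fc Black x = x"
proof (cases "x = 0")
  case False
  then have "0 < x" using assms by simp
  have "fc Red x + fc Black x - x = fc Red 0 + fc Black 0 - 0"
  proof (rule DERIV_isconst_end[OF \<open>0 < x\<close>])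
    show "continuous_on {0..x} (\<lambda>t. fc Red t + fc Black t - t)"
      by (intro continuous_intros continuous_fc assms)
    fix t assume t: "0 < t" "t < x"
    then have d: "ereal t < \<kappa>\<^sub>f" using domain_mono[of t x] assms by auto
    have "((\<lambda>t. fc Red t + fc Black t - t) has_real_derivative
        bet Red t / (bet Red t + bet Black t) + bet Black t / (bet Red t + bet Black t) - 1) (at t)"
      by (intro DERIV_diff DERIV_add DERIV_fc t d DERIV_ident)
    then show "((\<lambda>t. fc Red t + fc Black t - t) has_real_derivative 0) (at t)"
      using bet_sum_nz[OF t(1) d] by (simp add: add_divide_distrib[symmetric])
  qed
  then show ?thesis by simp
qed (simp add: fc_0[simplified])

lemma bet_Critical: "reg = Critical \<Longrightarrow> bet S x = 1 / real r * (1 - 1 / real r) ^ (r - 1) * (fc S x + \<alpha> S) ^ r - fc S x"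
  by simp

text \<open>At the first zero of one of the \<open>\<beta>\<^sub>S\<close> along the solution the sum \<open>\<beta>\<^sub>R + \<beta>\<^sub>B\<close> would still be at least
  some \<open>m > 0\<close>.  Since \<open>\<beta>\<^sub>S\<close> has slope at least \<open>-1\<close> in its argument, its derivative in time is at least
  \<open>- \<beta>\<^sub>S / m\<close>, hence \<open>\<beta>\<^sub>S exp(t / m)\<close> increases and cannot vanish.\<close>

lemma Critical_pos:
  assumes reg: "reg = Critical" and x: "0 \<le> x" "ereal x < \<kappa>\<^sub>f"
  shows "0 < bet S x"
proof (rule ccontr)
  assume neg: "\<not> ?thesis"
  define c where "c = 1 / real r * (1 - 1 / real r) ^ (r - 1)"
  have c: "0 < c" using r2 by (auto simp: c_def)
  have bet: "bet S t = c * (fc S t + \<alpha> S) ^ r - fc S t" for S t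
    unfolding bet_Critical[OF reg] c_def ..
  have cont: "continuous_on {0..x} (bet S)" for S
    unfolding bet by (intro continuous_intros continuous_fc x)
  define Z where "Z = {t \<in> {0..x}. bet Red t \<le> 0} \<union> {t \<in> {0..x}. bet Black t \<le> 0}"
  have cZ: "compact Z"
    unfolding Z_def by (intro compact_Un compact_Collect_nonpos cont)
  have nZ: "Z \<noteq> {}" using neg x by (cases S) (auto simp: Z_def)
  from compact_attains_inf[OF cZ nZ] obtain x1 where x1: "x1 \<in> Z" "\<And>t. t \<in> Z \<Longrightarrow> x1 \<le> t"
    by metis
  obtain S1 where S1: "bet S1 x1 \<le> 0" using x1(1) by (auto simp: Z_def)
  have x1x: "0 \<le> x1" "x1 \<le> x" using x1(1) by (auto simp: Z_def)
  have pos: "0 < bet S t" if "0 \<le> t" "t < x1" for S t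
  proof (rule ccontr)
    assume "\<not> ?thesis"
    then have "t \<in> Z" using that x1x by (cases S) (auto simp: Z_def)
    then show False using x1(2) that by force
  qed
  have bet0: "0 < bet S 0" for S
    unfolding bet using c \<alpha>_pos[of S] by simp
  have x1pos: "0 < x1" using S1 bet0[of S1] x1x by (cases "x1 = 0") auto
  have d1: "ereal x1 < \<kappa>\<^sub>f" using domain_mono[OF x1x(2) x(2)] .
  have contx1: "continuous_on {0..x1} (bet S)" for S
    by (rule continuous_on_subset[OF cont]) (use x1x in auto)
  have nn: "0 \<le> bet S x1" for S
  proof (rule tendsto_lowerbound)
    show "(bet S \<longlongrightarrow> bet S x1) (at_left x1)"
      by (rule continuous_on_Icc_at_leftD[OF contx1 x1pos])
    show "\<forall>\<^sub>F t in at_left x1. 0 \<le> bet S t"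
      using eventually_at_left_real[OF x1pos] by eventually_elim (use pos in \<open>auto intro: less_imp_le\<close>)
  qed auto
  \<comment> \<open>At \<open>x1\<close> both functions are limits of positive values, so the sum is
    nonnegative, and it is nonzero by the definition of a solution.\<close>
  have sumpos: "0 < bet Red t + bet Black t" if "t \<in> {0..x1}" for t
  proof (cases "t = x1")
    case True
    then show ?thesis using bet_sum_nz[OF x1pos d1] nn[of Red] nn[of Black] by auto
  next
    case False
    then show ?thesis using that pos[of t Red] pos[of t Black] by auto
  qed
  have "\<exists>m>0. \<forall>t\<in>{0..x1}. m \<le> bet Red t + bet Black t"
  proof -
    have "\<exists>t0\<in>{0..x1}. \<forall>t\<in>{0..x1}. bet Red t0 + bet Black t0 \<le> bet Red t + bet Black t"
      using x1x by (intro continuous_attains_inf continuous_intros contx1) auto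
    then show ?thesis using sumpos by blast
  qed
  then obtain m where m: "0 < m" "\<And>t. t \<in> {0..x1} \<Longrightarrow> m \<le> bet Red t + bet Black t" by blast
  have "bet S1 0 * exp (0 / m) \<le> bet S1 x1 * exp (x1 / m)"
  proof (rule DERIV_nonneg_imp_increasing_open[of 0 x1 "\<lambda>t. bet S1 t * exp (t / m)"])
    fix t assume t: "0 < t" "t < x1"
    have dt: "ereal t < \<kappa>\<^sub>f" using domain_mono[of t x1] t d1 by auto
    let ?s = "bet Red t + bet Black t"
    let ?D = "(c * (real r * ((bet S1 t / ?s) * (fc S1 t + \<alpha> S1) ^ (r - 1))) - bet S1 t / ?s)"
    have D: "(bet S1 has_real_derivative ?D) (at t)"
      unfolding bet
      by (rule derivative_eq_intros DERIV_fc[OF t(1) dt, of S1, unfolded bet] refl)+ (simp add: bet)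
    have "((\<lambda>t. bet S1 t * exp (t / m)) has_real_derivative (?D * exp (t / m) + exp (t / m) * (1 / m) * bet S1 t)) (at t)"
      using m(1) by (intro DERIV_mult' DERIV_mult D) (auto intro!: derivative_eq_intros)
    moreover have "0 \<le> ?D * exp (t / m) + exp (t / m) * (1 / m) * bet S1 t"
    proof -
      have s: "m \<le> ?s" "0 < ?s" using m t sumpos[of t] by auto
      have b: "0 < bet S1 t" using pos t by auto
      have "0 \<le> c * (real r * ((bet S1 t / ?s) * (fc S1 t + \<alpha> S1) ^ (r - 1)))"
        using c b s fc_nonneg[of t S1] t dt \<alpha>_pos[of S1] by (intro mult_nonneg_nonneg divide_nonneg_nonneg zero_le_power) auto
      moreover have "bet S1 t / ?s \<le> bet S1 t / m" using s b m by (intro divide_left_mono) auto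
      ultimately have "0 \<le> ?D + bet S1 t / m" by linarith
      then have "0 \<le> exp (t / m) * (?D + bet S1 t / m)" by (intro mult_nonneg_nonneg) auto
      then show ?thesis by (simp add: algebra_simps)
    qed
    ultimately show "\<exists>y. ((\<lambda>t. bet S1 t * exp (t / m)) has_real_derivative y) (at t) \<and> 0 \<le> y" by blast
  next
    show "continuous_on {0..x1} (\<lambda>t. bet S1 t * exp (t / m))"
      using m by (intro continuous_intros contx1) auto
  qed (use x1x in auto)
  moreover have "bet S1 x1 * exp (x1 / m) \<le> 0" using S1 by (simp add: mult_nonpos_nonneg)
  ultimately show False using bet0[of S1] by simp
qed

text \<open>Red starts ahead, and while it is ahead its lead \<open>d\<close> has derivative 1. So
  there is no first time without a lead, and the discontinuity of the field is never
  reached.\<close>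

lemma Beyond_fc:
  assumes reg: "reg = Beyond" and x: "0 \<le> x" "ereal x < \<kappa>\<^sub>f"
  shows "fc Red x = x" "fc Black x = 0"
proof -
  define d where "d t = fc Red t + \<alpha> Red - (fc Black t + \<alpha> Black)" for t
  have ratio: "u / (u + w) \<ge> 1 / 2 \<longleftrightarrow> w \<le> u" if "0 < u" "0 < w" for u w :: real
    using that by (simp add: field_simps)
  \<comment> \<open>At a tie both values are 1, because the inequality in \<open>beta\<close> is not
    strict.\<close>
  have b: "bet Red t = of_bool (0 \<le> d t)" "bet Black t = of_bool (d t \<le> 0)" if "0 \<le> t" "ereal t < \<kappa>\<^sub>f" for t
  proof -
    have p: "0 < fc Red t + \<alpha> Red" "0 < fc Black t + \<alpha> Black"
      using fc_nonneg[OF that] \<alpha>_pos by (simp_all add: add_nonneg_pos del: component.simps)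
    have e: "fc Red t + \<alpha> Red + fc Black t + \<alpha> Black = (fc Red t + \<alpha> Red) + (fc Black t + \<alpha> Black)"
      "fc Red t + \<alpha> Red + fc Black t + \<alpha> Black = (fc Black t + \<alpha> Black) + (fc Red t + \<alpha> Red)" by simp_all
    show "bet Red t = of_bool (0 \<le> d t)"
      unfolding reg beta.simps e(1) ratio[OF p] d_def by simp
    show "bet Black t = of_bool (d t \<le> 0)"
      unfolding reg beta.simps e(2) ratio[OF p(2,1)] d_def by simp
  qed
  have dpos: "0 < d t" if t: "0 \<le> t" "ereal t < \<kappa>\<^sub>f" for t
  proof (rule ccontr)
    assume neg: "\<not> ?thesis"
    have cont: "continuous_on {0..t} d" unfolding d_def by (intro continuous_intros continuous_fc t)
    define Z where "Z = {s \<in> {0..t}. d s \<le> 0}"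
    have cZ: "compact Z" unfolding Z_def by (intro compact_Collect_nonpos cont)
    have nZ: "Z \<noteq> {}" using neg t by (auto simp: Z_def)
    from compact_attains_inf[OF cZ nZ] obtain x1 where x1: "x1 \<in> Z" "\<And>s. s \<in> Z \<Longrightarrow> x1 \<le> s"
      by metis
    have d0: "0 < d 0" using \<alpha>_less by (simp add: d_def del: component.simps)
    have x1t: "0 < x1" "x1 \<le> t" "d x1 \<le> 0" using x1(1) d0 by (auto simp: Z_def less_le)
    have "d x1 - x1 = d 0 - 0"
    proof (rule DERIV_isconst_end[OF x1t(1)])
      show "continuous_on {0..x1} (\<lambda>s. d s - s)"
        using cont x1t by (intro continuous_intros) (auto intro: continuous_on_subset)
      fix s assume s: "0 < s" "s < x1"
      then have ds: "ereal s < \<kappa>\<^sub>f" using domain_mono[of s t] t x1t by auto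
      have "0 < d s" using x1(2)[of s] s x1t by (force simp: Z_def)
      then have bs: "bet Red s = 1" "bet Black s = 0" using b[of s] s ds by auto
      have "((\<lambda>s. d s - s) has_real_derivative
          ((bet Red s / (bet Red s + bet Black s) + 0) - (bet Black s / (bet Red s + bet Black s) + 0)) - 1) (at s)"
        unfolding d_def by (intro DERIV_diff DERIV_add DERIV_fc s ds DERIV_ident DERIV_const)
      then show "((\<lambda>s. d s - s) has_real_derivative 0) (at s)" unfolding bs by simp
    qed
    then show False using d0 x1t by simp
  qed
  show R: "fc Red x = x"
  proof (cases "x = 0")
    case False
    then have "0 < x" using x by simp
    have "fc Red x - x = fc Red 0 - 0"
    proof (rule DERIV_isconst_end[OF \<open>0 < x\<close>])
      show "continuous_on {0..x} (\<lambda>s. fc Red s - s)" by (intro continuous_intros continuous_fc x)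
      fix s assume s: "0 < s" "s < x"
      then have ds: "ereal s < \<kappa>\<^sub>f" using domain_mono[of s x] x by auto
      have bs: "bet Red s = 1" "bet Black s = 0" using b[of s] s ds dpos[of s] by auto
      have "((\<lambda>s. fc Red s - s) has_real_derivative bet Red s / (bet Red s + bet Black s) - 1) (at s)"
        by (intro DERIV_diff DERIV_fc s ds DERIV_ident)
      then show "((\<lambda>s. fc Red s - s) has_real_derivative 0) (at s)" unfolding bs by simp
    qed
    then show ?thesis by simp
  qed (simp add: fc_0[simplified])
  show "fc Black x = 0" using fc_sum[OF x] R by linarith
qed

lemma Beyond_bet:
  assumes reg: "reg = Beyond" and x: "0 \<le> x" "ereal x < \<kappa>\<^sub>f"
  shows "bet Red x = 1" "bet Black x = 0"
proof -
  have "x + \<alpha> Red + 0 + \<alpha> Black > 0" using x \<alpha>_pos[of Red] \<alpha>_pos[of Black] by linarith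
  moreover have "\<alpha> Black < x + \<alpha> Red" using x \<alpha>_less by linarith
  ultimately show "bet Red x = 1" "bet Black x = 0"
    unfolding reg beta.simps Beyond_fc[OF assms] by (auto simp: field_simps)
qed

lemma bet_Inverse_p:
  assumes reg: "reg = Inverse_p" and x: "0 \<le> x" "ereal x < \<kappa>\<^sub>f"
  shows "bet S x = hpois (int r) (fc S x + \<alpha> S) (fc (other S) x + \<alpha> (other S))"
  unfolding reg using fc_nonneg[OF x, of "other S"] \<alpha>_pos[of "other S"] by (intro beta_Inverse_p) simp

lemma bet_nonneg_sum_pos:
  assumes x: "0 \<le> x" "ereal x < \<kappa>\<^sub>f"
  shows "0 \<le> bet S x" "0 < bet Red x + bet Black x"
proof -
  have "(\<forall>S. 0 \<le> bet S x) \<and> 0 < bet Red x + bet Black x"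
  proof (cases reg)
    case Critical
    have p: "0 < bet S x" for S by (rule Critical_pos[OF Critical x])
    show ?thesis by (intro conjI allI less_imp_le[OF p] add_pos_pos p)
  next
    case Intermediate
    have p: "0 < bet S x" for S
      unfolding Intermediate beta.simps using fc_nonneg[OF x, of S] \<alpha>_pos[of S] by (intro mult_pos_pos zero_less_power) auto
    show ?thesis by (intro conjI allI less_imp_le[OF p] add_pos_pos p)
  next
    case Inverse_p
    have p: "0 < bet S x" for S
      unfolding bet_Inverse_p[OF Inverse_p x]
      using fc_nonneg[OF x, of S] \<alpha>_pos[of S] fc_nonneg[OF x, of "other S"] \<alpha>_pos[of "other S"] by (intro hpois_pos) auto
    show ?thesis by (intro conjI allI less_imp_le[OF p] add_pos_pos p)
  next
    case Beyond
    have "0 \<le> bet S x" for S by (cases S) (simp_all only: Beyond_bet[OF Beyond x])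
    then show ?thesis using Beyond_bet[OF Beyond x] by auto
  qed
  then show "0 \<le> bet S x" "0 < bet Red x + bet Black x" by auto
qed

text \<open>For \<open>Inverse_p\<close> continuity comes from \<open>hpois_Lipschitz\<close>; for
  \<open>Beyond\<close> the field is discontinuous but constant along the solution.\<close>

lemma continuous_bet:
  assumes K: "ereal K < \<kappa>\<^sub>f" shows "continuous_on {0..K} (bet S)"
proof (cases reg)
  case Critical
  show ?thesis unfolding bet_Critical[OF Critical] by (intro continuous_intros continuous_fc K)
next
  case Intermediate
  show ?thesis unfolding Intermediate beta.simps by (intro continuous_intros continuous_fc K)
next
  case Inverse_p
  let ?h = "\<lambda>x. hpois (int r) (fc S x + \<alpha> S) (fc (other S) x + \<alpha> (other S))"
  have "continuous_on {0..K} ?h"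
    unfolding continuous_on_def
  proof
    fix x assume x: "x \<in> {0..K}"
    have p: "0 \<le> fc S' t + \<alpha> S'" if "t \<in> {0..K}" for S' t
      using fc_nonneg[of t S'] \<alpha>_pos[of S'] domain_mono[of t K] K that by auto
    have lim: "((\<lambda>t. 2 * \<bar>(fc S t + \<alpha> S) - (fc S x + \<alpha> S)\<bar> + 2 * \<bar>(fc (other S) t + \<alpha> (other S)) - (fc (other S) x + \<alpha> (other S))\<bar>) \<longlongrightarrow> 0) (at x within {0..K})"
    proof -
      have l: "((\<lambda>t. fc S' t) \<longlongrightarrow> fc S' x) (at x within {0..K})" for S'
        using continuous_fc[OF K] x unfolding continuous_on_def by blast
      have "((\<lambda>t. 2 * \<bar>(fc S t + \<alpha> S) - (fc S x + \<alpha> S)\<bar> + 2 * \<bar>(fc (other S) t + \<alpha> (other S)) - (fc (other S) x + \<alpha> (other S))\<bar>)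
        \<longlongrightarrow> 2 * \<bar>(fc S x + \<alpha> S) - (fc S x + \<alpha> S)\<bar> + 2 * \<bar>(fc (other S) x + \<alpha> (other S)) - (fc (other S) x + \<alpha> (other S))\<bar>) (at x within {0..K})"
        by (intro tendsto_intros l)
      then show ?thesis by simp
    qed
    show "(?h \<longlongrightarrow> ?h x) (at x within {0..K})"
    proof (rule LIM_zero_cancel, rule Lim_null_comparison[OF _ lim])
      show "\<forall>\<^sub>F t in at x within {0..K}. norm (?h t - ?h x) \<le> 2 * \<bar>(fc S t + \<alpha> S) - (fc S x + \<alpha> S)\<bar> + 2 * \<bar>(fc (other S) t + \<alpha> (other S)) - (fc (other S) x + \<alpha> (other S))\<bar>"
        unfolding eventually_at_topological
        using hpois_Lipschitz[OF p[of _ S] p[OF x, of S] p[of _ "other S"] p[OF x, of "other S"]] by auto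
    qed
  qed
  then show ?thesis
    using K domain_mono by (subst continuous_on_cong[OF refl bet_Inverse_p[OF Inverse_p]]) auto
next
  case Beyond
  have "bet S x = (case S of Red \<Rightarrow> 1 | Black \<Rightarrow> 0)" if "x \<in> {0..K}" for x
    using Beyond_bet[OF Beyond, of x] domain_mono[of x K] K that by (cases S) auto
  then show ?thesis by (subst continuous_on_cong[OF refl]) (auto intro: continuous_intros)
qed

text \<open>By compactness. The bound \<open>\<delta>\<close> keeps the denominator of the rates
  away from 0, and \<open>B\<close> later bounds mean counts.\<close>

lemma bet_bounds:
  assumes K: "0 \<le> K" "ereal K < \<kappa>\<^sub>f"
  obtains \<delta> B where "0 < \<delta>" "\<And>x. x \<in> {0..K} \<Longrightarrow> \<delta> \<le> bet Red x + bet Black x"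
    "\<And>x S. x \<in> {0..K} \<Longrightarrow> bet S x \<le> B"
proof -
  have "\<exists>t0\<in>{0..K}. \<forall>t\<in>{0..K}. bet Red t0 + bet Black t0 \<le> bet Red t + bet Black t"
    using K by (intro continuous_attains_inf continuous_intros continuous_bet) auto
  then obtain t0 where t0: "t0 \<in> {0..K}" "\<And>t. t \<in> {0..K} \<Longrightarrow> bet Red t0 + bet Black t0 \<le> bet Red t + bet Black t" by blast
  have "\<exists>t1\<in>{0..K}. \<forall>t\<in>{0..K}. bet Red t + bet Black t \<le> bet Red t1 + bet Black t1"
    using K by (intro continuous_attains_sup continuous_intros continuous_bet) auto
  then obtain t1 where t1: "t1 \<in> {0..K}" "\<And>t. t \<in> {0..K} \<Longrightarrow> bet Red t + bet Black t \<le> bet Red t1 + bet Black t1" by blast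
  show thesis
  proof (rule that)
    show "0 < bet Red t0 + bet Black t0"
      using t0 domain_mono[of t0 K] K by (intro bet_nonneg_sum_pos) auto
    fix x S assume x: "x \<in> {0..K}"
    then have "0 \<le> bet Red x" "0 \<le> bet Black x" using domain_mono[of x K] K by (auto intro!: bet_nonneg_sum_pos simp del: beta.simps)
    then show "bet S x \<le> bet Red t1 + bet Black t1" using t1(2)[OF x] by (cases S) auto
  qed (rule t0(2))
qed

text \<open>Mean value theorem and uniform continuity of \<open>rate\<close>. Only interior
  derivatives enter, so \<open>x = 0\<close> is covered although the equation is required at
  positive times.\<close>

lemma euler_estimate:
  assumes K: "0 \<le> K" "ereal K < \<kappa>\<^sub>f" and \<epsilon>: "0 < \<epsilon>"
  obtains d where "0 < d" "\<And>x h. 0 \<le> x \<Longrightarrow> 0 < h \<Longrightarrow> h < d \<Longrightarrow> x + h \<le> K \<Longrightarrow> \<bar>fc Red (x + h) - fc Red x - rate x * h\<bar> \<le> \<epsilon> * h"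
proof -
  have "continuous_on {0..K} rate"
  proof (intro continuous_on_divide continuous_on_add continuous_bet K ballI)
    fix x assume "x \<in> {0..K}"
    then show "bet Red x + bet Black x \<noteq> 0"
      using bet_nonneg_sum_pos(2)[of x] domain_mono[of x K] K by auto
  qed
  then have "uniformly_continuous_on {0..K} rate"
    by (intro compact_uniformly_continuous) auto
  then obtain d where d: "0 < d" "\<And>x x'. x \<in> {0..K} \<Longrightarrow> x' \<in> {0..K} \<Longrightarrow> dist x' x < d \<Longrightarrow> dist (rate x') (rate x) < \<epsilon>"
    unfolding uniformly_continuous_on_def using \<epsilon> by metis
  show thesis
  proof (rule that[OF d(1)])
    fix x h assume h: "0 \<le> x" "0 < h" "h < d" "x + h \<le> K"
    have dk: "ereal t < \<kappa>\<^sub>f" if "t \<le> x + h" for t using domain_mono[of t K] that h K by auto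
    have "continuous_on {x..x + h} (\<lambda>t. fc Red t)"
      using continuous_fc[of "x + h" Red] dk[of "x + h"] h by (auto intro: continuous_on_subset)
    moreover have D: "((\<lambda>t. fc Red t) has_real_derivative rate t) (at t)" if "x < t" "t < x + h" for t
      using that h dk[of t] by (intro DERIV_fc) auto
    ultimately obtain l z where z: "x < z" "z < x + h" "((\<lambda>t. fc Red t) has_real_derivative l) (at z)"
      "fc Red (x + h) - fc Red x = (x + h - x) * l"
      using MVT[of x "x + h" "\<lambda>t. fc Red t"] h by (auto simp: real_differentiable_def simp del: component.simps)
    have l: "l = rate z" by (rule DERIV_unique[OF z(3) D[OF z(1,2)]])
    have "dist (rate z) (rate x) < \<epsilon>" using z h by (intro d(2)) (auto simp: dist_real_def)
    then have "\<bar>rate z - rate x\<bar> * h \<le> \<epsilon> * h" using h by (intro mult_right_mono) (auto simp: dist_real_def)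
    moreover have "fc Red (x + h) - fc Red x - rate x * h = (rate z - rate x) * h"
      using z(4) unfolding l by (simp add: right_diff_distrib left_diff_distrib mult.commute)
    ultimately show "\<bar>fc Red (x + h) - fc Red x - rate x * h\<bar> \<le> \<epsilon> * h"
      using h by (simp only: abs_mult abs_of_pos)
  qed
qed

end

section \<open>Asymptotics of the parameters\<close>

lemma tendsto_eq_ev:
  fixes u h :: "nat \<Rightarrow> real"
  assumes "u \<longlonglongrightarrow> l" "\<forall>\<^sub>F n in sequentially. u n = h n" "l = l'"
  shows "h \<longlonglongrightarrow> l'"
  using Lim_transform_eventually[OF assms(1,2)] assms(3) by simp

lemma tendsto_0_of_power:
  fixes x :: "nat \<Rightarrow> real"
  assumes "(\<lambda>n. x n ^ k) \<longlonglongrightarrow> 0" "0 < k" "\<forall>\<^sub>F n in sequentially. 0 \<le> x n"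
  shows "x \<longlonglongrightarrow> 0"
proof -
  have "(\<lambda>n. root k (x n ^ k)) \<longlonglongrightarrow> root k 0"
    by (intro tendsto_real_root assms)
  moreover have "\<forall>\<^sub>F n in sequentially. root k (x n ^ k) = x n"
    using assms(3) by eventually_elim (simp add: real_root_power_cancel assms(2))
  ultimately show ?thesis by (rule tendsto_eq_ev) (simp add: power_0_left)
qed

lemma smallo_le:
  fixes u h :: "nat \<Rightarrow> real"
  assumes "u \<in> o(h)" "\<forall>\<^sub>F n in sequentially. 0 < u n" "\<forall>\<^sub>F n in sequentially. 0 < h n"
  shows "\<forall>\<^sub>F n in sequentially. u n \<le> h n"
  using landau_o.smallD[OF assms(1) zero_less_one] assms(2,3) by eventually_elim auto

locale setting = solution +
  fixes p q :: "nat \<Rightarrow> real" and a :: "color \<Rightarrow> nat \<Rightarrow> nat"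
  assumes p01: "\<And>n. n \<ge> 1 \<Longrightarrow> 0 < p n \<and> p n < 1"
    and p_lower: "(\<lambda>n. 1 / real n) \<in> o(p)"
    and p_upper: "p \<in> o(\<lambda>n. 1 / (real n powr (1 / real r) * ln (real n)))"
    and regime: "in_regime reg r p q"
    and seeds_lim: "\<And>S. (\<lambda>n. real (a S n) / q n) \<longlonglongrightarrow> \<alpha> S"
begin

abbreviation "G \<equiv> g_seq r p"
abbreviation "C\<^sub>0 \<equiv> (1 - 1 / real r) ^ (r - 1) * fact (r - 1)"

lemma C0_pos: "0 < C\<^sub>0"
  using r2 by (intro mult_pos_pos zero_less_power) auto

lemma r_pred: "real r - 1 = real (r - 1)" "0 < r - 1" "r = Suc (r - 1)"
  using r2 by auto

lemma inv_np: "(\<lambda>n. 1 / (real n * p n)) \<longlonglongrightarrow> 0"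
  using smalloD_tendsto[OF p_lower] by simp

lemma G_pos: "n \<ge> 1 \<Longrightarrow> 0 < G n"
  unfolding g_seq_def using p01[of n] r2 by (intro mult_pos_pos) auto

text \<open>The defining relation of \<open>g_seq\<close> freed from real powers, on which the
  limits involving \<open>g_seq\<close> rest.\<close>

lemma G_power: "n \<ge> 1 \<Longrightarrow> G n ^ (r - 1) * (real n * p n ^ r) = C\<^sub>0"
proof -
  assume n: "n \<ge> 1"
  define y where "y = fact (r - 1) / (real n * p n ^ r)"
  have y: "0 < y" unfolding y_def using p01[OF n] n by auto
  have "(y powr (1 / (real r - 1))) ^ (r - 1) = y"
    unfolding r_pred(1) using y r_pred(2) by (simp add: powr_power)
  then have "G n ^ (r - 1) = (1 - 1 / real r) ^ (r - 1) * y"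
    unfolding g_seq_def y_def[symmetric] power_mult_distrib by simp
  then show ?thesis using p01[OF n] n by (simp add: y_def)
qed

lemma s_lim: "(\<lambda>n. p n * (real n powr (1 / real r) * ln (real n))) \<longlonglongrightarrow> 0"
  using smalloD_tendsto[OF p_upper] by simp

lemma ev_ge: "\<forall>\<^sub>F n in sequentially. N \<le> (n :: nat)"
  by (rule eventually_ge_at_top)

text \<open>With \<open>s = p n * (n powr (1 / r) * ln n)\<close>, the power \<open>r - 1\<close> of
  the quotient is \<open>s ^ r / (ln n * C\<^sub>0)\<close>, and \<open>s\<close> tends to 0 by the
  upper bound on \<open>p\<close>.\<close>

lemma ln_over_G: "(\<lambda>n. ln (real n) / G n) \<longlonglongrightarrow> 0"
proof (rule tendsto_0_of_power[OF _ r_pred(2)])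
  let ?s = "\<lambda>n. p n * (real n powr (1 / real r) * ln (real n))"
  have "(\<lambda>n. ?s n ^ r * inverse (ln (real n)) * inverse C\<^sub>0) \<longlonglongrightarrow> 0 ^ r * 0 * inverse C\<^sub>0"
    by (intro tendsto_intros s_lim tendsto_inverse_0_at_top filterlim_compose[OF ln_at_top filterlim_real_sequentially])
  moreover have "\<forall>\<^sub>F n in sequentially. ?s n ^ r * inverse (ln (real n)) * inverse C\<^sub>0 = (ln (real n) / G n) ^ (r - 1)"
    using ev_ge[of 2]
  proof eventually_elim
    fix n :: nat assume n: "2 \<le> n"
    then have n1: "n \<ge> 1" and l: "0 < ln (real n)" by auto
    have "(real n powr (1 / real r)) ^ r = real n" using n r2 by (simp add: powr_power)
    then have sr: "?s n ^ r = p n ^ r * real n * ln (real n) ^ r" by (simp add: power_mult_distrib)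
    have lr: "ln (real n) ^ r = ln (real n) ^ (r - 1) * ln (real n)" by (subst r_pred(3)) simp
    have Gr: "G n ^ (r - 1) = C\<^sub>0 / (real n * p n ^ r)" using G_power[OF n1] p01[OF n1] n1 by (simp add: eq_divide_eq)
    show "?s n ^ r * inverse (ln (real n)) * inverse C\<^sub>0 = (ln (real n) / G n) ^ (r - 1)"
      unfolding sr lr power_divide Gr using l C0_pos p01[OF n1] n1 by (simp add: field_simps)
  qed
  ultimately show "(\<lambda>n. (ln (real n) / G n) ^ (r - 1)) \<longlonglongrightarrow> 0"
    by (rule tendsto_eq_ev) simp
  show "\<forall>\<^sub>F n in sequentially. 0 \<le> ln (real n) / G n"
    using ev_ge[of 1] by eventually_elim (auto intro!: divide_nonneg_pos G_pos)
qed

text \<open>The power \<open>r - 1\<close> of the product is \<open>C\<^sub>0 / (n * p n)\<close>,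
  which tends to 0 by the lower bound on \<open>p\<close>.\<close>

lemma Gp_lim: "(\<lambda>n. G n * p n) \<longlonglongrightarrow> 0"
proof (rule tendsto_0_of_power[OF _ r_pred(2)])
  have "(\<lambda>n. C\<^sub>0 * (1 / (real n * p n))) \<longlonglongrightarrow> C\<^sub>0 * 0" by (intro tendsto_intros inv_np)
  moreover have "\<forall>\<^sub>F n in sequentially. C\<^sub>0 * (1 / (real n * p n)) = (G n * p n) ^ (r - 1)"
    using ev_ge[of 1]
  proof eventually_elim
    fix n :: nat assume n: "1 \<le> n"
    have "p n ^ r = p n ^ (r - 1) * p n" by (subst r_pred(3)) simp
    moreover have "G n ^ (r - 1) = C\<^sub>0 / (real n * p n ^ r)" using G_power[OF n] p01[OF n] n by (simp add: eq_divide_eq)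
    ultimately show "C\<^sub>0 * (1 / (real n * p n)) = (G n * p n) ^ (r - 1)"
      unfolding power_mult_distrib using p01[OF n] n by simp
  qed
  ultimately show "(\<lambda>n. (G n * p n) ^ (r - 1)) \<longlonglongrightarrow> 0" by (rule tendsto_eq_ev) (simp add: power_0_left)
  show "\<forall>\<^sub>F n in sequentially. 0 \<le> G n * p n"
    using ev_ge[of 1] by eventually_elim (use G_pos p01 in \<open>auto intro!: mult_nonneg_nonneg less_imp_le\<close>)
qed

lemma p_lim: "p \<longlonglongrightarrow> 0"
proof (rule Lim_null_comparison[OF _ s_lim])
  show "\<forall>\<^sub>F n in sequentially. norm (p n) \<le> p n * (real n powr (1 / real r) * ln (real n))"
    using ev_ge[of 3]
  proof eventually_elim
    fix n :: nat assume n: "3 \<le> n"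
    have "exp 1 \<le> (3 :: real)" using exp_le by simp
    then have "1 \<le> ln (real n)" using n by (subst ln_ge_iff) auto
    moreover have "1 \<le> real n powr (1 / real r)" using n by (intro ge_one_powr_ge_zero) auto
    ultimately have "1 \<le> real n powr (1 / real r) * ln (real n)" using mult_mono[of 1 _ 1] by fastforce
    then show "norm (p n) \<le> p n * (real n powr (1 / real r) * ln (real n))"
      using p01[of n] n mult_left_mono[of 1 _ "p n"] by auto
  qed
qed

text \<open>Seed numbers are nonnegative and their ratio to \<open>q\<close> has a positive limit,
  which forces the sign of \<open>q\<close>.\<close>

lemma q_pos: "\<forall>\<^sub>F n in sequentially. 0 < q n"
proof -
  have "\<forall>\<^sub>F n in sequentially. 0 < real (a Red n) / q n"
    by (rule order_tendstoD(1)[OF seeds_lim \<alpha>_pos])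
  then show ?thesis by eventually_elim (auto simp: zero_less_divide_iff)
qed

lemma G_le_q: "\<forall>\<^sub>F n in sequentially. G n \<le> q n"
proof -
  have Gp: "\<forall>\<^sub>F n in sequentially. 0 < G n" using ev_ge[of 1] by eventually_elim (rule G_pos)
  have Gi: "\<forall>\<^sub>F n in sequentially. G n \<le> 1 / p n"
    using order_tendstoD(2)[OF Gp_lim, of 1, simplified] ev_ge[of 1]
    by eventually_elim (use p01 in \<open>auto simp: field_simps\<close>)
  have ip: "\<forall>\<^sub>F n in sequentially. 0 < 1 / p n" using ev_ge[of 1] by eventually_elim (use p01 in auto)
  show ?thesis
  proof (cases reg)
    case Critical
    then show ?thesis using regime by (intro eventually_mono[OF ev_ge[of 1]]) auto
  next
    case Intermediate
    then show ?thesis using regime by (intro smallo_le Gp q_pos) auto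
  next
    case Inverse_p
    then have "q n = 1 / p n" if "n \<ge> 1" for n using regime that by auto
    note qp = this
    show ?thesis using Gi ev_ge[of 1] by eventually_elim (simp add: qp)
  next
    case Beyond
    then have "\<forall>\<^sub>F n in sequentially. 1 / p n \<le> q n" using regime by (intro smallo_le ip q_pos) auto
    with Gi show ?thesis by eventually_elim simp
  qed
qed

lemma ln_over_q: "(\<lambda>n. ln (real n) / q n) \<longlonglongrightarrow> 0"
proof (rule Lim_null_comparison[OF _ ln_over_G])
  show "\<forall>\<^sub>F n in sequentially. norm (ln (real n) / q n) \<le> ln (real n) / G n"
    using G_le_q q_pos ev_ge[of 1]
    by eventually_elim (use G_pos in \<open>auto intro!: divide_left_mono mult_pos_pos\<close>)
qed

lemma inv_q: "(\<lambda>n. 1 / q n) \<longlonglongrightarrow> 0"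
proof (rule Lim_null_comparison[OF _ ln_over_q])
  show "\<forall>\<^sub>F n in sequentially. norm (1 / q n) \<le> ln (real n) / q n"
    using q_pos ev_ge[of 3]
  proof eventually_elim
    fix n :: nat assume n: "0 < q n" "3 \<le> n"
    have "exp 1 \<le> (3 :: real)" using exp_le by simp
    then have "1 \<le> ln (real n)" using n by (subst ln_ge_iff) auto
    then show "norm (1 / q n) \<le> ln (real n) / q n" using n by (auto intro!: divide_right_mono)
  qed
qed

lemma qp_lim:
  assumes "reg = Critical \<or> reg = Intermediate" shows "(\<lambda>n. q n * p n) \<longlonglongrightarrow> 0"
  using assms
proof
  assume "reg = Critical"
  then have "\<forall>\<^sub>F n in sequentially. G n * p n = q n * p n"
    using regime by (intro eventually_mono[OF ev_ge[of 1]]) auto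
  from tendsto_eq_ev[OF Gp_lim this refl] show ?thesis .
next
  assume "reg = Intermediate"
  then have "q \<in> o(\<lambda>n. 1 / p n)" using regime by simp
  from smalloD_tendsto[OF this] show ?thesis by simp
qed

lemma q_over_n: "(\<lambda>n. q n / real n) \<longlonglongrightarrow> 0"
proof (cases reg)
  case Beyond
  then have "q \<in> o(\<lambda>n. real n)" using regime by simp
  from smalloD_tendsto[OF this] show ?thesis .
next
  case Inverse_p
  then have "\<forall>\<^sub>F n in sequentially. 1 / (real n * p n) = q n / real n"
    using regime by (intro eventually_mono[OF ev_ge[of 1]]) (auto simp: mult.commute)
  from tendsto_eq_ev[OF inv_np this refl] show ?thesis .
next
  have *: ?thesis if "reg = Critical \<or> reg = Intermediate"
  proof -
    have "(\<lambda>n. (q n * p n) * (1 / (real n * p n))) \<longlonglongrightarrow> 0 * 0"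
      by (intro tendsto_mult qp_lim inv_np that)
    moreover have "\<forall>\<^sub>F n in sequentially. (q n * p n) * (1 / (real n * p n)) = q n / real n"
      using ev_ge[of 1] by eventually_elim (use p01 in force)
    ultimately show ?thesis by (rule tendsto_eq_ev) (simp add: power_0_left)
  qed
  { case Critical then show ?thesis using * by simp }
  { case Intermediate then show ?thesis using * by simp }
qed

lemma seeds_over_n: "(\<lambda>n. real (a S n) / real n) \<longlonglongrightarrow> 0"
proof -
  have "(\<lambda>n. (real (a S n) / q n) * (q n / real n)) \<longlonglongrightarrow> \<alpha> S * 0"
    by (intro tendsto_mult seeds_lim q_over_n)
  moreover have "\<forall>\<^sub>F n in sequentially. (real (a S n) / q n) * (q n / real n) = real (a S n) / real n"
    using q_pos by eventually_elim simp
  ultimately show ?thesis by (rule tendsto_eq_ev) (simp add: power_0_left)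
qed

lemma nW_over_n: "(\<lambda>n. real (n_W a n) / real n) \<longlonglongrightarrow> 1"
proof -
  have l: "(\<lambda>n. real (a Red n) / real n + real (a Black n) / real n) \<longlonglongrightarrow> 0 + 0"
    by (intro tendsto_add seeds_over_n)
  have "(\<lambda>n. 1 - (real (a Red n) / real n + real (a Black n) / real n)) \<longlonglongrightarrow> 1 - (0 + 0)"
    by (intro tendsto_diff tendsto_const l)
  moreover have "\<forall>\<^sub>F n in sequentially. 1 - (real (a Red n) / real n + real (a Black n) / real n) = real (n_W a n) / real n"
    using order_tendstoD(2)[OF l, of 1, simplified] ev_ge[of 1]
  proof eventually_elim
    fix n :: nat assume h: "real (a Red n) / real n + real (a Black n) / real n < 1" "1 \<le> n"
    then have "real (a Red n) + real (a Black n) < real n" by (simp add: add_divide_distrib[symmetric])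
    then have "real (n_W a n) = real n - (real (a Red n) + real (a Black n))" by (simp add: n_W_def)
    then show "1 - (real (a Red n) / real n + real (a Black n) / real n) = real (n_W a n) / real n"
      using h(2) by (simp add: diff_divide_distrib add_divide_distrib)
  qed
  ultimately show ?thesis by (rule tendsto_eq_ev) (simp add: power_0_left)
qed

text \<open>The order of magnitude of the number of susceptible nodes; mean counts are compared with
  \<open>beta\<close> after division by it.\<close>

definition scale :: "nat \<Rightarrow> real" where
  "scale n = (case reg of Critical \<Rightarrow> q n | Intermediate \<Rightarrow> real n * (q n * p n) ^ r | _ \<Rightarrow> real n)"

lemma Intermediate_ratio:
  assumes "reg = Intermediate" shows "\<forall>\<^sub>F n in sequentially. q n / scale n = (G n / q n) ^ (r - 1) / C\<^sub>0"
  using q_pos ev_ge[of 1]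
proof eventually_elim
  fix n :: nat assume n: "0 < q n" "1 \<le> n"
  have q: "q n ^ r = q n ^ (r - 1) * q n" by (subst r_pred(3)) simp
  have "G n ^ (r - 1) = C\<^sub>0 / (real n * p n ^ r)" using G_power[OF n(2)] p01[OF n(2)] n by (simp add: eq_divide_eq)
  moreover have "scale n = real n * (q n * p n) ^ r" unfolding scale_def using assms by simp
  ultimately show "q n / scale n = (G n / q n) ^ (r - 1) / C\<^sub>0"
    using n p01[OF n(2)] C0_pos by (simp add: power_mult_distrib q power_divide field_simps)
qed

text \<open>Says that outside \<open>Critical\<close> the active nodes are negligible against the
  susceptible ones. For \<open>Intermediate\<close> this is the assumption that \<open>q\<close>
  exceeds \<open>g_seq\<close> in order, for the other two that \<open>q\<close> is of smaller order
  than \<open>n\<close>.\<close>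

lemma q_over_scale:
  assumes "reg \<noteq> Critical" shows "(\<lambda>n. q n / scale n) \<longlonglongrightarrow> 0"
proof (cases reg)
  case Intermediate
  then have "G \<in> o(q)" using regime by simp
  from smalloD_tendsto[OF this] have "(\<lambda>n. (G n / q n) ^ (r - 1) / C\<^sub>0) \<longlonglongrightarrow> 0 ^ (r - 1) / C\<^sub>0"
    using C0_pos by (intro tendsto_intros) auto
  moreover have "(0::real) ^ (r - 1) / C\<^sub>0 = 0" using r_pred(2) by (simp add: power_0_left)
  ultimately have "(\<lambda>n. (G n / q n) ^ (r - 1) / C\<^sub>0) \<longlonglongrightarrow> 0" by (simp only:)
  then show ?thesis
    by (rule tendsto_eq_ev[OF _ eventually_mono[OF Intermediate_ratio[OF Intermediate] sym] refl])
qed (unfold scale_def, use assms q_over_n in simp_all)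

lemma scale_ge: "\<forall>\<^sub>F n in sequentially. q n \<le> scale n" and scale_pos: "\<forall>\<^sub>F n in sequentially. 0 < scale n"
proof -
  have 1: "\<forall>\<^sub>F n in sequentially. 0 < scale n"
    using q_pos ev_ge[of 1] by eventually_elim (use p01 in \<open>auto simp: scale_def split: regime.split\<close>)
  then show "\<forall>\<^sub>F n in sequentially. 0 < scale n" .
  show "\<forall>\<^sub>F n in sequentially. q n \<le> scale n"
  proof (cases "reg = Critical")
    case True
    then show ?thesis unfolding scale_def by simp
  next
    case False
    have "\<forall>\<^sub>F n in sequentially. q n / scale n < 1" by (rule order_tendstoD(2)[OF q_over_scale[OF False]]) simp
    with 1 show ?thesis by eventually_elim (simp add: divide_less_eq)
  qed
qed

lemma Critical_ratio:
  assumes "reg = Critical" "n \<ge> 1" shows "real n * (q n * p n) ^ r = C\<^sub>0 * q n"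
proof -
  have "q n = G n" using regime assms by simp
  moreover have "G n ^ r = G n ^ (r - 1) * G n" by (subst r_pred(3)) simp
  ultimately show ?thesis using G_power[OF assms(2)] by (simp add: power_mult_distrib mult_ac)
qed

end

section \<open>Mean numbers of susceptible nodes\<close>

lemma abs_diff_chain5:
  fixes x1 :: real
  assumes "\<bar>x1 - x2\<bar> \<le> e1" "\<bar>x2 - x3\<bar> \<le> e2" "\<bar>x3 - x4\<bar> \<le> e3" "\<bar>x4 - x5\<bar> \<le> e4" "\<bar>y1 - y2\<bar> \<le> e5"
  shows "\<bar>x1 - y1 - (x5 - y2)\<bar> \<le> e1 + e2 + e3 + e4 + e5"
  using assms by linarith

lemma power_diff_le:
  fixes x y W :: real
  assumes "0 \<le> x" "x \<le> W" "0 \<le> y" "y \<le> W"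
  shows "\<bar>x ^ k - y ^ k\<bar> \<le> real k * W ^ (k - 1) * \<bar>x - y\<bar>"
proof -
  have "norm (x ^ k - y ^ k) \<le> (real k * W ^ (k - 1)) * norm (x - y)"
  proof (rule field_differentiable_bound[where S="{0..W}"])
    fix z :: real assume z: "z \<in> {0..W}"
    show "((\<lambda>x. x ^ k) has_field_derivative real k * z ^ (k - 1)) (at z within {0..W})"
      by (auto intro!: derivative_eq_intros)
    show "norm (real k * z ^ (k - 1)) \<le> real k * W ^ (k - 1)"
      using z by (auto simp: abs_mult intro!: mult_left_mono power_mono)
  qed (use assms in auto)
  then show ?thesis by simp
qed

lemma power_le_fact_choose:
  assumes "k \<le> m" shows "(real m - real k) ^ k \<le> fact k * real (m choose k)"
proof -
  have "(real m - real k) ^ k = (\<Prod>i=0..<k. real m - real k)" by simp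
  also have "\<dots> \<le> (\<Prod>i=0..<k. real m - real i)" using assms by (intro prod_mono) auto
  also have "\<dots> = fact k * real (m choose k)"
    by (simp add: binomial_gbinomial gbinomial_prod_rev)
  finally show ?thesis .
qed

lemma choose_le_power_fact: "fact k * real (m choose k) \<le> real m ^ k"
proof -
  have "(m choose k) * fact k \<le> m ^ k" by (rule binomial_fact_pow)
  then have "real ((m choose k) * fact k) \<le> real (m ^ k)" by (simp only: of_nat_le_iff)
  then show ?thesis by (simp add: mult.commute)
qed

text \<open>There are two errors. Replacing \<open>m choose r\<close> by
  \<open>m ^ r / fact r\<close> shifts the rescaled base by at most \<open>r / q\<close>, and the
  absence of further successes costs \<open>(m + m') * p\<close>, at most
  \<open>2 * W * (q * p)\<close>, by Bernoulli's inequality.\<close>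

lemma bindiff_power_approx:
  fixes p q W :: real
  assumes p: "0 \<le> p" "p \<le> 1" and q: "0 < q" and W: "real m / q \<le> W" "real m' / q \<le> W" and r: "1 \<le> r" "r \<le> m"
  shows "\<bar>bindiff p m m' (int r) - (q * p) ^ r / fact r * (real m / q) ^ r\<bar>
    \<le> (q * p) ^ r / fact r * (real r * W ^ (r - 1) * (real r / q) + W ^ r * (2 * W * (q * p)))"
proof -
  define w where "w = real m / q"
  define B where "B = (q * p) ^ r / fact r"
  define A where "A = real (m choose r) * p ^ r"
  have B0: "0 \<le> B" using p q by (simp add: B_def)
  have w: "0 \<le> w" "w \<le> W" "real r / q \<le> w" using W q r by (auto simp: w_def divide_right_mono)
  have mw: "real m = w * q" using q by (simp add: w_def)
  have Ble: "A \<le> B * w ^ r"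
  proof -
    have "fact r * A \<le> real m ^ r * p ^ r"
      unfolding A_def using choose_le_power_fact[of r m] p by (simp add: mult.assoc[symmetric] mult_right_mono)
    then show ?thesis by (simp add: mw B_def power_mult_distrib field_simps)
  qed
  have Bge: "B * (w - real r / q) ^ r \<le> A"
  proof -
    have "(real m - real r) ^ r * p ^ r \<le> fact r * A"
      unfolding A_def using power_le_fact_choose[OF r(2)] p by (simp add: mult.assoc[symmetric] mult_right_mono)
    moreover have "fact r * (B * (w - real r / q) ^ r) = (real m - real r) ^ r * p ^ r"
    proof -
      have e: "real m - real r = (w - real r / q) * q" using q by (simp add: mw left_diff_distrib)
      show ?thesis unfolding e by (simp add: B_def power_mult_distrib mult_ac)
    qed
    ultimately have "fact r * (B * (w - real r / q) ^ r) \<le> fact r * A" by simp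
    then show ?thesis by (simp only: mult_le_cancel_left_pos fact_gt_zero)
  qed
  have up: "bindiff p m m' (int r) \<le> B * w ^ r"
    using bindiff_upper_choose[OF p, of m m' r] Ble by (simp add: A_def)
  have A0: "0 \<le> A" using p by (simp add: A_def)
  define s where "s = real (m + m') * p"
  have s: "0 \<le> s" "s \<le> 2 * W * (q * p)"
  proof -
    show "0 \<le> s" using p by (simp add: s_def)
    have "real m \<le> W * q" "real m' \<le> W * q" using W q by (simp_all add: pos_divide_le_eq)
    then have "real (m + m') * p \<le> (2 * W * q) * p" using p by (intro mult_right_mono) auto
    then show "s \<le> 2 * W * (q * p)" by (simp add: s_def mult_ac)
  qed
  have "1 - s \<le> (1 - p) ^ (m + m')"
    using Bernoulli_inequality[of "-p" "m + m'"] p by (simp add: s_def)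
  then have "A * (1 - s) \<le> A * (1 - p) ^ (m + m')" using A0 by (rule mult_left_mono)
  also have "\<dots> \<le> bindiff p m m' (int r)"
    using bindiff_lower_choose[OF p, of m r m'] by (simp add: A_def)
  finally have lo: "A - A * s \<le> bindiff p m m' (int r)" by (simp add: right_diff_distrib)
  have "A * s \<le> (B * W ^ r) * (2 * W * (q * p))"
  proof (rule mult_mono)
    show "A \<le> B * W ^ r" using Ble mult_left_mono[OF power_mono[OF w(2,1), of r] B0] by linarith
    show "0 \<le> B * W ^ r" using B0 w by simp
  qed (use s in auto)
  moreover have "B * w ^ r - B * (w - real r / q) ^ r \<le> B * (real r * W ^ (r - 1) * (real r / q))"
  proof -
    have "w ^ r - (w - real r / q) ^ r \<le> real r * W ^ (r - 1) * \<bar>w - (w - real r / q)\<bar>"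
    proof (rule order.trans[OF abs_ge_self power_diff_le])
      have "0 \<le> real r / q" using q by simp
      then show "w - real r / q \<le> W" using w by linarith
    qed (use w in auto)
    then have "B * (w ^ r - (w - real r / q) ^ r) \<le> B * (real r * W ^ (r - 1) * (real r / q))"
      using B0 q by (intro mult_left_mono) auto
    then show ?thesis by (simp add: right_diff_distrib)
  qed
  ultimately have "B * w ^ r - bindiff p m m' (int r) \<le> B * (real r * W ^ (r - 1) * (real r / q) + W ^ r * (2 * W * (q * p)))"
    using lo Bge by (simp add: algebra_simps)
  moreover have "0 \<le> B * (real r * W ^ (r - 1) * (real r / q) + W ^ r * (2 * W * (q * p)))"
    using B0 w p q by (intro mult_nonneg_nonneg add_nonneg_nonneg) auto
  ultimately show ?thesis using up unfolding w_def[symmetric] B_def[symmetric] by (simp add: abs_le_iff)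
qed

context setting
begin

abbreviation "crit \<equiv> of_bool (reg = Critical) :: real"
abbreviation "ahead_mean S kk n \<equiv> real (n_W a n) * bindiff (p n) (kk S + a S n) (kk (other S) + a (other S) n) (int r)"
abbreviation "xpos kk n \<equiv> real (kk Red + kk Black) / q n"
abbreviation "gap kk n \<equiv> \<bar>real (kk Red) / q n - fc Red (xpos kk n)\<bar>"
abbreviation "seed_err S n \<equiv> \<bar>real (a S n) / q n - \<alpha> S\<bar>"

lemma seed_err_lim: "seed_err S \<longlonglongrightarrow> 0"
  using tendsto_rabs[OF LIM_zero[OF seeds_lim[of S]]] by simp

text \<open>The rescaled counts and the components of the solution both add up to
  \<open>xpos\<close>, so the errors of the two colors are opposite and one of them measures
  both.\<close>

lemma gap_color:
  assumes "0 < q n" "0 \<le> K" "ereal K < \<kappa>\<^sub>f" "real (kk Red + kk Black) \<le> K * q n"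
  shows "0 \<le> xpos kk n" "xpos kk n \<le> K" "ereal (xpos kk n) < \<kappa>\<^sub>f" "\<bar>real (kk S) / q n - fc S (xpos kk n)\<bar> = gap kk n"
    "real (kk S) / q n \<le> K" "0 \<le> fc S (xpos kk n)" "fc S (xpos kk n) \<le> K"
proof -
  show x0: "0 \<le> xpos kk n" using assms by simp
  show xK: "xpos kk n \<le> K" using assms by (simp only: pos_divide_le_eq)
  show xk: "ereal (xpos kk n) < \<kappa>\<^sub>f" by (rule domain_mono[OF xK assms(3)])
  have s: "fc Red (xpos kk n) + fc Black (xpos kk n) = xpos kk n" by (rule fc_sum[OF x0 xk])
  have t: "xpos kk n = real (kk Red) / q n + real (kk Black) / q n" by (simp only: of_nat_add add_divide_distrib)
  have "real (kk Black) / q n - fc Black (xpos kk n) = - (real (kk Red) / q n - fc Red (xpos kk n))"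
    using s t by linarith
  then have bl: "\<bar>real (kk Black) / q n - fc Black (xpos kk n)\<bar> = gap kk n"
    by (simp only: abs_minus_cancel)
  show "\<bar>real (kk S) / q n - fc S (xpos kk n)\<bar> = gap kk n"
    by (cases S) (simp_all only: bl)
  have nn: "0 \<le> real (kk S) / q n" for S using assms by simp
  have "real (kk S) / q n \<le> xpos kk n"
  proof (cases S)
    case Red
    show ?thesis unfolding Red using t nn[of Black] by linarith
  next
    case Black
    show ?thesis unfolding Black using t nn[of Red] by linarith
  qed
  then show "real (kk S) / q n \<le> K" using xK by simp
  show "0 \<le> fc S (xpos kk n)" by (rule fc_nonneg[OF x0 xk])
  show "fc S (xpos kk n) \<le> K"
  proof (cases S)
    case Red
    show ?thesis unfolding Red using s xK fc_nonneg[OF x0 xk, of Black] by linarith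
  next
    case Black
    show ?thesis unfolding Black using s xK fc_nonneg[OF x0 xk, of Red] by linarith
  qed
qed

text \<open>Uniform over all counts in the tube: an error \<open>\<epsilon>\<close> that can be made
  small and one that is Lipschitz in the distance to the solution. The term with \<open>crit\<close>
  removes the active nodes, which for \<open>Critical\<close> are of the same order as the
  susceptible ones.\<close>

definition approx_at :: "real \<Rightarrow> real \<Rightarrow> real \<Rightarrow> real \<Rightarrow> nat \<Rightarrow> bool" where
  "approx_at K L \<eta> \<epsilon> n \<longleftrightarrow> (\<forall>kk S. real (kk Red + kk Black) \<le> K * q n \<longrightarrow> gap kk n \<le> \<eta> \<longrightarrow>
     \<bar>ahead_mean S kk n / scale n - crit * (real (kk S) / q n) - bet S (xpos kk n)\<bar> \<le> \<epsilon> + L * gap kk n)"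

abbreviation "Wb K \<equiv> K + \<alpha> Red + 1"

section \<open>Regimes with polynomial rates\<close>

lemma seeds_ev:
  assumes "0 \<le> K"
  shows "\<forall>\<^sub>F n in sequentially. \<forall>kk S. real (kk Red + kk Black) \<le> K * q n \<longrightarrow> real (kk S + a S n) / q n \<le> Wb K"
proof -
  have e: "\<forall>\<^sub>F n in sequentially. real (a S n) / q n < \<alpha> Red + 1" for S
    by (rule order_tendstoD(2)[OF seeds_lim]) (use \<alpha>_less in \<open>cases S; simp\<close>)
  show ?thesis
    using e[of Red] e[of Black] q_pos
  proof eventually_elim
    fix n assume h: "real (a Red n) / q n < \<alpha> Red + 1" "real (a Black n) / q n < \<alpha> Red + 1" "0 < q n"
    show "\<forall>kk S. real (kk Red + kk Black) \<le> K * q n \<longrightarrow> real (kk S + a S n) / q n \<le> Wb K"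
    proof (intro allI impI)
      fix kk :: "color \<Rightarrow> nat" and S assume k: "real (kk Red + kk Black) \<le> K * q n"
      have "real (kk S) \<le> K * q n" using k by (cases S) auto
      then have "real (kk S) / q n \<le> K" using h by (simp add: pos_divide_le_eq)
      moreover have "real (a S n) / q n < \<alpha> Red + 1" using h by (cases S) auto
      ultimately show "real (kk S + a S n) / q n \<le> Wb K" by (simp add: add_divide_distrib)
    qed
  qed
qed

text \<open>Holds because \<open>q\<close> tends to infinity. It supplies the condition
  \<open>r \<le> m\<close> of \<open>bindiff_power_approx\<close> from the seeds alone.\<close>

lemma seeds_ge_r: "\<forall>\<^sub>F n in sequentially. r \<le> a S n"
proof -
  have "(\<lambda>n. real (a S n) / q n - real r * (1 / q n)) \<longlonglongrightarrow> \<alpha> S - real r * 0"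
    by (intro tendsto_intros seeds_lim inv_q)
  then have "\<forall>\<^sub>F n in sequentially. 0 < real (a S n) / q n - real r * (1 / q n)"
    by (rule order_tendstoD(1)) (use \<alpha>_pos in simp)
  then show ?thesis using q_pos
    by eventually_elim (simp add: diff_divide_distrib[symmetric] zero_less_divide_iff)
qed

text \<open>Treats \<open>Critical\<close> and \<open>Intermediate\<close>, where
  \<open>q * p\<close> tends to 0 and to leading order exactly \<open>r\<close> edges make a node
  susceptible. Five comparisons are chained: the binomial probability, the constant
  \<open>c\<close>, the seeds, the position relative to the solution, and the active nodes; the last
  accounts for \<open>+ 1\<close> in the Lipschitz constant.\<close>

lemma approx_polynomial:
  assumes K: "0 \<le> K" "ereal K < \<kappa>\<^sub>f" and \<epsilon>: "0 < \<epsilon>"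
    and c: "0 \<le> c" "(\<lambda>n. real (n_W a n) * (q n * p n) ^ r / (scale n * fact r)) \<longlonglongrightarrow> c"
    and qp: "(\<lambda>n. q n * p n) \<longlonglongrightarrow> 0"
    and bet: "\<And>S x. bet S x = c * (fc S x + \<alpha> S) ^ r - crit * fc S x"
  shows "\<forall>\<^sub>F n in sequentially. approx_at K (c * (real r * Wb K ^ (r - 1)) + 1) 1 \<epsilon> n"
proof -
  let ?W = "Wb K" and ?cc = "\<lambda>n. real (n_W a n) * (q n * p n) ^ r / (scale n * fact r)"
  let ?D = "real r * ?W ^ (r - 1)"
  let ?err = "\<lambda>n. ?D * (real r / q n) + ?W ^ r * (2 * ?W * (q n * p n))"
  let ?E = "\<lambda>n. ?cc n * ?err n + \<bar>?cc n - c\<bar> * ?W ^ r + c * (?D * (seed_err Red n + seed_err Black n))"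
  have W0: "0 \<le> ?W" using K \<alpha>_pos[of Red] by simp
  have "?E \<longlonglongrightarrow> c * (?D * (real r * 0) + ?W ^ r * (2 * ?W * 0)) + \<bar>c - c\<bar> * ?W ^ r + c * (?D * (0 + 0))"
  proof (intro tendsto_add tendsto_mult tendsto_const tendsto_rabs tendsto_diff c qp seed_err_lim)
    show "(\<lambda>n. real r / q n) \<longlonglongrightarrow> real r * 0" using tendsto_mult[OF tendsto_const inv_q, of "real r"] by simp
  qed
  then have "?E \<longlonglongrightarrow> 0" by simp
  then have "\<forall>\<^sub>F n in sequentially. ?E n < \<epsilon>" by (rule order_tendstoD(2)) (rule \<epsilon>)
  then show ?thesis
    using q_pos scale_pos ev_ge[of 1] seeds_ev[OF K(1)] seeds_ge_r[of Red] seeds_ge_r[of Black]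
  proof eventually_elim
    case (elim n)
    have p: "0 \<le> p n" "p n \<le> 1" using p01[of n] elim by auto
    show ?case unfolding approx_at_def
    proof (intro allI impI)
      fix kk :: "color \<Rightarrow> nat" and S
      assume k: "real (kk Red + kk Black) \<le> K * q n" and "gap kk n \<le> 1"
      let ?x = "xpos kk n" and ?m = "kk S + a S n" and ?m' = "kk (other S) + a (other S) n"
      let ?w = "real ?m / q n" and ?v = "real (kk S) / q n + \<alpha> S"
      note g = gap_color[OF elim(2) K k]
      have w: "?w \<le> ?W" "real ?m' / q n \<le> ?W" using elim(5) k by blast+
      have w0: "0 \<le> ?w" using elim by simp
      have rm: "1 \<le> r" "r \<le> ?m" using r2 elim by (cases S; simp)+
      have aS: "\<alpha> S \<le> \<alpha> Red" using \<alpha>_less by (cases S) auto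
      have v: "0 \<le> ?v" "?v \<le> ?W" using g(5)[of S] \<alpha>_pos[of S] aS elim by auto
      have u: "0 \<le> fc S ?x + \<alpha> S" "fc S ?x + \<alpha> S \<le> ?W" using g(6,7)[of S] \<alpha>_pos[of S] aS by linarith+
      have cc0: "0 \<le> ?cc n" using elim p by (intro divide_nonneg_pos mult_nonneg_nonneg zero_le_power) auto
      have "real (n_W a n) / scale n * \<bar>bindiff (p n) ?m ?m' (int r) - (q n * p n) ^ r / fact r * ?w ^ r\<bar>
          \<le> real (n_W a n) / scale n * ((q n * p n) ^ r / fact r * ?err n)"
        by (intro mult_left_mono bindiff_power_approx[OF p elim(2) w rm]) (use elim in auto)
      also have "\<dots> = ?cc n * ?err n" by simp
      finally have 1: "\<bar>ahead_mean S kk n / scale n - ?cc n * ?w ^ r\<bar> \<le> ?cc n * ?err n"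
      proof -
        assume h: "real (n_W a n) / scale n * \<bar>bindiff (p n) ?m ?m' (int r) - (q n * p n) ^ r / fact r * ?w ^ r\<bar> \<le> ?cc n * ?err n"
        have "ahead_mean S kk n / scale n - ?cc n * ?w ^ r
            = real (n_W a n) / scale n * (bindiff (p n) ?m ?m' (int r) - (q n * p n) ^ r / fact r * ?w ^ r)"
          by (simp add: right_diff_distrib)
        then have "\<bar>ahead_mean S kk n / scale n - ?cc n * ?w ^ r\<bar>
            = real (n_W a n) / scale n * \<bar>bindiff (p n) ?m ?m' (int r) - (q n * p n) ^ r / fact r * ?w ^ r\<bar>"
          using elim(3) by (simp only: abs_mult) simp
        then show ?thesis using h by simp
      qed
      have 2: "\<bar>?cc n * ?w ^ r - c * ?w ^ r\<bar> \<le> \<bar>?cc n - c\<bar> * ?W ^ r"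
      proof -
        have "\<bar>?cc n * ?w ^ r - c * ?w ^ r\<bar> = \<bar>?cc n - c\<bar> * ?w ^ r"
          using w0 by (simp only: left_diff_distrib[symmetric] abs_mult abs_of_nonneg[OF zero_le_power[OF w0]])
        also have "\<dots> \<le> \<bar>?cc n - c\<bar> * ?W ^ r" using w w0 by (intro mult_left_mono power_mono) auto
        finally show ?thesis .
      qed
      have wv: "\<bar>?w - ?v\<bar> \<le> seed_err Red n + seed_err Black n"
        by (cases S) (simp_all add: add_divide_distrib)
      have 3: "\<bar>c * ?w ^ r - c * ?v ^ r\<bar> \<le> c * (?D * (seed_err Red n + seed_err Black n))"
      proof -
        have "\<bar>?w ^ r - ?v ^ r\<bar> \<le> ?D * \<bar>?w - ?v\<bar>" by (rule power_diff_le[OF w0 w(1) v])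
        also have "\<dots> \<le> ?D * (seed_err Red n + seed_err Black n)" using W0 wv by (intro mult_left_mono) auto
        finally show ?thesis using c(1) by (simp only: right_diff_distrib[symmetric] abs_mult abs_of_nonneg mult_left_mono)
      qed
      have vu: "\<bar>?v - (fc S ?x + \<alpha> S)\<bar> = gap kk n" using g(4)[of S] by simp
      have 4: "\<bar>c * ?v ^ r - c * (fc S ?x + \<alpha> S) ^ r\<bar> \<le> c * (?D * gap kk n)"
      proof -
        have "\<bar>?v ^ r - (fc S ?x + \<alpha> S) ^ r\<bar> \<le> ?D * \<bar>?v - (fc S ?x + \<alpha> S)\<bar>" by (rule power_diff_le[OF v u])
        then have "\<bar>?v ^ r - (fc S ?x + \<alpha> S) ^ r\<bar> \<le> ?D * gap kk n" unfolding vu .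
        then show ?thesis using c(1) by (simp only: right_diff_distrib[symmetric] abs_mult abs_of_nonneg mult_left_mono)
      qed
      have 5: "\<bar>crit * (real (kk S) / q n) - crit * fc S ?x\<bar> \<le> gap kk n"
        using g(4)[of S] by (cases "reg = Critical") auto
      have "\<bar>ahead_mean S kk n / scale n - crit * (real (kk S) / q n) - bet S ?x\<bar>
          \<le> ?E n + c * (?D * gap kk n) + gap kk n"
        unfolding bet using abs_diff_chain5[OF 1 2 3 4 5] by (simp only: add.assoc)
      also have "\<dots> \<le> \<epsilon> + (c * ?D + 1) * gap kk n" using elim(1) by (simp add: algebra_simps)
      finally show "\<bar>ahead_mean S kk n / scale n - crit * (real (kk S) / q n) - bet S ?x\<bar> \<le> \<epsilon> + (c * ?D + 1) * gap kk n" .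
    qed
  qed
qed

lemma approx_Critical:
  assumes reg: "reg = Critical" and K: "0 \<le> K" "ereal K < \<kappa>\<^sub>f" and \<epsilon>: "0 < \<epsilon>"
  shows "\<forall>\<^sub>F n in sequentially. approx_at K (C\<^sub>0 / fact r * (real r * Wb K ^ (r - 1)) + 1) 1 \<epsilon> n"
proof (rule approx_polynomial[OF K \<epsilon>])
  show "0 \<le> C\<^sub>0 / fact r" using C0_pos by simp
  have "(\<lambda>n. real (n_W a n) / real n * (C\<^sub>0 / fact r)) \<longlonglongrightarrow> 1 * (C\<^sub>0 / fact r)"
    by (intro tendsto_intros nW_over_n)
  moreover have "\<forall>\<^sub>F n in sequentially. real (n_W a n) / real n * (C\<^sub>0 / fact r) = real (n_W a n) * (q n * p n) ^ r / (scale n * fact r)"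
    using q_pos ev_ge[of 1]
  proof eventually_elim
    fix n :: nat assume n: "0 < q n" "1 \<le> n"
    have "(q n * p n) ^ r = C\<^sub>0 * q n / real n" using Critical_ratio[OF reg n(2)] n by (simp add: eq_divide_eq mult.commute)
    moreover have "scale n = q n" unfolding scale_def using reg by simp
    ultimately show "real (n_W a n) / real n * (C\<^sub>0 / fact r) = real (n_W a n) * (q n * p n) ^ r / (scale n * fact r)"
      using n by simp
  qed
  ultimately show "(\<lambda>n. real (n_W a n) * (q n * p n) ^ r / (scale n * fact r)) \<longlonglongrightarrow> C\<^sub>0 / fact r"
    by (rule tendsto_eq_ev) simp
  show "(\<lambda>n. q n * p n) \<longlonglongrightarrow> 0" using qp_lim reg by blast
  fix S x
  \<comment> \<open>Identifies the constant of \<open>G_power\<close> with the coefficient in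
    \<open>beta\<close>.\<close>
  have "(fact r :: real) = real r * fact (r - 1)" using r2 by (subst fact_reduce) auto
  then have "C\<^sub>0 / fact r = 1 / real r * (1 - 1 / real r) ^ (r - 1)" using r2 by simp
  moreover have "crit = 1" using reg by simp
  ultimately show "bet S x = C\<^sub>0 / fact r * (fc S x + \<alpha> S) ^ r - crit * fc S x"
    using bet_Critical[OF reg] by simp
qed

lemma approx_Intermediate:
  assumes reg: "reg = Intermediate" and K: "0 \<le> K" "ereal K < \<kappa>\<^sub>f" and \<epsilon>: "0 < \<epsilon>"
  shows "\<forall>\<^sub>F n in sequentially. approx_at K (1 / fact r * (real r * Wb K ^ (r - 1)) + 1) 1 \<epsilon> n"
proof (rule approx_polynomial[OF K \<epsilon>])
  have "(\<lambda>n. real (n_W a n) / real n * (1 / fact r)) \<longlonglongrightarrow> 1 * (1 / fact r)"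
    by (intro tendsto_intros nW_over_n)
  moreover have "\<forall>\<^sub>F n in sequentially. real (n_W a n) / real n * (1 / fact r) = real (n_W a n) * (q n * p n) ^ r / (scale n * fact r)"
    using q_pos ev_ge[of 1]
  proof eventually_elim
    fix n :: nat assume n: "0 < q n" "1 \<le> n"
    have "scale n = real n * (q n * p n) ^ r" unfolding scale_def using reg by simp
    then show "real (n_W a n) / real n * (1 / fact r) = real (n_W a n) * (q n * p n) ^ r / (scale n * fact r)"
      using n p01[OF n(2)] by simp
  qed
  ultimately show "(\<lambda>n. real (n_W a n) * (q n * p n) ^ r / (scale n * fact r)) \<longlonglongrightarrow> 1 / fact r"
    by (rule tendsto_eq_ev) simp
  show "(\<lambda>n. q n * p n) \<longlonglongrightarrow> 0" using qp_lim reg by blast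
  fix S x
  have "crit = 0" using reg by simp
  then show "bet S x = 1 / fact r * (fc S x + \<alpha> S) ^ r - crit * fc S x"
    unfolding reg by simp
qed simp

end

section \<open>The regimes \<open>Inverse_p\<close> and \<open>Beyond\<close>, and crowded
  nodes\<close>

context setting
begin

text \<open>Since \<open>q * p = 1\<close>, the Poisson means are the rescaled counts. The constant
  4 is the Lipschitz constant 2 of \<open>hpois\<close> for each color, both colors having the same
  gap.\<close>

lemma approx_Inverse_p:
  assumes reg: "reg = Inverse_p" and K: "0 \<le> K" "ereal K < \<kappa>\<^sub>f" and \<epsilon>: "0 < \<epsilon>"
  shows "\<forall>\<^sub>F n in sequentially. approx_at K 4 1 \<epsilon> n"
proof -
  let ?W = "Wb K" and ?\<rho> = "\<lambda>n. real (n_W a n) / real n"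
  let ?se = "\<lambda>n. seed_err Red n + seed_err Black n"
  let ?E = "\<lambda>n. \<bar>?\<rho> n - 1\<bar> + 8 * ?W * p n + 2 * ?se n"
  have W0: "0 \<le> ?W" using K \<alpha>_pos[of Red] by simp
  have "?E \<longlonglongrightarrow> \<bar>1 - 1\<bar> + 8 * ?W * 0 + 2 * (0 + 0)"
    by (intro tendsto_intros nW_over_n p_lim seed_err_lim)
  then have "?E \<longlonglongrightarrow> 0" by simp
  then have "\<forall>\<^sub>F n in sequentially. ?E n < \<epsilon>" by (rule order_tendstoD(2)) (rule \<epsilon>)
  then show ?thesis
    using q_pos ev_ge[of 1] seeds_ev[OF K(1)]
  proof eventually_elim
    case (elim n)
    have p: "0 < p n" "0 \<le> p n" "p n \<le> 1" using p01[of n] elim by auto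
    have qp: "q n = 1 / p n" using regime reg elim by auto
    have sc: "scale n = real n" unfolding scale_def using reg by simp
    have cr: "crit = 0" using reg by simp
    show ?case unfolding approx_at_def
    proof (intro allI impI)
      fix kk :: "color \<Rightarrow> nat" and S
      assume k: "real (kk Red + kk Black) \<le> K * q n" and "gap kk n \<le> 1"
      let ?x = "xpos kk n" and ?m = "\<lambda>S. kk S + a S n" and ?o = "other S"
      let ?u = "\<lambda>S. fc S ?x + \<alpha> S"
      note g = gap_color[OF elim(2) K k]
      let ?bd = "bindiff (p n) (?m S) (?m ?o) (int r)"
      have mp: "real (?m S') * p n = real (?m S') / q n" for S' by (simp add: qp)
      have w: "real (?m S') * p n \<le> ?W" for S' unfolding mp using elim(4) k by blast
      have u0: "0 \<le> ?u S'" for S' using g(6)[of S'] \<alpha>_pos[of S'] by linarith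
      have bet: "bet S ?x = hpois (int r) (?u S) (?u ?o)" by (rule bet_Inverse_p[OF reg g(1,3)])
      have d: "\<bar>real (?m S') * p n - ?u S'\<bar> \<le> seed_err S' n + gap kk n" for S'
      proof -
        have "real (?m S') * p n = real (kk S') / q n + real (a S' n) / q n"
          unfolding mp by (simp only: of_nat_add add_divide_distrib)
        then show ?thesis using g(4)[of S'] by linarith
      qed
      have 1: "\<bar>?bd - hpois (int r) (real (?m S) * p n) (real (?m ?o) * p n)\<bar> \<le> 8 * ?W * p n"
      proof -
        have "4 * real (?m S + ?m ?o) * (p n)\<^sup>2 = 4 * (real (?m S) * p n + real (?m ?o) * p n) * p n"
          by (simp add: power2_eq_square algebra_simps)
        also have "\<dots> \<le> 4 * (?W + ?W) * p n" using p w by (intro mult_right_mono mult_left_mono add_mono) auto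
        also have "4 * (?W + ?W) * p n = 8 * ?W * p n" by (simp add: algebra_simps)
        finally show ?thesis by (rule order.trans[OF bindiff_poisson[OF p(2,3)]])
      qed
      have se: "seed_err S n + seed_err ?o n = ?se n" by (cases S) auto
      have 2: "\<bar>hpois (int r) (real (?m S) * p n) (real (?m ?o) * p n) - bet S ?x\<bar> \<le> 2 * ?se n + 4 * gap kk n"
        unfolding bet using hpois_Lipschitz[of "real (?m S) * p n" "?u S" "real (?m ?o) * p n" "?u ?o" "int r"] u0[of S] u0[of ?o] p
          d[of S] d[of ?o] se by simp
      have 3: "\<bar>?\<rho> n * ?bd - ?bd\<bar> \<le> \<bar>?\<rho> n - 1\<bar>"
      proof -
        have "\<bar>?\<rho> n * ?bd - ?bd\<bar> = \<bar>?\<rho> n - 1\<bar> * ?bd"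
        proof -
          have "?\<rho> n * ?bd - ?bd = (?\<rho> n - 1) * ?bd" by (simp only: left_diff_distrib mult_1)
          then show ?thesis by (simp only: abs_mult abs_of_nonneg[OF bindiff_nonneg[OF p(2,3)]])
        qed
        also have "\<dots> \<le> \<bar>?\<rho> n - 1\<bar> * 1" using bindiff_le_1[OF p(2,3)] by (intro mult_left_mono) auto
        finally show ?thesis by simp
      qed
      have "\<bar>?\<rho> n * ?bd - bet S ?x\<bar> \<le> ?E n + 4 * gap kk n" using 1 2 3 by linarith
      then have "\<bar>?\<rho> n * ?bd - bet S ?x\<bar> \<le> \<epsilon> + 4 * gap kk n" using elim(1) by linarith
      then show "\<bar>ahead_mean S kk n / scale n - crit * (real (kk S) / q n) - bet S ?x\<bar> \<le> \<epsilon> + 4 * gap kk n"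
        unfolding sc cr by simp
    qed
  qed
qed

text \<open>In the tube the red nodes, seeds included, outnumber the black ones by a multiple of \<open>q\<close>, and
  \<open>q p \<rightarrow> \<infinity>\<close>.\<close>

lemma approx_Beyond:
  assumes reg: "reg = Beyond" and K: "0 \<le> K" "ereal K < \<kappa>\<^sub>f" and \<epsilon>: "0 < \<epsilon>"
  shows "\<forall>\<^sub>F n in sequentially. approx_at K 0 ((\<alpha> Red - \<alpha> Black) / 4) \<epsilon> n"
proof -
  define \<gamma> where "\<gamma> = \<alpha> Red - \<alpha> Black"
  have \<gamma>: "0 < \<gamma>" using \<alpha>_less by (simp add: \<gamma>_def)
  let ?W = "Wb K" and ?\<rho> = "\<lambda>n. real (n_W a n) / real n"
  have W0: "0 < ?W" using K \<alpha>_pos[of Red] by simp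
  \<comment> \<open>With this tilt the quadratic term of the Chernoff exponent is at most half of
    the linear one.\<close>
  define t where "t = min 1 (\<gamma> / (8 * ?W))"
  have t: "0 < t" "t \<le> 1" "t * (2 * ?W) \<le> \<gamma> / 4"
  proof -
    show "0 < t" "t \<le> 1" using \<gamma> W0 by (auto simp: t_def)
    have "t * (2 * ?W) \<le> \<gamma> / (8 * ?W) * (2 * ?W)" using W0 by (intro mult_right_mono) (auto simp: t_def)
    also have "\<dots> = \<gamma> / 4"
    proof -
      have "\<gamma> / (8 * w) * (2 * w) = \<gamma> / 4" if "0 < w" for w :: real using that by simp
      then show ?thesis using W0 .
    qed
    finally show "t * (2 * ?W) \<le> \<gamma> / 4" .
  qed
  let ?tail = "\<lambda>n. exp (real r - (t * \<gamma> / 4) * (q n * p n))"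
  have qp_top: "filterlim (\<lambda>n. q n * p n) at_top sequentially"
  proof -
    have "(\<lambda>n. 1 / p n) \<in> o(q)" using regime reg by simp
    from smalloD_tendsto[OF this] have l: "(\<lambda>n. (1 / p n) / q n) \<longlonglongrightarrow> 0" .
    have "\<forall>\<^sub>F n in sequentially. 0 < (1 / p n) / q n"
      using q_pos ev_ge[of 1] by eventually_elim (use p01 in auto)
    from filterlim_inverse_at_top[OF l this] show ?thesis by (simp add: mult.commute)
  qed
  have tail: "?tail \<longlonglongrightarrow> 0"
  proof -
    have "filterlim (\<lambda>n. (t * \<gamma> / 4) * (q n * p n)) at_top sequentially"
      using t \<gamma> by (intro filterlim_tendsto_pos_mult_at_top[OF tendsto_const _ qp_top]) auto
    then have "filterlim (\<lambda>n. - real r + (t * \<gamma> / 4) * (q n * p n)) at_top sequentially"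
      by (intro filterlim_tendsto_add_at_top[OF tendsto_const])
    then have "filterlim (\<lambda>n. - (- real r + (t * \<gamma> / 4) * (q n * p n))) at_bot sequentially"
      by (simp only: filterlim_uminus_at_top)
    from filterlim_compose[OF exp_at_bot this] show ?thesis by simp
  qed
  let ?E = "\<lambda>n. \<bar>?\<rho> n - 1\<bar> + ?tail n"
  have "?E \<longlonglongrightarrow> \<bar>1 - 1\<bar> + 0" by (intro tendsto_intros nW_over_n tail)
  then have "?E \<longlonglongrightarrow> 0" by simp
  then have EE: "\<forall>\<^sub>F n in sequentially. ?E n < \<epsilon>" by (rule order_tendstoD(2)) (rule \<epsilon>)
  have se: "\<forall>\<^sub>F n in sequentially. seed_err S n < \<gamma> / 8" for S
    by (rule order_tendstoD(2)[OF seed_err_lim]) (use \<gamma> in simp)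
  show ?thesis
    using EE q_pos ev_ge[of 1] seeds_ev[OF K(1)] se[of Red] se[of Black]
  proof eventually_elim
    case (elim n)
    have p: "0 \<le> p n" "p n \<le> 1" using p01[of n] elim by auto
    have sc: "scale n = real n" unfolding scale_def using reg by simp
    have cr: "crit = 0" using reg by simp
    have \<rho>0: "0 \<le> ?\<rho> n" by simp
    show ?case unfolding approx_at_def
    proof (intro allI impI)
      fix kk :: "color \<Rightarrow> nat" and S
      assume k: "real (kk Red + kk Black) \<le> K * q n" and gp: "gap kk n \<le> (\<alpha> Red - \<alpha> Black) / 4"
      let ?x = "xpos kk n" and ?m = "\<lambda>S. kk S + a S n"
      note g = gap_color[OF elim(2) K k]
      have b1: "bet Red ?x = 1" and b0: "bet Black ?x = 0" by (rule Beyond_bet[OF reg g(1,3)])+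
      have f0: "fc Black ?x = 0" by (rule Beyond_fc(2)[OF reg g(1,3)])
      have kB: "real (kk Black) / q n \<le> \<gamma> / 4" using g(4)[of Black] gp f0 unfolding \<gamma>_def by linarith
      have w: "real (?m S') / q n \<le> ?W" for S' using elim(4) k by blast
      define mR where "mR = real (?m Red)"
      define mB where "mB = real (?m Black)"
      have mw: "mR \<le> ?W * q n" "mB \<le> ?W * q n" using w[of Red] w[of Black] elim(2) by (simp_all add: mR_def mB_def pos_divide_le_eq)
      \<comment> \<open>The seeds alone give a rescaled lead of at least
        \<open>3 * \<gamma> / 4\<close>, of which the black activations in the tube take at most
        \<open>\<gamma> / 4\<close>.\<close>
      have diff: "\<gamma> / 2 * q n \<le> mR - mB"
      proof -
        have "0 \<le> real (kk Red) / q n" using elim by simp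
        then have "\<gamma> / 2 \<le> real (kk Red) / q n + real (a Red n) / q n - (real (kk Black) / q n + real (a Black n) / q n)"
        proof -
          have "\<alpha> Red - \<gamma> / 8 < real (a Red n) / q n" "real (a Black n) / q n < \<alpha> Black + \<gamma> / 8"
            using abs_less_iff[THEN iffD1, OF elim(5)] abs_less_iff[THEN iffD1, OF elim(6)] by linarith+
          then show ?thesis using kB \<open>0 \<le> real (kk Red) / q n\<close> \<gamma>_def by linarith
        qed
        also have "\<dots> = (mR - mB) / q n" by (simp add: mR_def mB_def add_divide_distrib diff_divide_distrib)
        finally show ?thesis using elim by (simp add: pos_le_divide_eq)
      qed
      have key: "mR * (p n * (exp (- t) - 1)) + mB * (p n * (exp t - 1)) \<le> - (t * \<gamma> / 4) * (q n * p n)"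
      proof -
        have e: "exp (- t) - 1 \<le> - t + t\<^sup>2" "exp t - 1 \<le> t + t\<^sup>2"
          using exp_le_quadratic[of "-t"] exp_le_quadratic[of t] t by auto
        have "mR * (exp (- t) - 1) + mB * (exp t - 1) \<le> mR * (- t + t\<^sup>2) + mB * (t + t\<^sup>2)"
          using e by (intro add_mono mult_left_mono) (auto simp: mR_def mB_def)
        also have "\<dots> = - (t * (mR - mB)) + t * (t * (mR + mB))" by (simp add: algebra_simps power2_eq_square)
        also have "\<dots> \<le> - (t * (\<gamma> / 2 * q n)) + t * (\<gamma> / 4 * q n)"
        proof (intro add_mono le_imp_neg_le mult_left_mono diff)
          have "mR + mB \<le> ?W * q n + ?W * q n" by (intro add_mono mw)
          then have "t * (mR + mB) \<le> t * (?W * q n + ?W * q n)" using t by (intro mult_left_mono) auto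
          also have "\<dots> = t * (2 * ?W) * q n" by (simp add: algebra_simps)
          also have "\<dots> \<le> \<gamma> / 4 * q n" using t(3) elim by (intro mult_right_mono) auto
          finally show "t * (mR + mB) \<le> \<gamma> / 4 * q n" .
        qed (use t in auto)
        also have "\<dots> = - (t * \<gamma> / 4) * q n" by (simp add: algebra_simps)
        finally have "p n * (mR * (exp (- t) - 1) + mB * (exp t - 1)) \<le> p n * (- (t * \<gamma> / 4) * q n)"
          using p by (intro mult_left_mono)
        then show ?thesis by (simp add: algebra_simps)
      qed
      have tr: "t * real r \<le> real r" using t by (simp add: mult_left_le_one_le)
      have R: "1 - bindiff (p n) (?m Red) (?m Black) (int r) \<le> ?tail n"
      proof -
        have "1 - bindiff (p n) (?m Red) (?m Black) (int r)
            \<le> exp (t * real r) * (exp (mR * (p n * (exp (- t) - 1))) * exp (mB * (p n * (exp t - 1))))"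
          using bindiff_complement_exp[OF p, of t "?m Red" "?m Black" "int r"] t
          by (simp add: exp_of_nat_mult[symmetric] mR_def mB_def)
        also have "\<dots> = exp (t * real r + (mR * (p n * (exp (- t) - 1)) + mB * (p n * (exp t - 1))))"
          by (simp only: exp_add)
        also have "\<dots> \<le> ?tail n" using key tr by simp
        finally show ?thesis .
      qed
      have B: "bindiff (p n) (?m Black) (?m Red) (int r) \<le> ?tail n"
      proof -
        have "bindiff (p n) (?m Black) (?m Red) (int r)
            \<le> exp (- t * real r) * (exp (mB * (p n * (exp t - 1))) * exp (mR * (p n * (exp (- t) - 1))))"
          using bindiff_upper_exp[OF p, of t "?m Black" "?m Red" "int r"] t
          by (simp add: exp_of_nat_mult[symmetric] mR_def mB_def)
        also have "\<dots> = exp (- t * real r + (mR * (p n * (exp (- t) - 1)) + mB * (p n * (exp t - 1))))"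
          by (simp only: exp_add mult_ac)
        also have "\<dots> \<le> ?tail n"
        proof -
          have "0 \<le> t * real r" using t by (intro mult_nonneg_nonneg) auto
          then have "- t * real r \<le> real r" using of_nat_0_le_iff[of r] by linarith
          then show ?thesis using key by simp
        qed
        finally show ?thesis .
      qed
      have "\<bar>?\<rho> n * bindiff (p n) (?m S) (?m (other S)) (int r) - bet S ?x\<bar> \<le> ?E n"
      proof -
        let ?bd = "bindiff (p n) (?m S) (?m (other S)) (int r)"
        have b: "0 \<le> ?bd" "?bd \<le> 1" using bindiff_nonneg[OF p] bindiff_le_1[OF p] by auto
        have "\<bar>?\<rho> n - 1\<bar> * ?bd \<le> \<bar>?\<rho> n - 1\<bar> * 1" using b by (intro mult_left_mono) auto
        then have 1: "\<bar>(?\<rho> n - 1) * ?bd\<bar> \<le> \<bar>?\<rho> n - 1\<bar>" using b by (simp only: abs_mult abs_of_nonneg mult_1_right)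
        have 2: "\<bar>?bd - bet S ?x\<bar> \<le> ?tail n"
        proof (cases S)
          case Red
          show ?thesis using R b unfolding Red other.simps b1 by linarith
        next
          case Black
          show ?thesis using B b unfolding Black other.simps b0 by linarith
        qed
        have "?\<rho> n * ?bd - bet S ?x = (?\<rho> n - 1) * ?bd + (?bd - bet S ?x)" by (simp only: left_diff_distrib)
        then show ?thesis using 1 2 by linarith
      qed
      then have "\<bar>?\<rho> n * bindiff (p n) (?m S) (?m (other S)) (int r) - bet S ?x\<bar> \<le> \<epsilon>" using elim(1) by linarith
      then show "\<bar>ahead_mean S kk n / scale n - crit * (real (kk S) / q n) - bet S ?x\<bar> \<le> \<epsilon> + 0 * gap kk n"
        unfolding sc cr by simp
    qed
  qed
qed

lemma regime_approx:
  assumes K: "0 \<le> K" "ereal K < \<kappa>\<^sub>f"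
  obtains L \<eta> where "0 \<le> L" "0 < \<eta>" "\<And>\<epsilon>. 0 < \<epsilon> \<Longrightarrow> \<forall>\<^sub>F n in sequentially. approx_at K L \<eta> \<epsilon> n"
proof (cases reg)
  case Critical
  have "0 \<le> C\<^sub>0 / fact r * (real r * Wb K ^ (r - 1)) + 1"
    using C0_pos K \<alpha>_pos[of Red] by (intro add_nonneg_nonneg mult_nonneg_nonneg zero_le_power) auto
  then show ?thesis using that zero_less_one approx_Critical[OF Critical K] by blast
next
  case Intermediate
  have "0 \<le> 1 / fact r * (real r * Wb K ^ (r - 1)) + 1"
    using K \<alpha>_pos[of Red] by (intro add_nonneg_nonneg mult_nonneg_nonneg zero_le_power) auto
  then show ?thesis using that zero_less_one approx_Intermediate[OF Intermediate K] by blast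
next
  case Inverse_p
  show ?thesis by (rule that[of 4 1]) (use approx_Inverse_p[OF Inverse_p K] in auto)
next
  case Beyond
  show ?thesis by (rule that[of 0 "(\<alpha> Red - \<alpha> Black) / 4"]) (use approx_Beyond[OF Beyond K] \<alpha>_less in auto)
qed

abbreviation "crowded_mean kk n \<equiv> real (n_W a n) * bindiff (p n) (kk Red + a Red n + (kk Black + a Black n)) 0 (int r + 1)"

text \<open>One more active neighbor costs another factor \<open>q * p\<close>, which tends to 0,
  while \<open>n * (q * p) ^ r\<close> is of order \<open>q\<close> by
  \<open>Critical_ratio\<close>.\<close>

lemma crowded_mean_small:
  assumes reg: "reg = Critical" and K: "0 \<le> K" and \<epsilon>: "0 < \<epsilon>"
  shows "\<forall>\<^sub>F n in sequentially. \<forall>kk. real (kk Red + kk Black) \<le> K * q n \<longrightarrow> crowded_mean kk n \<le> \<epsilon> * scale n"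
proof -
  let ?W = "Wb K"
  have W0: "0 < ?W" using K \<alpha>_pos[of Red] by simp
  have "(\<lambda>n. (2 * ?W) ^ (r + 1) * C\<^sub>0 * (q n * p n)) \<longlonglongrightarrow> (2 * ?W) ^ (r + 1) * C\<^sub>0 * 0"
    using qp_lim reg by (intro tendsto_intros) blast
  then have "\<forall>\<^sub>F n in sequentially. (2 * ?W) ^ (r + 1) * C\<^sub>0 * (q n * p n) < \<epsilon>"
    by (intro order_tendstoD(2)[of _ 0]) (use \<epsilon> in simp_all)
  then show ?thesis
    using q_pos ev_ge[of 1] seeds_ev[OF K]
  proof eventually_elim
    case (elim n)
    have p: "0 \<le> p n" "p n \<le> 1" using p01[of n] elim by auto
    have sc: "scale n = q n" unfolding scale_def using reg by simp
    show ?case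
    proof (intro allI impI)
      fix kk :: "color \<Rightarrow> nat"
      assume k: "real (kk Red + kk Black) \<le> K * q n"
      let ?M = "kk Red + a Red n + (kk Black + a Black n)"
      have w: "real (kk S + a S n) \<le> ?W * q n" for S
        using elim(4) k elim(2) by (auto simp: pos_divide_le_eq)
      have "real ?M = real (kk Red + a Red n) + real (kk Black + a Black n)" by simp
      also have "\<dots> \<le> ?W * q n + ?W * q n" by (intro add_mono w)
      also have "\<dots> = 2 * ?W * q n" by (simp add: algebra_simps)
      finally have M: "real ?M \<le> 2 * ?W * q n" .
      have "bindiff (p n) ?M 0 (int (r + 1)) \<le> real (?M choose (r + 1)) * p n ^ (r + 1)"
        by (rule bindiff_upper_choose[OF p])
      also have "\<dots> \<le> real ?M ^ (r + 1) * p n ^ (r + 1)"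
      proof (rule mult_right_mono)
        have "1 * real (?M choose (r + 1)) \<le> fact (r + 1) * real (?M choose (r + 1))"
          by (intro mult_right_mono fact_ge_1) auto
        then show "real (?M choose (r + 1)) \<le> real ?M ^ (r + 1)" using choose_le_power_fact[of "r + 1" ?M] by linarith
      qed (use p in auto)
      also have "\<dots> \<le> (2 * ?W * q n) ^ (r + 1) * p n ^ (r + 1)"
        using M p by (intro mult_right_mono power_mono) auto
      finally have b: "bindiff (p n) ?M 0 (int r + 1) \<le> (2 * ?W) ^ (r + 1) * (q n * p n) ^ (r + 1)"
        by (simp add: power_mult_distrib mult_ac add.commute)
      have "crowded_mean kk n \<le> real n * ((2 * ?W) ^ (r + 1) * (q n * p n) ^ (r + 1))"
      proof (rule mult_mono[OF _ b])
        show "real (n_W a n) \<le> real n" by (simp add: n_W_def)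
        show "0 \<le> bindiff (p n) ?M 0 (int r + 1)" by (rule bindiff_nonneg[OF p])
      qed auto
      also have "\<dots> = (2 * ?W) ^ (r + 1) * (real n * (q n * p n) ^ r) * (q n * p n)" by (simp add: mult_ac)
      also have "\<dots> = ((2 * ?W) ^ (r + 1) * C\<^sub>0 * (q n * p n)) * q n"
        unfolding Critical_ratio[OF reg elim(3)] by (simp add: mult_ac)
      also have "\<dots> \<le> \<epsilon> * scale n" unfolding sc using elim(1,2) by (intro mult_right_mono) auto
      finally show "crowded_mean kk n \<le> \<epsilon> * scale n" .
    qed
  qed
qed

end

section \<open>Tracking the solution\<close>

lemma abs_diff_chain2:
  fixes x1 :: real
  assumes "\<bar>x1 - x2\<bar> \<le> e" "\<bar>x2 - y - b\<bar> \<le> e + g" "\<bar>s - (x1 - y)\<bar> \<le> 2 * e"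
  shows "\<bar>s - b\<bar> \<le> 4 * e + g"
  using assms by linarith

text \<open>Over a common denominator the numerator is
  \<open>(s1 - b1) * b2 - (s2 - b2) * b1\<close>. So \<open>b1 + b2\<close> cancels, and the
  perturbed denominator is at least \<open>\<delta> / 2\<close>.\<close>

lemma ratio_perturb:
  fixes s1 s2 b1 b2 :: real
  assumes "\<bar>s1 - b1\<bar> \<le> \<Delta>" "\<bar>s2 - b2\<bar> \<le> \<Delta>" "0 \<le> b1" "0 \<le> b2" "\<delta> \<le> b1 + b2" "0 < \<delta>" "\<Delta> \<le> \<delta> / 4"
  shows "0 < s1 + s2" "\<bar>s1 / (s1 + s2) - b1 / (b1 + b2)\<bar> \<le> 2 * \<Delta> / \<delta>"
proof -
  have s: "\<delta> / 2 \<le> s1 + s2" using assms by linarith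
  then show s0: "0 < s1 + s2" using assms by linarith
  have b0: "0 < b1 + b2" using assms by linarith
  have "s1 / (s1 + s2) - b1 / (b1 + b2) = ((s1 - b1) * b2 - (s2 - b2) * b1) / ((s1 + s2) * (b1 + b2))"
    using s0 b0 by (simp add: field_simps)
  also have "\<bar>\<dots>\<bar> = \<bar>(s1 - b1) * b2 - (s2 - b2) * b1\<bar> / ((s1 + s2) * (b1 + b2))"
    using s0 b0 by (simp add: abs_divide abs_mult)
  also have "\<dots> \<le> (\<Delta> * (b1 + b2)) / ((s1 + s2) * (b1 + b2))"
  proof (rule divide_right_mono)
    have "\<bar>(s1 - b1) * b2 - (s2 - b2) * b1\<bar> \<le> \<bar>(s1 - b1) * b2\<bar> + \<bar>(s2 - b2) * b1\<bar>" by (rule abs_triangle_ineq4)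
    also have "\<dots> \<le> \<Delta> * b2 + \<Delta> * b1"
      unfolding abs_mult using assms by (intro add_mono mult_mono) auto
    finally show "\<bar>(s1 - b1) * b2 - (s2 - b2) * b1\<bar> \<le> \<Delta> * (b1 + b2)" by (simp add: algebra_simps)
  qed (use s0 b0 in auto)
  also have "\<dots> = \<Delta> / (s1 + s2)" using b0 by simp
  also have "\<dots> \<le> \<Delta> / (\<delta> / 2)" using assms s by (intro divide_left_mono mult_pos_pos) auto
  finally show "\<bar>s1 / (s1 + s2) - b1 / (b1 + b2)\<bar> \<le> 2 * \<Delta> / \<delta>" by (simp add: mult.commute)
qed

lemma interpolate_close:
  assumes "0 \<le> y" and m: "N k \<le> N (Suc k)" "N (Suc k) \<le> Suc (N k)" and k: "k = nat \<lfloor>y\<rfloor>"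
  shows "\<bar>interpolate N y - real (N k)\<bar> \<le> 1"
proof (cases "real_of_int \<lfloor>y\<rfloor> = y")
  case True
  then have "\<lceil>y\<rceil> = \<lfloor>y\<rfloor>" by (metis ceiling_of_int)
  then show ?thesis using True by (simp add: interpolate_def k)
next
  case False
  then have c: "\<lceil>y\<rceil> = \<lfloor>y\<rfloor> + 1" by (metis ceiling_altdef)
  have "nat \<lceil>y\<rceil> = Suc k" unfolding c k using assms(1) by (simp add: nat_add_distrib)
  then have "interpolate N y - real (N k) = (y - real_of_int \<lfloor>y\<rfloor>) * (real (N (Suc k)) - real (N k))"
    by (simp add: interpolate_def k)
  also have "\<bar>\<dots>\<bar> \<le> 1 * 1"
    unfolding abs_mult
  proof (rule mult_mono)
    show "\<bar>y - real_of_int \<lfloor>y\<rfloor>\<bar> \<le> 1" by linarith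
    show "\<bar>real (N (Suc k)) - real (N k)\<bar> \<le> 1" using m by linarith
  qed auto
  finally show ?thesis by simp
qed

section \<open>Deterministic tracking on a good event\<close>

context setting
begin

abbreviation "sus_n n E \<equiv> percolation.sus r (n_W a n) (\<lambda>S. a S n) E"

text \<open>All that tracking needs from the randomness, besides edges being 0 or 1: counts close to
  their means throughout the tube, and small deviations up to the horizon.\<close>

definition concentrated :: "real \<Rightarrow> real \<Rightarrow> real \<Rightarrow> nat \<Rightarrow> (color \<Rightarrow> nat \<Rightarrow> nat \<Rightarrow> real) \<Rightarrow> (nat \<Rightarrow> real set) \<Rightarrow> bool" where
  "concentrated K \<eta> \<epsilon> n E ring \<longleftrightarrow>
     (\<forall>kk S. real (kk Red + kk Black) \<le> K * q n \<longrightarrow> gap kk n \<le> \<eta> \<longrightarrow>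
        \<bar>real (card (percolation.ahead r (n_W a n) E S (kk S + a S n) (kk (other S) + a (other S) n))) - ahead_mean S kk n\<bar> < \<epsilon> * scale n)
   \<and> (reg = Critical \<longrightarrow> (\<forall>kk. real (kk Red + kk Black) \<le> K * q n \<longrightarrow>
        \<bar>real (card (percolation.crowded r (n_W a n) E (kk Red + a Red n) (kk Black + a Black n))) - crowded_mean kk n\<bar> < \<epsilon> * scale n))
   \<and> (\<forall>k. real k \<le> K * q n \<longrightarrow> \<bar>deviation (sus_n n E) ring (\<lambda>_. {}) k\<bar> < \<epsilon> * q n)"

text \<open>Controls what separates \<open>sus\<close> from the difference that
  \<open>approx_at\<close> describes: crowded nodes for \<open>Critical\<close>, active nodes
  otherwise.\<close>

definition negligible :: "real \<Rightarrow> real \<Rightarrow> nat \<Rightarrow> bool" where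
  "negligible K \<epsilon> n \<longleftrightarrow> (if reg = Critical then \<forall>kk. real (kk Red + kk Black) \<le> K * q n \<longrightarrow> crowded_mean kk n \<le> \<epsilon> * scale n
     else K * q n \<le> \<epsilon> * scale n)"

lemma ev_negligible:
  assumes K: "0 \<le> K" and \<epsilon>: "0 < \<epsilon>"
  shows "\<forall>\<^sub>F n in sequentially. negligible K \<epsilon> n"
proof (cases "reg = Critical")
  case True
  show ?thesis using crowded_mean_small[OF True K \<epsilon>] by eventually_elim (unfold negligible_def, use True in simp)
next
  case False
  have "(\<lambda>n. K * (q n / scale n)) \<longlonglongrightarrow> K * 0" by (intro tendsto_intros q_over_scale False)
  then have "\<forall>\<^sub>F n in sequentially. K * (q n / scale n) < \<epsilon>" by (rule order_tendstoD(2)) (use \<epsilon> in simp)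
  then show ?thesis using scale_pos
    by eventually_elim (use False in \<open>auto simp: negligible_def field_simps\<close>)
qed

text \<open>\<open>4 * \<epsilon>\<close> consists of one \<open>\<epsilon>\<close> for
  concentration, one for the mean and two for the crowded or active nodes. As the sum of the
  limiting \<open>beta\<close> is at least \<open>\<delta>\<close>, such closeness also leaves
  available nodes, so the process has not stopped.\<close>

lemma step_estimate:
  fixes E :: "color \<Rightarrow> nat \<Rightarrow> nat \<Rightarrow> real" and ring :: "nat \<Rightarrow> real set" and k n :: nat
  defines "A \<equiv> sus_n n E"
  defines "C \<equiv> run A ring (\<lambda>_. {}) k"
  defines "d \<equiv> \<bar>real (card (C Red)) / q n - fc Red (real k / q n)\<bar>"
  assumes K: "0 \<le> K" "ereal K < \<kappa>\<^sub>f" and \<delta>: "0 < \<delta>" "\<And>x. x \<in> {0..K} \<Longrightarrow> \<delta> \<le> bet Red x + bet Black x"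
    and L: "0 \<le> L" and \<epsilon>: "0 < \<epsilon>" and small: "4 * \<epsilon> + L * \<eta> \<le> \<delta> / 4"
    and n: "0 < q n" "0 < scale n"
    and E01: "\<And>S v i. v < n_W a n \<Longrightarrow> 1 \<le> i \<Longrightarrow> E S v i = 0 \<or> E S v i = 1"
    and conc: "concentrated K \<eta> \<epsilon> n E ring" and appr: "approx_at K L \<eta> \<epsilon> n" and neg: "negligible K \<epsilon> n"
    and k: "real k \<le> K * q n" and G: "\<And>j. j < k \<Longrightarrow> avail A (run A ring (\<lambda>_. {}) j) \<noteq> {}"
    and d: "d \<le> \<eta>"
  shows "avail A C \<noteq> {}" "\<bar>red_rate A C - rate (real k / q n)\<bar> \<le> 2 * (4 * \<epsilon> + L * d) / \<delta>"
proof -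
  interpret P: percolation01 r "n_W a n" "\<lambda>S. a S n" ring E "\<lambda>_. 0"
    using E01 r2 by unfold_locales auto
  define kk where "kk S = card (C S)" for S
  have tot: "kk Red + kk Black = k"
    unfolding kk_def C_def A_def by (rule P.card_nat_run) (use G in \<open>simp add: A_def\<close>)
  have x: "xpos kk n = real k / q n" by (simp only: tot)
  have gd: "gap kk n = d" unfolding x d_def by (simp only: kk_def)
  have ktot: "real (kk Red + kk Black) \<le> K * q n" using k tot by simp
  note g = gap_color[OF n(1) K ktot, unfolded x]
  have xK: "real k / q n \<in> {0..K}" using g(1,2) by simp
  have CV: "C Red \<union> C Black \<subseteq> P.VW" unfolding C_def A_def using P.nat_run_subset by blast
  define s where "s S = real (card (A C S)) / scale n" for S
  have s_near: "\<bar>s S - bet S (real k / q n)\<bar> \<le> 4 * \<epsilon> + L * d" for S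
  proof -
    define T where "T = P.ahead S (card (C S) + a S n) (card (C (other S)) + a (other S) n)"
    have 1: "\<bar>real (card T) / scale n - ahead_mean S kk n / scale n\<bar> \<le> \<epsilon>"
    proof -
      have "\<bar>real (card T) - ahead_mean S kk n\<bar> < \<epsilon> * scale n"
        using conc ktot gd d unfolding concentrated_def T_def kk_def[symmetric] by auto
      then have "\<bar>real (card T) - ahead_mean S kk n\<bar> / scale n \<le> \<epsilon>" using n by (simp add: pos_divide_le_eq)
      then show ?thesis using n by (simp add: diff_divide_distrib[symmetric] abs_divide)
    qed
    have 2: "\<bar>ahead_mean S kk n / scale n - crit * (real (kk S) / q n) - bet S (real k / q n)\<bar> \<le> \<epsilon> + L * d"
      using appr ktot gd d unfolding approx_at_def x[symmetric] by auto
    have 3: "\<bar>s S - (real (card T) / scale n - crit * (real (kk S) / q n))\<bar> \<le> 2 * \<epsilon>"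
    proof (cases "reg = Critical")
      case True
      then have c: "crit = 1" and sc: "scale n = q n" by (simp, unfold scale_def, simp)
      define Z where "Z = P.crowded (card (C Red) + a Red n) (card (C Black) + a Black n)"
      have "\<bar>real (card Z) - crowded_mean kk n\<bar> < \<epsilon> * scale n"
        using conc ktot True unfolding concentrated_def Z_def kk_def[symmetric] by blast
      moreover have "crowded_mean kk n \<le> \<epsilon> * scale n"
        using neg ktot True unfolding negligible_def by auto
      ultimately have Z: "real (card Z) \<le> 2 * \<epsilon> * scale n" by linarith
      have "\<bar>real (card (A C S)) - (real (card T) - real (kk S))\<bar> \<le> real (card Z)"
        using P.sus_card_crowded[of k S] unfolding T_def Z_def kk_def C_def A_def .
      then have "\<bar>real (card (A C S)) - (real (card T) - real (kk S))\<bar> / scale n \<le> 2 * \<epsilon>"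
        using Z n by (simp add: pos_divide_le_eq)
      moreover have "s S - (real (card T) / scale n - crit * (real (kk S) / q n)) = (real (card (A C S)) - (real (card T) - real (kk S))) / scale n"
        unfolding c s_def sc[symmetric] by (simp add: diff_divide_distrib)
      ultimately show ?thesis using n by (simp add: abs_divide)
    next
      case False
      then have c: "crit = 0" by simp
      have b: "card (A C S) \<le> card T" "card T \<le> card (A C S) + (card (C Red) + card (C Black))"
        using P.sus_card_bounds[OF CV, of S] unfolding T_def A_def by auto
      have "real k \<le> \<epsilon> * scale n" using k neg False unfolding negligible_def by simp
      then have "\<bar>real (card (A C S)) - real (card T)\<bar> \<le> \<epsilon> * scale n"
        using b tot unfolding kk_def by linarith
      then have "\<bar>real (card (A C S)) - real (card T)\<bar> / scale n \<le> \<epsilon>" using n by (simp add: pos_divide_le_eq)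
      then have "\<bar>s S - real (card T) / scale n\<bar> \<le> \<epsilon>"
        using n by (simp add: s_def diff_divide_distrib[symmetric] abs_divide)
      then show ?thesis unfolding c using \<epsilon> by simp
    qed
    show ?thesis by (rule abs_diff_chain2[OF 1 2 3])
  qed
  have bn: "0 \<le> bet S (real k / q n)" for S by (rule bet_nonneg_sum_pos[OF g(1,3)])
  have "L * d \<le> L * \<eta>" using d L by (rule mult_left_mono)
  then have D: "4 * \<epsilon> + L * d \<le> \<delta> / 4" using small by linarith
  note rp = ratio_perturb[OF s_near[of Red] s_near[of Black] bn bn \<delta>(2)[OF xK] \<delta>(1) D]
  have disj: "A C Red \<inter> A C Black = {}"
    using r2 by (auto simp: A_def P.sus_def P.ahead_def split: if_splits)
  have fin: "finite (A C S)" for S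
    using finite_subset[OF P.sus_subset(1)[of C] P.finite_VW] unfolding A_def[symmetric] by (cases S) (auto simp: avail_def)
  have ca: "real (card (avail A C)) / scale n = s Red + s Black"
    unfolding avail_def s_def using card_Un_disjoint[OF fin fin disj] by (simp add: add_divide_distrib)
  then show "avail A C \<noteq> {}" using rp(1) by auto
  have "red_rate A C = (real (card (A C Red)) / scale n) / (real (card (avail A C)) / scale n)"
    unfolding red_rate_def using n by simp
  also have "\<dots> = s Red / (s Red + s Black)" by (simp only: ca s_def)
  finally have "red_rate A C = s Red / (s Red + s Black)" .
  then show "\<bar>red_rate A C - rate (real k / q n)\<bar> \<le> 2 * (4 * \<epsilon> + L * d) / \<delta>" using rp(2) by simp
qed

definition edges01 :: "nat \<Rightarrow> (color \<Rightarrow> nat \<Rightarrow> nat \<Rightarrow> real) \<Rightarrow> bool" where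
  "edges01 n E \<longleftrightarrow> (\<forall>S v i. v < n_W a n \<longrightarrow> 1 \<le> i \<longrightarrow> E S v i = 0 \<or> E S v i = 1)"

definition tracks :: "real \<Rightarrow> real \<Rightarrow> nat \<Rightarrow> (color \<Rightarrow> nat \<Rightarrow> nat \<Rightarrow> real) \<Rightarrow> (nat \<Rightarrow> real set) \<Rightarrow> bool" where
  "tracks K e n E ring \<longleftrightarrow> (\<forall>k. real k \<le> K * q n \<longrightarrow> (let A = sus_n n E; C = run A ring (\<lambda>_. {}) k in
     avail A C \<noteq> {} \<and> \<bar>real (card (C Red)) / q n - fc Red (real k / q n)\<bar> \<le> e))"

text \<open>Information about \<open>approx_at\<close> is passed on because the probability of
  \<open>concentrated\<close> must be estimated in the same tube of radius
  \<open>\<eta>\<close>.\<close>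

lemma trajectory_close:
  assumes K: "0 \<le> K" "ereal K < \<kappa>\<^sub>f" and e: "0 < e"
  obtains \<eta> \<epsilon> where "0 < \<eta>" "0 < \<epsilon>" "\<epsilon> \<le> 1"
    "\<exists>L\<ge>0. \<forall>\<epsilon>'>0. \<forall>\<^sub>F n in sequentially. approx_at K L \<eta> \<epsilon>' n"
    "\<forall>\<^sub>F n in sequentially. \<forall>E ring. edges01 n E \<longrightarrow> concentrated K \<eta> \<epsilon> n E ring \<longrightarrow> tracks K e n E ring"
proof -
  obtain L \<eta>0 where L: "0 \<le> L" "0 < \<eta>0" and appr0: "\<And>\<epsilon>. 0 < \<epsilon> \<Longrightarrow> \<forall>\<^sub>F n in sequentially. approx_at K L \<eta>0 \<epsilon> n"
    using regime_approx[OF K] by blast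
  obtain \<delta> B where \<delta>: "0 < \<delta>" "\<And>x. x \<in> {0..K} \<Longrightarrow> \<delta> \<le> bet Red x + bet Black x" using bet_bounds[OF K] by metis
  \<comment> \<open>This gives \<open>L * \<eta> \<le> \<delta> / 8\<close>, and
    \<open>\<epsilon> \<le> \<delta> / 32\<close> below supplies the other half of the bound
    required by \<open>step_estimate\<close>.\<close>
  define \<eta> where "\<eta> = min \<eta>0 (\<delta> / (8 * (L + 1)))"
  have \<eta>: "0 < \<eta>" "\<eta> \<le> \<eta>0" using L \<delta> by (auto simp: \<eta>_def)
  have L\<eta>: "L * \<eta> \<le> \<delta> / 8"
  proof -
    have "L * \<eta> \<le> (L + 1) * (\<delta> / (8 * (L + 1)))" using L \<delta> \<eta> by (intro mult_mono) (auto simp: \<eta>_def)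
    also have "\<dots> = \<delta> / 8"
    proof -
      have gen: "w * (\<delta> / (8 * w)) = \<delta> / 8" if "0 < w" for w :: real using that by simp
      show ?thesis by (rule gen) (use L in simp)
    qed
    finally show ?thesis .
  qed
  have appr: "\<forall>\<^sub>F n in sequentially. approx_at K L \<eta> \<epsilon> n" if "0 < \<epsilon>" for \<epsilon>
    using appr0[OF that] by eventually_elim (use \<eta>(2) in \<open>auto simp: approx_at_def\<close>)
  \<comment> \<open>\<open>ratio_perturb\<close> multiplies the Lipschitz constant by
    \<open>2 / \<delta>\<close>.\<close>
  define L1 where "L1 = 2 * L / \<delta>"
  have L1: "0 \<le> L1" using L \<delta> by (simp add: L1_def)
  define M where "M = (1 + 2 * K) * exp (L1 * K)"
  have M: "0 < M" using K by (simp add: M_def add_pos_nonneg)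
  \<comment> \<open>\<open>M\<close> is the amplification factor of the Euler scheme; the amplified
    error must stay within the target \<open>e\<close> and within the tube.\<close>
  define \<epsilon>1 where "\<epsilon>1 = min e \<eta> / M"
  have \<epsilon>1: "0 < \<epsilon>1" "\<epsilon>1 * M \<le> e" "\<epsilon>1 * M \<le> \<eta>" using e \<eta> M by (auto simp: \<epsilon>1_def)
  \<comment> \<open>The bound \<open>\<epsilon>1 * \<delta> / 8\<close> makes the error
    \<open>8 * \<epsilon> / \<delta>\<close> of the rate at most \<open>\<epsilon>1\<close>.\<close>
  define \<epsilon> where "\<epsilon> = min (min 1 \<epsilon>1) (min (\<delta> / 32) (\<epsilon>1 * \<delta> / 8))"
  have \<epsilon>: "0 < \<epsilon>" "\<epsilon> \<le> 1" "\<epsilon> \<le> \<epsilon>1" "\<epsilon> \<le> \<delta> / 32" "8 * \<epsilon> / \<delta> \<le> \<epsilon>1"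
  proof -
    show "0 < \<epsilon>" "\<epsilon> \<le> 1" "\<epsilon> \<le> \<epsilon>1" "\<epsilon> \<le> \<delta> / 32" using \<epsilon>1 \<delta> by (auto simp: \<epsilon>_def)
    have "\<epsilon> \<le> \<epsilon>1 * \<delta> / 8" by (simp add: \<epsilon>_def)
    then show "8 * \<epsilon> / \<delta> \<le> \<epsilon>1" using \<delta> by (simp add: pos_divide_le_eq)
  qed
  obtain h where h: "0 < h" "\<And>x t. 0 \<le> x \<Longrightarrow> 0 < t \<Longrightarrow> t < h \<Longrightarrow> x + t \<le> K \<Longrightarrow> \<bar>fc Red (x + t) - fc Red x - rate x * t\<bar> \<le> \<epsilon>1 * t"
    using euler_estimate[OF K \<epsilon>1(1)] by metis
  have hq: "\<forall>\<^sub>F n in sequentially. 1 / q n < h" by (rule order_tendstoD(2)[OF inv_q h(1)])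
  have "\<forall>\<^sub>F n in sequentially. \<forall>E ring. edges01 n E \<longrightarrow> concentrated K \<eta> \<epsilon> n E ring \<longrightarrow> tracks K e n E ring"
    using q_pos scale_pos hq appr[OF \<epsilon>(1)] ev_negligible[OF K(1) \<epsilon>(1)]
  proof eventually_elim
    case (elim n)
    show ?case unfolding tracks_def Let_def
    proof (intro allI impI)
      fix E :: "color \<Rightarrow> nat \<Rightarrow> nat \<Rightarrow> real" and ring :: "nat \<Rightarrow> real set" and k :: nat
      assume E01: "edges01 n E" and conc: "concentrated K \<eta> \<epsilon> n E ring" and k: "real k \<le> K * q n"
      define A where "A = sus_n n E"
      let ?C = "run A ring (\<lambda>_. {})"
      have "avail A (?C k) \<noteq> {} \<and> \<bar>real (card (?C k Red)) / q n - fc Red (real k / q n)\<bar> \<le> \<epsilon>1 * (1 + 2 * K) * exp (L1 * K)"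
      proof (rule euler_stability[where y="\<lambda>x. fc Red x" and \<phi>=rate and N="\<lambda>k. real (card (?C k Red))"
            and u="\<lambda>k. red_rate A (?C k)" and G="\<lambda>k. avail A (?C k) \<noteq> {}" and \<eta>=\<eta>, OF elim(1) K(1) less_imp_le[OF \<epsilon>1(1)] L1])
        show "\<epsilon>1 * (1 + 2 * K) * exp (L1 * K) \<le> \<eta>" using \<epsilon>1(3) by (simp add: M_def mult.assoc)
        show "fc Red 0 = 0" by (rule fc_0)
        show "real k \<le> K * q n" by (rule k)
      next
        fix j assume j: "real (Suc j) \<le> K * q n"
        have "real j / q n + 1 / q n = real (Suc j) / q n" by (simp add: add_divide_distrib)
        moreover have "real (Suc j) / q n \<le> K" using j elim(1) by (simp only: pos_divide_le_eq)
        ultimately show "\<bar>fc Red (real (Suc j) / q n) - fc Red (real j / q n) - rate (real j / q n) / q n\<bar> \<le> \<epsilon>1 / q n"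
          using h(2)[of "real j / q n" "1 / q n"] elim(1,3) by simp
      next
        fix j assume "real j \<le> K * q n"
        then have "\<bar>deviation A ring (\<lambda>_. {}) j\<bar> < \<epsilon> * q n" using conc unfolding concentrated_def A_def by blast
        also have "\<epsilon> * q n \<le> \<epsilon>1 * q n" using \<epsilon>(3) elim(1) by (intro mult_right_mono) auto
        finally show "\<bar>real (card (?C j Red)) - (\<Sum>i<j. red_rate A (?C i))\<bar> \<le> \<epsilon>1 * q n"
          unfolding deviation_def by simp
      next
        fix j
        let ?d = "\<bar>real (card (?C j Red)) / q n - fc Red (real j / q n)\<bar>"
        assume j: "real j \<le> K * q n" and G: "\<And>i. i < j \<Longrightarrow> avail A (?C i) \<noteq> {}" and d: "?d \<le> \<eta>"
        have sm: "4 * \<epsilon> + L * \<eta> \<le> \<delta> / 4" using \<epsilon>(4) L\<eta> by linarith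
        have E01': "v < n_W a n \<Longrightarrow> 1 \<le> i \<Longrightarrow> E S v i = 0 \<or> E S v i = 1" for S v i using E01 unfolding edges01_def by blast
        note st = step_estimate[OF K \<delta> L(1) \<epsilon>(1) sm elim(1,2) E01' conc elim(4,5) j G[unfolded A_def] d[unfolded A_def], folded A_def]
        have "2 * (4 * \<epsilon> + L * ?d) / \<delta> = 8 * \<epsilon> / \<delta> + L1 * ?d"
          by (simp add: L1_def add_divide_distrib distrib_left)
        then show "avail A (?C j) \<noteq> {} \<and> \<bar>red_rate A (?C j) - rate (real j / q n)\<bar> \<le> \<epsilon>1 + L1 * ?d"
          using st \<epsilon>(5) by linarith
      qed
      then show "avail (sus_n n E) (run (sus_n n E) ring (\<lambda>_. {}) k) \<noteq> {}
          \<and> \<bar>real (card (run (sus_n n E) ring (\<lambda>_. {}) k Red)) / q n - fc Red (real k / q n)\<bar> \<le> e"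
        using \<epsilon>1(2) unfolding A_def[symmetric] M_def by (simp add: mult.assoc)
    qed
  qed
  then show thesis using that[OF \<eta>(1) \<epsilon>(1,2)] appr L(1) by blast
qed

end

section \<open>Almost sure convergence\<close>

text \<open>Exceptional sets are covered by events instead of being events, so the properties
  \<open>Q i\<close> may be non-measurable.\<close>

lemma (in prob_space) union_bound_all:
  assumes I: "finite I" and Q: "\<And>i. i \<in> I \<Longrightarrow> \<exists>B\<in>events. prob B \<le> b \<and> (\<forall>\<omega>\<in>space M - B. Q i \<omega>)"
  shows "\<exists>B\<in>events. prob B \<le> real (card I) * b \<and> (\<forall>\<omega>\<in>space M - B. \<forall>i\<in>I. Q i \<omega>)"
proof -
  have "\<forall>i\<in>I. \<exists>B. B \<in> events \<and> prob B \<le> b \<and> (\<forall>\<omega>\<in>space M - B. Q i \<omega>)" using Q by blast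
  from bchoice[OF this] obtain B where
    B: "\<And>i. i \<in> I \<Longrightarrow> B i \<in> events \<and> prob (B i) \<le> b \<and> (\<forall>\<omega>\<in>space M - B i. Q i \<omega>)" by blast
  have "prob (\<Union>i\<in>I. B i) \<le> (\<Sum>i\<in>I. prob (B i))"
    using B by (intro finite_measure_subadditive_finite I) auto
  also have "\<dots> \<le> (\<Sum>i\<in>I. b)" using B by (intro sum_mono) auto
  finally have "prob (\<Union>i\<in>I. B i) \<le> real (card I) * b" by simp
  moreover have "(\<Union>i\<in>I. B i) \<in> events" using B by (intro sets.finite_UN I) auto
  ultimately show ?thesis using B by (intro bexI[of _ "\<Union>i\<in>I. B i"]) auto
qed

lemma (in prob_space) union_bound_3:
  assumes "\<exists>B\<in>events. prob B \<le> b1 \<and> (\<forall>\<omega>\<in>space M - B. Q1 \<omega>)" "\<exists>B\<in>events. prob B \<le> b2 \<and> (\<forall>\<omega>\<in>space M - B. Q2 \<omega>)"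
    "\<exists>B\<in>events. prob B \<le> b3 \<and> (\<forall>\<omega>\<in>space M - B. Q3 \<omega>)" "b1 + b2 + b3 \<le> b"
  shows "\<exists>B\<in>events. prob B \<le> b \<and> (\<forall>\<omega>\<in>space M - B. Q1 \<omega> \<and> Q2 \<omega> \<and> Q3 \<omega>)"
proof -
  obtain B1 B2 B3 where B: "B1 \<in> events" "B2 \<in> events" "B3 \<in> events" "prob B1 \<le> b1" "prob B2 \<le> b2" "prob B3 \<le> b3"
    "\<forall>\<omega>\<in>space M - B1. Q1 \<omega>" "\<forall>\<omega>\<in>space M - B2. Q2 \<omega>" "\<forall>\<omega>\<in>space M - B3. Q3 \<omega>" using assms(1-3) by blast
  have "prob (B1 \<union> B2 \<union> B3) \<le> prob (B1 \<union> B2) + prob B3" using B by (intro measure_Un_le) auto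
  also have "prob (B1 \<union> B2) \<le> prob B1 + prob B2" using B by (intro measure_Un_le) auto
  finally have "prob (B1 \<union> B2 \<union> B3) \<le> b" using B assms(4) by linarith
  then show ?thesis using B by (intro bexI[of _ "B1 \<union> B2 \<union> B3"]) auto
qed

lemma color_pair_eta: "case_color (kk Red) (kk Black) = (kk :: color \<Rightarrow> nat)"
proof
  fix S show "case_color (kk Red) (kk Black) S = kk S" by (cases S) auto
qed

section \<open>The good event and the limit\<close>

locale percolation_setting = setting +
  fixes M :: "'a measure" and X :: "input \<Rightarrow> 'a \<Rightarrow> real"
  assumes inputs: "percolation_inputs M p a X"
begin

sublocale prob_space M
  using inputs by (simp add: percolation_inputs_def)

abbreviation "edges_of n \<omega> \<equiv> \<lambda>S v i. X (Edge n S v i) \<omega>"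
abbreviation "rings_of n \<omega> \<equiv> \<lambda>v. range (\<lambda>m. \<Sum>j\<le>m. X (Gap n v j) \<omega>)"
abbreviation "conc K \<eta> \<epsilon> n \<omega> \<equiv> concentrated K \<eta> \<epsilon> n (edges_of n \<omega>) (rings_of n \<omega>)"

lemma inputs_at: "1 \<le> n \<Longrightarrow> inputs_at M p a X n"
  using inputs p01[of n] prob_space_axioms by (simp add: inputs_at_def inputs_at_axioms_def)

text \<open>\<open>c\<close> is the smaller of the exponents for counts and for deviations. Means at
  most \<open>C * scale n\<close> make the Chernoff exponent proportional to \<open>scale n\<close>,
  hence at least proportional to \<open>q n\<close>.\<close>

lemma concentrated_prob:
  fixes K \<eta> \<epsilon> C :: real
  defines "c \<equiv> min (\<epsilon>\<^sup>2 / (4 * C)) (min 1 (\<epsilon> / (2 * (K + 1))) * \<epsilon> / 2)"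
  assumes K: "0 \<le> K" and \<epsilon>: "0 < \<epsilon>" "\<epsilon> \<le> C" and n: "1 \<le> n" "0 < q n" "q n \<le> scale n"
    and ahead: "\<And>kk S. real (kk Red + kk Black) \<le> K * q n \<Longrightarrow> gap kk n \<le> \<eta> \<Longrightarrow> ahead_mean S kk n \<le> C * scale n"
    and crowded: "\<And>kk. reg = Critical \<Longrightarrow> real (kk Red + kk Black) \<le> K * q n \<Longrightarrow> crowded_mean kk n \<le> C * scale n"
  shows "\<exists>B\<in>events. prob B \<le> 8 * (K * q n + 1)\<^sup>2 * exp (- c * q n) \<and> (\<forall>\<omega>\<in>space M - B. conc K \<eta> \<epsilon> n \<omega>)"
proof -
  interpret I: inputs_at M p a X n r by (rule inputs_at[OF n(1)])
  \<comment> \<open>The integer form of the horizon: both counts lie in \<open>{..N}\<close>, so the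
    union bound runs over a finite box.\<close>
  define N where "N = nat \<lfloor>K * q n\<rfloor>"
  have NK: "real k \<le> K * q n \<longleftrightarrow> k \<le> N" for k
    using K n by (simp add: N_def le_nat_iff le_floor_iff)
  have N1: "real N + 1 \<le> K * q n + 1" using NK[of N] by simp
  have sc: "0 < scale n" using n by linarith
  define e where "e = exp (- c * q n)"
  have e0: "0 < e" by (simp add: e_def)
  have exp1: "2 * exp (- (\<epsilon>\<^sup>2 / (4 * C)) * scale n) \<le> 2 * e"
  proof -
    have "c * q n \<le> (\<epsilon>\<^sup>2 / (4 * C)) * scale n"
      using n \<epsilon> by (intro mult_mono) (auto simp: c_def)
    then show ?thesis by (simp add: e_def)
  qed
  \<comment> \<open>\<open>l * K \<le> \<epsilon> / 2\<close> makes the quadratic term at most half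
    of the linear gain; \<open>K + 1\<close> avoids division by 0.\<close>
  define l where "l = min 1 (\<epsilon> / (2 * (K + 1)))"
  have l: "0 < l" "l \<le> 1" "l * K \<le> \<epsilon> / 2"
  proof -
    show "0 < l" "l \<le> 1" using K \<epsilon> by (auto simp: l_def)
    have "l * K \<le> \<epsilon> / (2 * (K + 1)) * (K + 1)" using K \<epsilon> by (intro mult_mono) (auto simp: l_def)
    also have "\<dots> = \<epsilon> / 2"
    proof -
      have gen: "\<epsilon> / (2 * w) * w = \<epsilon> / 2" if "0 < w" for w :: real using that by simp
      show ?thesis by (rule gen) (use K in simp)
    qed
    finally show "l * K \<le> \<epsilon> / 2" .
  qed
  have exp2: "2 * exp (l\<^sup>2 * real k - l * (\<epsilon> * q n)) \<le> 2 * e" if "k \<le> N" for k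
  proof -
    have "l\<^sup>2 * real k \<le> l\<^sup>2 * (K * q n)" using that NK by (intro mult_left_mono) auto
    also have "\<dots> = l * q n * (l * K)" by (simp add: power2_eq_square mult_ac)
    also have "\<dots> \<le> l * q n * (\<epsilon> / 2)" using l n by (intro mult_left_mono) auto
    finally have "l\<^sup>2 * real k - l * (\<epsilon> * q n) \<le> - (l * \<epsilon> / 2) * q n" by (simp add: algebra_simps)
    also have "\<dots> \<le> - c * q n"
    proof -
      have "c \<le> l * \<epsilon> / 2" unfolding c_def l_def by (rule min.cobounded2)
      then show ?thesis using n by (intro mult_right_mono) auto
    qed
    finally show ?thesis by (simp add: e_def)
  qed
  \<comment> \<open>Pairs outside the tube satisfy it vacuously, as means are bounded inside
    only.\<close>
  define Q1 where "Q1 = (\<lambda>(i, j, S) \<omega>. let kk = case_color i j in real (kk Red + kk Black) \<le> K * q n \<longrightarrow> gap kk n \<le> \<eta> \<longrightarrow>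
        \<bar>real (card (I.ahead_at \<omega> S (kk S + a S n) (kk (other S) + a (other S) n))) - ahead_mean S kk n\<bar> < \<epsilon> * scale n)"
  have 1: "\<exists>B\<in>events. prob B \<le> real (card ({..N} \<times> {..N} \<times> (UNIV :: color set))) * (2 * e) \<and>
      (\<forall>\<omega>\<in>space M - B. \<forall>x\<in>{..N} \<times> {..N} \<times> UNIV. Q1 x \<omega>)"
  proof (rule union_bound_all)
    show "finite ({..N} \<times> {..N} \<times> (UNIV :: color set))" using finite_color by auto
    fix x :: "nat \<times> nat \<times> color"
    obtain i j S where x: "x = (i, j, S)" by (cases x)
    define kk where "kk = case_color i j"
    show "\<exists>B\<in>events. prob B \<le> 2 * e \<and> (\<forall>\<omega>\<in>space M - B. Q1 x \<omega>)"
    proof (cases "real (kk Red + kk Black) \<le> K * q n \<and> gap kk n \<le> \<eta>")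
      case True
      note ac = I.ahead_concentration[OF ahead[OF conjunct1[OF True] conjunct2[OF True], of S] \<epsilon> sc, of S]
      show ?thesis
      proof (rule bexI[rotated], rule ac(1), rule conjI, rule order.trans[OF ac(2) exp1], rule ballI)
        fix \<omega>
        assume "\<omega> \<in> space M - {\<omega> \<in> space M. \<epsilon> * scale n \<le> \<bar>real (card (I.ahead_at \<omega> S (kk S + a S n) (kk (other S) + a (other S) n))) - ahead_mean S kk n\<bar>}"
        then have "\<bar>real (card (I.ahead_at \<omega> S (kk S + a S n) (kk (other S) + a (other S) n))) - ahead_mean S kk n\<bar> < \<epsilon> * scale n"
          unfolding Diff_iff mem_Collect_eq not_le[symmetric] by blast
        then show "Q1 x \<omega>" unfolding Q1_def x prod.case kk_def[symmetric] Let_def by (intro impI)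
      qed
    next
      case False
      then have "Q1 x \<omega>" for \<omega> unfolding Q1_def x prod.case kk_def[symmetric] Let_def by blast
      then show ?thesis using e0 by (intro bexI[of _ "{}"]) auto
    qed
  qed
  define Q2 where "Q2 = (\<lambda>(i, j) \<omega>. let kk = case_color i j in reg = Critical \<longrightarrow> real (kk Red + kk Black) \<le> K * q n \<longrightarrow>
        \<bar>real (card (I.crowded_at \<omega> (kk Red + a Red n) (kk Black + a Black n))) - crowded_mean kk n\<bar> < \<epsilon> * scale n)"
  have 2: "\<exists>B\<in>events. prob B \<le> real (card ({..N} \<times> {..N})) * (2 * e) \<and>
      (\<forall>\<omega>\<in>space M - B. \<forall>x\<in>{..N} \<times> {..N}. Q2 x \<omega>)"
  proof (rule union_bound_all)
    fix x :: "nat \<times> nat"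
    obtain i j where x: "x = (i, j)" by (cases x)
    define kk where "kk = case_color i j"
    show "\<exists>B\<in>events. prob B \<le> 2 * e \<and> (\<forall>\<omega>\<in>space M - B. Q2 x \<omega>)"
    proof (cases "reg = Critical \<and> real (kk Red + kk Black) \<le> K * q n")
      case True
      have r1: "int (r + 1) = int r + 1" by simp
      note cc = I.crowded_concentration[unfolded r1, OF crowded[OF conjunct1[OF True] conjunct2[OF True]] \<epsilon> sc]
      show ?thesis
      proof (rule bexI[rotated], rule cc(1), rule conjI, rule order.trans[OF cc(2) exp1], rule ballI)
        fix \<omega>
        assume "\<omega> \<in> space M - {\<omega> \<in> space M. \<epsilon> * scale n \<le> \<bar>real (card (I.crowded_at \<omega> (kk Red + a Red n) (kk Black + a Black n))) - crowded_mean kk n\<bar>}"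
        then have "\<bar>real (card (I.crowded_at \<omega> (kk Red + a Red n) (kk Black + a Black n))) - crowded_mean kk n\<bar> < \<epsilon> * scale n"
          unfolding Diff_iff mem_Collect_eq not_le[symmetric] by blast
        then show "Q2 x \<omega>" unfolding Q2_def x prod.case kk_def[symmetric] Let_def by (intro impI)
      qed
    next
      case False
      then have "Q2 x \<omega>" for \<omega> unfolding Q2_def x prod.case kk_def[symmetric] Let_def by blast
      then show ?thesis using e0 by (intro bexI[of _ "{}"]) auto
    qed
  qed simp
  define Q3 where "Q3 = (\<lambda>k \<omega>. \<bar>deviation (I.sus_at \<omega>) (rings_of n \<omega>) (\<lambda>_. {}) k\<bar> < \<epsilon> * q n)"
  have 3: "\<exists>B\<in>events. prob B \<le> real (card {..N}) * (2 * e) \<and> (\<forall>\<omega>\<in>space M - B. \<forall>k\<in>{..N}. Q3 k \<omega>)"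
  proof (rule union_bound_all)
    fix k assume "k \<in> {..N}"
    then have k: "k \<le> N" by simp
    have "0 < \<epsilon> * q n" using \<epsilon> n by simp
    from I.deviation_prob[OF less_imp_le[OF l(1)] l(2) this, of k] obtain B where B: "B \<in> events"
      "prob B \<le> 2 * exp (l\<^sup>2 * real k - l * (\<epsilon> * q n))" "\<forall>\<omega>\<in>space M - B. Q3 k \<omega>"
      unfolding Q3_def by blast
    show "\<exists>B\<in>events. prob B \<le> 2 * e \<and> (\<forall>\<omega>\<in>space M - B. Q3 k \<omega>)"
      by (rule bexI[OF _ B(1)], rule conjI, rule order.trans[OF B(2) exp2[OF k]], rule B(3))
  qed simp
  have "(UNIV :: color set) = {Red, Black}" using color.exhaust by auto
  then have cu: "card (UNIV :: color set) = 2" by (metis card_2_iff color.distinct(1))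
  \<comment> \<open>The constant 8 is 4 for \<open>ahead\<close> with its two colors, 2 for crowded
    nodes and 2 for deviations, whose linear number is bounded by the square.\<close>
  have tot: "real (card ({..N} \<times> {..N} \<times> (UNIV :: color set))) * (2 * e) + real (card ({..N} \<times> {..N})) * (2 * e) + real (card {..N}) * (2 * e)
    \<le> 8 * (K * q n + 1)\<^sup>2 * e"
  proof -
    have "real (card ({..N} \<times> {..N} \<times> (UNIV :: color set))) * (2 * e) + real (card ({..N} \<times> {..N})) * (2 * e) + real (card {..N}) * (2 * e)
        = (6 * (real N + 1)\<^sup>2 + 2 * (real N + 1)) * e"
      by (simp add: card_cartesian_product cu power2_eq_square algebra_simps)
    also have "\<dots> \<le> (6 * (real N + 1)\<^sup>2 + 2 * (real N + 1)\<^sup>2) * e"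
      using e0 by (intro mult_right_mono add_left_mono mult_left_mono) (auto simp: power2_eq_square)
    also have "\<dots> = 8 * (real N + 1)\<^sup>2 * e" by simp
    also have "\<dots> \<le> 8 * (K * q n + 1)\<^sup>2 * e"
      using e0 N1 by (intro mult_right_mono mult_left_mono power_mono) auto
    finally show ?thesis .
  qed
  from union_bound_3[OF 1 2 3 tot] obtain B where B: "B \<in> events" "prob B \<le> 8 * (K * q n + 1)\<^sup>2 * e"
    "\<And>\<omega>. \<omega> \<in> space M - B \<Longrightarrow> (\<forall>x\<in>{..N} \<times> {..N} \<times> UNIV. Q1 x \<omega>) \<and> (\<forall>x\<in>{..N} \<times> {..N}. Q2 x \<omega>) \<and> (\<forall>k\<in>{..N}. Q3 k \<omega>)"
    by blast
  have "conc K \<eta> \<epsilon> n \<omega>" if "\<omega> \<in> space M - B" for \<omega>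
    unfolding concentrated_def
  proof (intro conjI allI impI)
    fix kk :: "color \<Rightarrow> nat" and S
    assume k: "real (kk Red + kk Black) \<le> K * q n" "gap kk n \<le> \<eta>"
    have "kk Red + kk Black \<le> N" using k(1) NK by blast
    then have "Q1 (kk Red, kk Black, S) \<omega>" using B(3)[OF that] by auto
    then show "\<bar>real (card (I.ahead_at \<omega> S (kk S + a S n) (kk (other S) + a (other S) n))) - ahead_mean S kk n\<bar> < \<epsilon> * scale n"
      unfolding Q1_def prod.case color_pair_eta Let_def using k by blast
  next
    fix kk :: "color \<Rightarrow> nat"
    assume c: "reg = Critical" and k: "real (kk Red + kk Black) \<le> K * q n"
    have "kk Red + kk Black \<le> N" using k NK by blast
    then have "Q2 (kk Red, kk Black) \<omega>" using B(3)[OF that] by auto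
    then show "\<bar>real (card (I.crowded_at \<omega> (kk Red + a Red n) (kk Black + a Black n))) - crowded_mean kk n\<bar> < \<epsilon> * scale n"
      unfolding Q2_def prod.case color_pair_eta Let_def using k c by blast
  next
    fix k assume "real k \<le> K * q n"
    then have "Q3 k \<omega>" using B(3)[OF that] NK by auto
    then show "\<bar>deviation (I.sus_at \<omega>) (rings_of n \<omega>) (\<lambda>_. {}) k\<bar> < \<epsilon> * q n" unfolding Q3_def .
  qed
  then show ?thesis using B(1,2) unfolding e_def by blast
qed

text \<open>As \<open>ln n / q n\<close> tends to 0, eventually \<open>exp (- c * q n)\<close> is at
  most \<open>1 / n^4\<close>; with \<open>q n \<le> n\<close> the exceptional probabilities are of
  order \<open>1 / n^2\<close>.\<close>

lemma AE_concentrated: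
  assumes K: "0 \<le> K" "ereal K < \<kappa>\<^sub>f" and \<eta>: "0 < \<eta>" and \<epsilon>: "0 < \<epsilon>" "\<epsilon> \<le> 1"
    and appr: "\<exists>L\<ge>0. \<forall>\<epsilon>'>0. \<forall>\<^sub>F n in sequentially. approx_at K L \<eta> \<epsilon>' n"
  shows "AE \<omega> in M. \<forall>\<^sub>F n in sequentially. conc K \<eta> \<epsilon> n \<omega>"
proof -
  obtain L where L: "0 \<le> L" "\<forall>\<^sub>F n in sequentially. approx_at K L \<eta> 1 n" using appr zero_less_one by blast
  obtain \<delta> B0 where B0: "\<And>x S. x \<in> {0..K} \<Longrightarrow> bet S x \<le> B0" using bet_bounds[OF K] by metis
  \<comment> \<open>Bounds a rescaled mean count: 1 and \<open>L * \<eta>\<close> for the error in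
    \<open>approx_at\<close>, \<open>K\<close> for the active nodes and \<open>B0\<close> for
    \<open>beta\<close> along the solution.\<close>
  define C where "C = 1 + L * \<eta> + K + \<bar>B0\<bar>"
  have C1: "1 \<le> C" using L \<eta> K by (simp add: C_def)
  define c where "c = min (\<epsilon>\<^sup>2 / (4 * C)) (min 1 (\<epsilon> / (2 * (K + 1))) * \<epsilon> / 2)"
  have c: "0 < c" using \<epsilon> C1 K by (simp add: c_def)
  have ev: "\<forall>\<^sub>F n in sequentially. \<exists>B\<in>events. prob B \<le> 8 * (K * q n + 1)\<^sup>2 * exp (- c * q n) \<and> (\<forall>\<omega>\<in>space M - B. conc K \<eta> \<epsilon> n \<omega>)"
    using ev_ge[of 1] q_pos scale_pos scale_ge L(2) ev_negligible[OF K(1) zero_less_one]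
  proof eventually_elim
    case (elim n)
    show ?case unfolding c_def
    proof (rule concentrated_prob[OF K(1) \<epsilon>(1) _ elim(1,2,4)])
      show "\<epsilon> \<le> C" using \<epsilon> C1 by simp
    next
      fix kk :: "color \<Rightarrow> nat" and S
      assume k: "real (kk Red + kk Black) \<le> K * q n" and g: "gap kk n \<le> \<eta>"
      note gc = gap_color[OF elim(2) K k]
      have "\<bar>ahead_mean S kk n / scale n - crit * (real (kk S) / q n) - bet S (xpos kk n)\<bar> \<le> 1 + L * gap kk n"
        using elim(5) k g unfolding approx_at_def by blast
      moreover have "L * gap kk n \<le> L * \<eta>" using L g by (intro mult_left_mono) auto
      moreover have "crit * (real (kk S) / q n) \<le> K" using gc(5)[of S] K by (cases "reg = Critical") auto
      moreover have "bet S (xpos kk n) \<le> B0" using gc(1,2) by (intro B0) simp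
      ultimately have "ahead_mean S kk n / scale n \<le> C" unfolding C_def by linarith
      then show "ahead_mean S kk n \<le> C * scale n" using elim(3) by (simp only: pos_divide_le_eq)
    next
      fix kk :: "color \<Rightarrow> nat"
      assume "reg = Critical" "real (kk Red + kk Black) \<le> K * q n"
      then have "crowded_mean kk n \<le> 1 * scale n" using elim(6) unfolding negligible_def by auto
      also have "\<dots> \<le> C * scale n" using C1 elim(3) by (intro mult_right_mono) auto
      finally show "crowded_mean kk n \<le> C * scale n" .
    qed
  qed
  define P where "P n B \<longleftrightarrow> B \<in> events \<and> prob B \<le> 8 * (K * q n + 1)\<^sup>2 * exp (- c * q n) \<and> (\<forall>\<omega>\<in>space M - B. conc K \<eta> \<epsilon> n \<omega>)" for n B
  \<comment> \<open>Borel-Cantelli asks for an event at every \<open>n\<close>, while covers are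
    known to exist only eventually; the empty set fills in.\<close>
  define Bad where "Bad n = (if \<exists>B. P n B then SOME B. P n B else {})" for n
  have Bad: "P n (Bad n)" if "\<exists>B. P n B" for n using someI_ex[OF that] that by (simp add: Bad_def)
  have evP: "\<forall>\<^sub>F n in sequentially. P n (Bad n)"
    using ev by eventually_elim (intro Bad, auto simp: P_def)
  have Bev: "Bad n \<in> events" for n
  proof (cases "\<exists>B. P n B")
    case True then show ?thesis using Bad[OF True] by (simp add: P_def)
  qed (simp add: Bad_def)
  have "summable (\<lambda>n. prob (Bad n))"
  proof (rule summable_comparison_test_ev)
    show "summable (\<lambda>n. 8 * (K + 1)\<^sup>2 * inverse (real n ^ 2))"
      by (intro summable_mult inverse_power_summable) simp
    have l1: "\<forall>\<^sub>F n in sequentially. q n / real n < 1" by (rule order_tendstoD(2)[OF q_over_n]) simp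
    have l2: "\<forall>\<^sub>F n in sequentially. ln (real n) / q n < c / 4" by (rule order_tendstoD(2)[OF ln_over_q]) (use c in simp)
    show "\<forall>\<^sub>F n in sequentially. norm (prob (Bad n)) \<le> 8 * (K + 1)\<^sup>2 * inverse (real n ^ 2)"
      using evP l1 l2 q_pos ev_ge[of 1]
    proof eventually_elim
      case (elim n)
      have n0: "0 < real n" using elim by simp
      have "q n \<le> real n" using elim(2) n0 by (simp add: divide_less_eq)
      then have "K * q n + 1 \<le> K * real n + 1 * real n" using K elim(5) by (intro add_mono mult_left_mono) auto
      then have 1: "(K * q n + 1)\<^sup>2 \<le> ((K + 1) * real n)\<^sup>2"
        using K elim(4) by (intro power_mono) (auto simp: algebra_simps)
      have "4 * ln (real n) \<le> c * q n" using elim(3,4) by (simp add: pos_divide_less_eq)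
      then have "exp (- c * q n) \<le> exp (- (4 * ln (real n)))" by simp
      also have "\<dots> = inverse (real n ^ 4)"
        using n0 by (simp add: exp_minus exp_of_nat_mult[of 4, simplified])
      finally have 2: "exp (- c * q n) \<le> inverse (real n ^ 4)" .
      have "prob (Bad n) \<le> 8 * (K * q n + 1)\<^sup>2 * exp (- c * q n)" using elim(1) by (simp add: P_def)
      also have "\<dots> \<le> 8 * ((K + 1) * real n)\<^sup>2 * inverse (real n ^ 4)"
        using 1 2 by (intro mult_mono mult_left_mono) auto
      also have "\<dots> = 8 * (K + 1)\<^sup>2 * inverse (real n ^ 2)"
        using n0 by (simp add: power_mult_distrib field_simps power2_eq_square power4_eq_xxxx)
      finally show ?case by simp
    qed
  qed
  then have "AE \<omega> in M. \<forall>\<^sub>F n in sequentially. \<omega> \<in> space M - Bad n"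
    using Bev by (intro borel_cantelli_AE1) (auto simp: less_top[symmetric])
  then show ?thesis
  proof eventually_elim
    fix \<omega> assume "\<forall>\<^sub>F n in sequentially. \<omega> \<in> space M - Bad n"
    with evP show "\<forall>\<^sub>F n in sequentially. conc K \<eta> \<epsilon> n \<omega>" by eventually_elim (auto simp: P_def)
  qed
qed

text \<open>Each component contributes \<open>3 * e\<close>: interpolation costs
  \<open>1 / q n\<close>, tracking costs \<open>e\<close> at the grid point, and moving from there
  to \<open>x\<close> costs \<open>e\<close> by uniform continuity. The horizon
  \<open>K > \<kappa>\<close> leaves room for the next grid point.\<close>

lemma F_close:
  fixes K \<kappa> e d :: real
  assumes K: "0 \<le> \<kappa>" "\<kappa> < K" "ereal K < \<kappa>\<^sub>f" and n: "0 < q n" "1 / q n \<le> e" "1 / q n < d" "1 / q n \<le> K - \<kappa>"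
    and traj: "tracks K e n (edges_of n \<omega>) (rings_of n \<omega>)"
    and uc: "\<And>S x t. x \<in> {0..K} \<Longrightarrow> t \<in> {0..K} \<Longrightarrow> \<bar>t - x\<bar> < d \<Longrightarrow> \<bar>fc S t - fc S x\<bar> \<le> e"
    and x: "x \<in> {0..\<kappa>}"
  shows "norm (F r a q X n \<omega> x - f x) \<le> 6 * e"
proof -
  let ?r = "\<lambda>k. run (sus_n n (edges_of n \<omega>)) (rings_of n \<omega>) (\<lambda>_. {}) k"
  let ?A = "sus_n n (edges_of n \<omega>)"
  define k where "k = nat \<lfloor>x * q n\<rfloor>"
  have xq: "0 \<le> x * q n" using x n by simp
  have kx: "real k \<le> x * q n" "x * q n < real k + 1" using xq by (auto simp: k_def)
  have xK: "x * q n \<le> \<kappa> * q n" using x n by (intro mult_right_mono) auto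
  have "1 \<le> (K - \<kappa>) * q n" using n(1,4) by (simp add: pos_divide_le_eq)
  then have "\<kappa> * q n + 1 \<le> K * q n" by (simp add: left_diff_distrib)
  then have kK: "real k \<le> K * q n" "real (Suc k) \<le> K * q n" using kx xK by simp_all
  have stop: "avail ?A (?r j) \<noteq> {}" if "real j \<le> K * q n" for j
    using traj that unfolding tracks_def Let_def by blast
  have act: "activations r a X n \<omega> S j = card (?r j S)" if "real j \<le> K * q n" for j S
    unfolding activations_def
    by (rule percolation.process_eq_nat_run, rule stop) (use that in simp)
  have close: "\<bar>interpolate (activations r a X n \<omega> S) (x * q n) / q n - fc S x\<bar> \<le> 3 * e" for S
  proof -
    have m: "activations r a X n \<omega> S k \<le> activations r a X n \<omega> S (Suc k)"
      "activations r a X n \<omega> S (Suc k) \<le> Suc (activations r a X n \<omega> S k)"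
      unfolding act[OF kK(1)] act[OF kK(2)] by (rule percolation.card_nat_run_Suc)+
    have "\<bar>interpolate (activations r a X n \<omega> S) (x * q n) - real (card (?r k S))\<bar> \<le> 1"
      using interpolate_close[OF xq m k_def] unfolding act[OF kK(1)] .
    then have "\<bar>interpolate (activations r a X n \<omega> S) (x * q n) - real (card (?r k S))\<bar> / q n \<le> 1 / q n"
      using n by (intro divide_right_mono) auto
    then have 1: "\<bar>interpolate (activations r a X n \<omega> S) (x * q n) / q n - real (card (?r k S)) / q n\<bar> \<le> e"
      using n by (simp add: diff_divide_distrib[symmetric] abs_divide)
    define kk where "kk S = card (?r k S)" for S
    have tot: "kk Red + kk Black = k"
      unfolding kk_def by (rule percolation.card_nat_run, rule stop) (use kK in simp)
    have ktot: "real (kk Red + kk Black) \<le> K * q n" using tot kK by simp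
    have K0: "0 \<le> K" using K by simp
    note g = gap_color[OF n(1) K0 K(3) ktot, unfolded tot]
    have 2: "\<bar>real (card (?r k S)) / q n - fc S (real k / q n)\<bar> \<le> e"
      using g(4)[of S] traj kK(1) unfolding kk_def tracks_def Let_def by simp
    have 3: "\<bar>fc S (real k / q n) - fc S x\<bar> \<le> e"
    proof (rule uc)
      show "x \<in> {0..K}" using x K by simp
      show "real k / q n \<in> {0..K}" using g(1,2) by simp
      have "real k / q n \<le> x" "x < real k / q n + 1 / q n"
        using kx n by (simp_all add: pos_divide_le_eq add_divide_distrib[symmetric] pos_less_divide_eq)
      then show "\<bar>real k / q n - x\<bar> < d" using n(3) by linarith
    qed
    show ?thesis using 1 2 3 by linarith
  qed
  have "F r a q X n \<omega> x - f x = (interpolate (activations r a X n \<omega> Red) (x * q n) / q n - fc Red x,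
      interpolate (activations r a X n \<omega> Black) (x * q n) / q n - fc Black x)"
    by (simp add: F_def prod_eq_iff)
  then have "norm (F r a q X n \<omega> x - f x) \<le> \<bar>interpolate (activations r a X n \<omega> Red) (x * q n) / q n - fc Red x\<bar>
      + \<bar>interpolate (activations r a X n \<omega> Black) (x * q n) / q n - fc Black x\<bar>"
    using norm_Pair_le by (metis real_norm_def)
  then show ?thesis using close[of Red] close[of Black] by linarith
qed

lemma AE_uniformly_close:
  assumes K: "0 \<le> \<kappa>" "ereal \<kappa> < \<kappa>\<^sub>f" and e: "0 < e"
  shows "AE \<omega> in M. \<forall>\<^sub>F n in sequentially. \<forall>x\<in>{0..\<kappa>}. norm (F r a q X n \<omega> x - f x) \<le> 6 * e"
proof -
  obtain K where K': "\<kappa> < K" "ereal K < \<kappa>\<^sub>f"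
    using ereal_dense2[OF K(2)] by auto
  have K0: "0 \<le> K" using K K' by simp
  obtain \<eta> \<epsilon> where h: "0 < \<eta>" "0 < \<epsilon>" "\<epsilon> \<le> 1"
    and appr: "\<exists>L\<ge>0. \<forall>\<epsilon>'>0. \<forall>\<^sub>F n in sequentially. approx_at K L \<eta> \<epsilon>' n"
    and traj: "\<forall>\<^sub>F n in sequentially. \<forall>E ring. edges01 n E \<longrightarrow> concentrated K \<eta> \<epsilon> n E ring \<longrightarrow> tracks K e n E ring"
    by (rule trajectory_close[OF K0 K'(2) e])
  have "\<exists>d>0. \<forall>x\<in>{0..K}. \<forall>t\<in>{0..K}. dist t x < d \<longrightarrow> dist (fc S t) (fc S x) < e" for S
    using compact_uniformly_continuous[OF continuous_fc[OF K'(2), of S] compact_Icc] e unfolding uniformly_continuous_on_def by blast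
  then obtain d' where d': "\<And>S. 0 < d' S" "\<And>S x t. x \<in> {0..K} \<Longrightarrow> t \<in> {0..K} \<Longrightarrow> dist t x < d' S \<Longrightarrow> dist (fc S t) (fc S x) < e"
    by metis
  define d where "d = min (d' Red) (d' Black)"
  have d: "0 < d" using d' by (simp add: d_def)
  have uc: "\<bar>fc S t - fc S x\<bar> \<le> e" if "x \<in> {0..K}" "t \<in> {0..K}" "\<bar>t - x\<bar> < d" for S x t
    using d'(2)[OF that(1,2), of S] that(3) by (cases S) (auto simp: d_def dist_real_def simp del: component.simps)
  have lim: "\<forall>\<^sub>F n in sequentially. 1 / q n < c" if "0 < c" for c by (rule order_tendstoD(2)[OF inv_q that])
  have lK: "\<forall>\<^sub>F n in sequentially. 1 / q n < K - \<kappa>" by (rule lim) (use K' in simp)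
  \<comment> \<open>Edges are 0 or 1 only almost surely; one null set serves for all sizes.\<close>
  have "AE \<omega> in M. \<forall>n\<in>{1..}. \<forall>v\<in>{..<n_W a n}. \<forall>S. \<forall>i\<ge>1. edges_of n \<omega> S v i = 0 \<or> edges_of n \<omega> S v i = 1"
  proof (rule AE_ball_countable')
    fix n :: nat assume "n \<in> {1..}"
    then interpret I: inputs_at M p a X n r by (intro inputs_at) simp
    show "AE \<omega> in M. \<forall>v\<in>{..<n_W a n}. \<forall>S. \<forall>i\<ge>1. edges_of n \<omega> S v i = 0 \<or> edges_of n \<omega> S v i = 1"
      by (rule I.AE_edge01)
  qed simp
  with AE_concentrated[OF K0 K'(2) h appr] show ?thesis
  proof eventually_elim
    fix \<omega>
    assume c: "\<forall>\<^sub>F n in sequentially. conc K \<eta> \<epsilon> n \<omega>"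
      and E01: "\<forall>n\<in>{1..}. \<forall>v\<in>{..<n_W a n}. \<forall>S. \<forall>i\<ge>1. edges_of n \<omega> S v i = 0 \<or> edges_of n \<omega> S v i = 1"
    show "\<forall>\<^sub>F n in sequentially. \<forall>x\<in>{0..\<kappa>}. norm (F r a q X n \<omega> x - f x) \<le> 6 * e"
      using c traj q_pos lim[OF e] lim[OF d] lK ev_ge[of 1]
    proof eventually_elim
      case (elim n)
      show ?case
      proof
        fix x assume x: "x \<in> {0..\<kappa>}"
        have "edges01 n (edges_of n \<omega>)"
          using E01 elim by (auto simp: edges01_def)
        then show "norm (F r a q X n \<omega> x - f x) \<le> 6 * e"
          using elim by (intro F_close[OF K(1) K'(1,2) _ _ _ _ _ uc x]) auto
      qed
    qed
  qed
qed

end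

theorem theorem4p2:
  fixes M :: "'a measure"
    and X :: "input \<Rightarrow> 'a \<Rightarrow> real"
    and r :: nat
    and p q :: "nat \<Rightarrow> real"
    and a :: "color \<Rightarrow> nat \<Rightarrow> nat"
    and \<alpha> :: "color \<Rightarrow> real"
    and reg :: regime
    and f :: "real \<Rightarrow> real \<times> real"
    and \<kappa>\<^sub>f :: ereal
    and \<kappa> :: real
  assumes "r \<ge> 2"
    and "\<And>n. n \<ge> 1 \<Longrightarrow> 0 < p n \<and> p n < 1"
    and "(\<lambda>n. 1 / real n) \<in> o(p)"
    and "p \<in> o(\<lambda>n. 1 / (real n powr (1 / real r) * ln (real n)))"
    and "in_regime reg r p q"
    and "\<And>S. (\<lambda>n. real (a S n) / q n) \<longlonglongrightarrow> \<alpha> S"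
    and "\<alpha> Red > \<alpha> Black" and "\<alpha> Black > 0"
    and "percolation_inputs M p a X"
    and "maximal_cauchy_solution (beta reg r \<alpha>) \<kappa>\<^sub>f f"
    and "0 \<le> \<kappa>" and "ereal \<kappa> < \<kappa>\<^sub>f"
  shows "AE \<omega> in M. (\<lambda>n. SUP x\<in>{0..\<kappa>}. norm (F r a q X n \<omega> x - f x)) \<longlonglongrightarrow> 0"
proof -
  interpret percolation_setting reg r \<alpha> f \<kappa>\<^sub>f p q a M X
    using assms by unfold_locales (auto simp: maximal_cauchy_solution_def)
  \<comment> \<open>Countably many tolerances, so that a single null set works for all of
    them.\<close>
  have "AE \<omega> in M. \<forall>m. \<forall>\<^sub>F n in sequentially. \<forall>x\<in>{0..\<kappa>}. norm (F r a q X n \<omega> x - f x) \<le> 6 * inverse (real (Suc m))"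
    unfolding AE_all_countable using assms by (intro allI AE_uniformly_close) auto
  then show ?thesis
  proof eventually_elim
    fix \<omega>
    let ?N = "\<lambda>n x. norm (F r a q X n \<omega> x - f x)"
    assume ev: "\<forall>m. \<forall>\<^sub>F n in sequentially. \<forall>x\<in>{0..\<kappa>}. ?N n x \<le> 6 * inverse (real (Suc m))"
    show "(\<lambda>n. SUP x\<in>{0..\<kappa>}. ?N n x) \<longlonglongrightarrow> 0"
    proof (rule tendstoI)
      fix e :: real assume "0 < e"
      then obtain m where m: "inverse (real (Suc m)) < e / 6" using reals_Archimedean[of "e / 6"] by auto
      from ev have "\<forall>\<^sub>F n in sequentially. \<forall>x\<in>{0..\<kappa>}. ?N n x \<le> 6 * inverse (real (Suc m))" ..
      then show "\<forall>\<^sub>F n in sequentially. dist (SUP x\<in>{0..\<kappa>}. ?N n x) 0 < e"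
      proof eventually_elim
        fix n assume b: "\<forall>x\<in>{0..\<kappa>}. ?N n x \<le> 6 * inverse (real (Suc m))"
        have ne: "{0..\<kappa>} \<noteq> {}" using \<open>0 \<le> \<kappa>\<close> by simp
        have "(SUP x\<in>{0..\<kappa>}. ?N n x) \<le> 6 * inverse (real (Suc m))"
          using b by (intro cSUP_least[OF ne]) auto
        \<comment> \<open>The uniform bound makes the set bounded above, as the supremum over the
          reals requires; evaluation at 0 then shows that the supremum is nonnegative.\<close>
        moreover have "?N n 0 \<le> (SUP x\<in>{0..\<kappa>}. ?N n x)"
          using b \<open>0 \<le> \<kappa>\<close> by (intro cSUP_upper bdd_aboveI2[where M="6 * inverse (real (Suc m))"]) auto
        then have "0 \<le> (SUP x\<in>{0..\<kappa>}. ?N n x)" by (rule order.trans[OF norm_ge_zero])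
        ultimately show "dist (SUP x\<in>{0..\<kappa>}. ?N n x) 0 < e" using m by (simp add: dist_real_def)
      qed
    qed
  qed
qed

end
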